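(* The derivation operator $D$, with domain $\mathcal{S}\subseteq\mathcal{B}(\mathfrak{H})$, is a closable operator from $\mathcal{B}(\mathfrak{H})$ to the $\mathcal{B}(\mathfrak{H})$-Hilbert module $\mathfrak{M}=\mathcal{B}(\mathfrak{H},\mathfrak{H}\otimes\mathfrak{h}_{\mathbb C}\otimes\mathbb{C}^2)$ with respect to the weak topologies.
   Context: $\mathfrak{h}$ is a real separable Hilbert space, $\mathfrak{h}_{\mathbb C}$ its complexification with conjugation, $\mathfrak{H}=\Gamma_s(\mathfrak{h}_{\mathbb C})$ the symmetric Fock space with exponential vectors $\mathcal{E}(k)=\sum_n k^{\otimes n}/\sqrt{n!}$, inner products linear in the second argument; pairs $h=(h_1,h_2)$ denote elements of $\mathfrak{h}\otimes\mathbb{R}^2$ or $\mathfrak{h}_{\mathbb C}\otimes\mathbb{C}^2$. With $[a(h),a^+(k)]=\langle h,k\rangle$ set $Q(h)=a(\overline h)+a^+(h)$, $P(h)=i(a(\overline h)-a^+(h))$, $U(h_1,h_2)=\exp(iP(h_1)+iQ(h_2))$. For $h\in\mathfrak{h}\otimes\mathbb{R}^2$, $\mathrm{Dom}\,O_h$ is the set of $\varphi:\mathbb{R}^2\to\mathbb{C}$ for which there is $M=:O_h(\varphi)\in\mathcal{B}(\mathfrak{H})$ with $\langle\mathcal{E}(k_1),M\mathcal{E}(k_2)\rangle=\frac1{2\pi}\int\langle\mathcal{E}(k_1),U(uh_1,vh_2)\mathcal{E}(k_2)\rangle\mathcal{F}^{-1}\varphi(u,v)\mathrm{d}u\mathrm{d}v$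 for all $k_1,k_2\in\mathfrak{h}_{\mathbb C}$, where $\mathcal{F}^{-1}\varphi(x,y)=\frac1{2\pi}\int\varphi(u,v)e^{-i(ux+vy)}\mathrm{d}u\mathrm{d}v$ (possibly a distribution). $\mathcal{S}$ is the algebra generated by all $O_h(\varphi)$ with $h\in\mathfrak{h}\otimes\mathbb{R}^2$ and $\varphi\in C^\infty(\mathbb{R}^2)$ all of whose partial derivatives (of all orders, including $0$) lie in $\mathrm{Dom}\,O_h$. $D:\mathcal{S}\to\mathcal{B}(\mathfrak{H})\otimes\mathfrak{h}_{\mathbb C}\otimes\mathbb{C}^2$ is defined by $DO_h(\varphi)=\Big(O_h\big(\tfrac{\partial\varphi}{\partial x}\big)\otimes h_1,\;O_h\big(\tfrac{\partial\varphi}{\partial y}\big)\otimes h_2\Big)$ and extended as a derivation with respect to left and right multiplication on the $\mathcal{B}(\mathfrak{H})$-factor. $\mathcal{B}(\mathfrak{H})\otimes\mathfrak{h}_{\mathbb C}\otimes\mathbb{C}^2$ is embedded into $\mathfrak{M}=\mathcal{B}(\mathfrak{H},\mathfrak{H}\otimes\mathfrak{h}_{\mathbb C}\otimes\mathbb{C}^2)$ by mapping $O\otimes k$ to $\psi\mapsto O\psi\otimes k$. Closability with respect to the weak topologies means: if $(A_n)_{n\in\mathbb{N}}\subseteq\mathcal{S}$ with $A_n\to0$ weakly and $DA_n\to\alpha\in\mathfrak{M}$ weakly, then $\alpha=0$. *)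

theory Defs
  imports "HOL-Analysis.Analysis"
begin

section \<open>Complex inner product spaces\<close>

text \<open>The real inner product underlying the norm and the topology is the real part of the
  complex one, which is linear in the second argument.\<close>

class complex_inner = real_inner +
  fixes scaleC :: "complex \<Rightarrow> 'a \<Rightarrow> 'a" (infixr \<open>*\<^sub>C\<close> 75)
    and cinner :: "'a \<Rightarrow> 'a \<Rightarrow> complex"
  assumes scaleC_add_right: "c *\<^sub>C (x + y) = c *\<^sub>C x + c *\<^sub>C y"
    and scaleC_add_left: "(c + d) *\<^sub>C x = c *\<^sub>C x + d *\<^sub>C x"
    and scaleC_scaleC: "c *\<^sub>C d *\<^sub>C x = (c * d) *\<^sub>C x"
    and scaleR_scaleC: "r *\<^sub>R x = complex_of_real r *\<^sub>C x"
    and cinner_commute: "cinner x y = cnj (cinner y x)"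
    and cinner_add_right: "cinner x (y + z) = cinner x y + cinner x z"
    and cinner_scaleC_right: "cinner x (c *\<^sub>C y) = c * cinner x y"
    and inner_eq_Re_cinner: "inner x y = Re (cinner x y)"

definition bounded_clinear :: "('a::complex_inner \<Rightarrow> 'b::complex_inner) \<Rightarrow> bool" where
  "bounded_clinear f \<longleftrightarrow> bounded_linear f \<and> (\<forall>c x. f (c *\<^sub>C x) = c *\<^sub>C f x)"

definition weak_op_tendsto ::
    "(nat \<Rightarrow> 'a::complex_inner \<Rightarrow> 'b::complex_inner) \<Rightarrow> ('a \<Rightarrow> 'b) \<Rightarrow> bool" where
  "weak_op_tendsto A B \<longleftrightarrow>
    (\<forall>\<psi> \<phi>. (\<lambda>n. cinner \<psi> (A n \<phi>)) \<longlonglongrightarrow> cinner \<psi> (B \<phi>))"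

definition weakly_closable ::
    "('a::complex_inner \<Rightarrow> 'b::complex_inner) set \<Rightarrow>
     (('a \<Rightarrow> 'b) \<Rightarrow> ('a \<Rightarrow> 'c::complex_inner)) \<Rightarrow> bool" where
  "weakly_closable S D \<longleftrightarrow>
    (\<forall>A \<alpha>. (\<forall>n::nat. A n \<in> S) \<longrightarrow> bounded_clinear \<alpha> \<longrightarrow>
       weak_op_tendsto A (\<lambda>_. 0) \<longrightarrow> weak_op_tendsto (\<lambda>n. D (A n)) \<alpha> \<longrightarrow>
       \<alpha> = (\<lambda>_. 0))"

lemma cinner_add_left: "cinner (x + y) z = cinner x z + cinner (y::'a::complex_inner) z"
  by (metis cinner_add_right cinner_commute complex_cnj_add)

lemma cinner_scaleC_left: "cinner (c *\<^sub>C x) y = cnj c * cinner x (y::'a::complex_inner)"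
  by (metis cinner_commute cinner_scaleC_right complex_cnj_mult)

lemma cinner_self: "cinner x x = complex_of_real ((norm (x::'a::complex_inner))\<^sup>2)"
proof (rule complex_eqI)
  show "Re (cinner x x) = Re (complex_of_real ((norm x)\<^sup>2))"
    by (simp add: inner_eq_Re_cinner[symmetric] power2_norm_eq_inner)
  have "Im (cinner x x) = - Im (cinner x x)"
    by (subst cinner_commute) simp
  then show "Im (cinner x x) = Im (complex_of_real ((norm x)\<^sup>2))" by simp
qed

lemma norm_scaleC: "norm (c *\<^sub>C x) = cmod c * norm (x::'a::complex_inner)"
proof -
  have "complex_of_real ((norm (c *\<^sub>C x))\<^sup>2) = (c * cnj c) * of_real ((norm x)\<^sup>2)"
    by (simp only: cinner_self[symmetric] cinner_scaleC_left cinner_scaleC_right mult_ac)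
  also have "\<dots> = of_real ((cmod c * norm x)\<^sup>2)"
    by (simp add: complex_norm_square[symmetric] power_mult_distrib)
  finally have "(norm (c *\<^sub>C x))\<^sup>2 = (cmod c * norm x)\<^sup>2"
    using of_real_eq_iff by blast
  then show ?thesis by simp
qed

lemma norm_cinner_le: "cmod (cinner x y) \<le> norm x * norm (y::'a::complex_inner)"
proof (cases "cinner x y = 0")
  case False
  define c where "c = cnj (cinner x y) / of_real (cmod (cinner x y))"
  have c: "cmod c = 1" using False by (simp add: c_def norm_divide)
  have "cinner x (c *\<^sub>C y) = of_real (cmod (cinner x y))"
    using False
    by (simp add: c_def cinner_scaleC_right divide_simps mult.commute
        complex_norm_square[symmetric] power2_eq_square del: of_real_mult)
      (metis complex_norm_square mult.commute of_real_mult power2_eq_square)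
  then have "cmod (cinner x y) = inner x (c *\<^sub>C y)" by (simp add: inner_eq_Re_cinner)
  also have "\<dots> \<le> norm x * norm (c *\<^sub>C y)" by (rule norm_cauchy_schwarz)
  finally show ?thesis by (simp add: norm_scaleC c)
qed simp

instantiation complex :: complex_inner
begin
definition "scaleC = ((*) :: complex \<Rightarrow> complex \<Rightarrow> complex)"
definition "cinner = (\<lambda>x y :: complex. cnj x * y)"
instance
  by standard (auto simp: scaleC_complex_def cinner_complex_def algebra_simps scaleR_conv_of_real
      inner_complex_def)
end

instantiation prod :: (complex_inner, complex_inner) complex_inner
begin
definition "scaleC c p = (c *\<^sub>C fst p, c *\<^sub>C snd p)"
definition "cinner p q = cinner (fst p) (fst q) + cinner (snd p) (snd q)"
instance
proof
  show "cinner x y = cnj (cinner y x)" for x y :: "'a \<times> 'b"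
    unfolding cinner_prod_def complex_cnj_add by (metis cinner_commute)
qed (auto simp: scaleC_prod_def cinner_prod_def scaleC_add_right scaleC_add_left scaleC_scaleC
      scaleR_scaleC cinner_add_right cinner_scaleC_right inner_prod_def inner_eq_Re_cinner
      algebra_simps prod_eq_iff)
end

definition square_summable :: "('i \<Rightarrow> 'v::complex_inner) \<Rightarrow> bool" where
  "square_summable f \<longleftrightarrow> (\<lambda>i. (norm (f i))\<^sup>2) summable_on UNIV"

lemma square_summable_0: "square_summable (\<lambda>_. 0)"
  by (simp add: square_summable_def)

lemma square_summable_scaleC:
  assumes "square_summable f" shows "square_summable (\<lambda>i. c *\<^sub>C f i)"
  using assms unfolding square_summable_def norm_scaleC power_mult_distrib
  by (rule summable_on_cmult_right)

lemma square_summable_add: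
  assumes "square_summable f" "square_summable g" shows "square_summable (\<lambda>i. f i + g i)"
  unfolding square_summable_def
proof (rule summable_on_comparison_test)
  show "(\<lambda>i. 2 * (norm (f i))\<^sup>2 + 2 * (norm (g i))\<^sup>2) summable_on UNIV"
    using assms unfolding square_summable_def
    by (intro summable_on_add summable_on_cmult_right)
  fix i
  have "(norm (f i + g i))\<^sup>2 \<le> (norm (f i) + norm (g i))\<^sup>2"
    by (simp add: norm_triangle_ineq power_mono)
  also have "\<dots> \<le> 2 * (norm (f i))\<^sup>2 + 2 * (norm (g i))\<^sup>2"
    using sum_squares_bound[of "norm (f i)" "norm (g i)"] by (simp add: power2_sum)
  finally show "(norm (f i + g i))\<^sup>2 \<le> 2 * (norm (f i))\<^sup>2 + 2 * (norm (g i))\<^sup>2" .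
qed auto

lemma square_summable_cinner:
  assumes "square_summable f" "square_summable g"
  shows "(\<lambda>i. cinner (f i) (g i)) summable_on UNIV"
proof (rule abs_summable_summable, rule summable_on_comparison_test)
  show "(\<lambda>i. (norm (f i))\<^sup>2 + (norm (g i))\<^sup>2) summable_on UNIV"
    using assms unfolding square_summable_def by (intro summable_on_add)
  fix i
  have "cmod (cinner (f i) (g i)) \<le> norm (f i) * norm (g i)" by (rule norm_cinner_le)
  also have "\<dots> \<le> 2 * norm (f i) * norm (g i)" by (simp add: mult.assoc)
  also have "\<dots> \<le> (norm (f i))\<^sup>2 + (norm (g i))\<^sup>2" by (rule sum_squares_bound)
  finally show "cmod (cinner (f i) (g i)) \<le> (norm (f i))\<^sup>2 + (norm (g i))\<^sup>2" .
qed auto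

lemma infsum_cinner_self:
  assumes "square_summable f"
  shows "(\<Sum>\<^sub>\<infinity>i. cinner (f i) (f i)) = of_real (\<Sum>\<^sub>\<infinity>i. (norm (f i))\<^sup>2)"
  unfolding cinner_self
  using has_sum_bounded_linear[OF bounded_linear_of_real[where 'a=complex]
      has_sum_infsum[OF assms[unfolded square_summable_def]]]
  by (simp add: infsumI)

lemma infsum_cinner_self_eq_0:
  assumes "square_summable f" "(\<Sum>\<^sub>\<infinity>i. cinner (f i) (f i)) = 0"
  shows "f i = 0"
proof -
  have "(\<Sum>\<^sub>\<infinity>i. (norm (f i))\<^sup>2) = 0"
    using assms(2) unfolding infsum_cinner_self[OF assms(1)] by (simp only: of_real_eq_0_iff)
  then have "(norm (f i))\<^sup>2 = 0"
    using assms(1) unfolding square_summable_def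
    by (intro nonneg_infsum_le_0D[of "\<lambda>i. (norm (f i))\<^sup>2" UNIV i]) auto
  then show ?thesis by simp
qed


section \<open>The one-particle space and a Hilbert basis\<close>

definition is_hilbert_basis :: "'a::real_inner set \<Rightarrow> bool" where
  "is_hilbert_basis B \<longleftrightarrow>
     pairwise orthogonal B \<and> (\<forall>x\<in>B. norm x = 1) \<and> closure (span B) = UNIV"

lemma orthonormal_insert:
  fixes x :: "'a::real_inner"
  assumes "finite B" "pairwise orthogonal B" "\<forall>x\<in>B. norm x = 1"
  shows "\<exists>C. finite C \<and> B \<subseteq> C \<and> pairwise orthogonal C \<and> (\<forall>x\<in>C. norm x = 1) \<and> x \<in> span C"
proof (cases "x \<in> span B")
  case False
  define y where "y = x - (\<Sum>b\<in>B. inner b x *\<^sub>R b)"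
  have s: "(\<Sum>b\<in>B. inner b x *\<^sub>R b) \<in> span B"
    by (intro span_sum span_scale span_base)
  then have "y \<noteq> 0" using False by (auto simp: y_def)
  have orth: "inner y b = 0" if "b \<in> B" for b
  proof -
    have "inner c b = (if c = b then 1 else 0)" if "c \<in> B" for c
      using assms(2,3) that \<open>b \<in> B\<close>
      by (auto simp: pairwise_def orthogonal_def norm_eq_1)
    then have "(\<Sum>c\<in>B. inner c x * inner c b) = (\<Sum>c\<in>B. if c = b then inner c x else 0)"
      by (intro sum.cong) auto
    then show ?thesis
      using that assms(1)
      by (simp add: y_def inner_diff_left inner_sum_left inner_commute[of x b])
  qed
  define C where "C = insert (y /\<^sub>R norm y) B"
  have "x = norm y *\<^sub>R (y /\<^sub>R norm y) + (\<Sum>b\<in>B. inner b x *\<^sub>R b)"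
    using \<open>y \<noteq> 0\<close> by (simp add: y_def)
  moreover have "\<dots> \<in> span C"
  proof (rule span_add, rule span_scale)
    show "y /\<^sub>R norm y \<in> span C" by (rule span_base) (simp add: C_def)
    show "(\<Sum>b\<in>B. inner b x *\<^sub>R b) \<in> span C"
      using s span_mono[of B C] by (auto simp: C_def)
  qed
  ultimately have "x \<in> span C" by simp
  moreover have "pairwise orthogonal C"
    using assms(2) orth by (auto simp: C_def pairwise_insert orthogonal_def inner_commute)
  moreover have "\<forall>x\<in>C. norm x = 1" using assms(3) \<open>y \<noteq> 0\<close> by (auto simp: C_def)
  ultimately show ?thesis using assms(1) by (intro exI[of _ C]) (auto simp: C_def)
qed (use assms in blast)

lemma hilbert_basis_exists: "\<exists>B :: 'a::{real_inner, polish_space} set. is_hilbert_basis B"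
proof -
  obtain D :: "'a set" where D: "countable D" "\<And>X. open X \<Longrightarrow> X \<noteq> {} \<Longrightarrow> \<exists>d\<in>D. d \<in> X"
    using countable_dense_exists by blast
  then have "D \<noteq> {}" by (metis UNIV_not_empty empty_iff open_UNIV)
  define e where "e = from_nat_into D"
  have e: "range e = D" using D(1) \<open>D \<noteq> {}\<close> by (simp add: e_def range_from_nat_into)
  define P where "P = (\<lambda>B :: 'a set. finite B \<and> pairwise orthogonal B \<and> (\<forall>x\<in>B. norm x = 1))"
  have "\<exists>f. \<forall>n. P (f n) \<and> (f n \<subseteq> f (Suc n) \<and> e n \<in> span (f (Suc n)))"
  proof (rule dependent_nat_choice)
    show "\<exists>B. P B" by (rule exI[of _ "{}"]) (simp add: P_def)
    show "\<exists>C. P C \<and> B \<subseteq> C \<and> e n \<in> span C" if "P B" for B n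
      using orthonormal_insert[of B "e n"] that unfolding P_def by blast
  qed
  then obtain f where f: "\<And>n. P (f n)" "\<And>n. f n \<subseteq> f (Suc n)" "\<And>n. e n \<in> span (f (Suc n))"
    by blast
  have mono: "f m \<subseteq> f n" if "m \<le> n" for m n using f(2) that by (rule lift_Suc_mono_le)
  define B where "B = (\<Union>n. f n)"
  have "orthogonal x y" if xy: "x \<in> B" "y \<in> B" "x \<noteq> y" for x y
  proof -
    obtain m n where "x \<in> f m" "y \<in> f n" using xy unfolding B_def by blast
    then have "x \<in> f (max m n)" "y \<in> f (max m n)"
      using mono[of m "max m n"] mono[of n "max m n"] by auto
    then show ?thesis using f(1)[of "max m n"] xy(3) by (auto simp: P_def pairwise_def)
  qed
  moreover have "\<forall>x\<in>B. norm x = 1" using f(1) by (auto simp: B_def P_def)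
  moreover have "D \<subseteq> span B"
  proof
    fix d assume "d \<in> D"
    then obtain n where "d = e n" using e by blast
    then show "d \<in> span B"
      using f(3)[of n] span_mono[of "f (Suc n)" B] by (auto simp: B_def)
  qed
  then have "closure D \<subseteq> closure (span B)" by (rule closure_mono)
  moreover have "closure D = UNIV"
  proof -
    have "\<exists>d\<in>D. d \<in> - closure D" if "- closure D \<noteq> {}"
      using that by (intro D(2)) auto
    then show ?thesis using closure_subset by blast
  qed
  ultimately show ?thesis unfolding is_hilbert_basis_def pairwise_def by (intro exI[of _ B]) auto
qed

text \<open>A fixed Hilbert basis, used only to write tensors as square-summable coefficient families.\<close>

definition hbasis :: "'a::{real_inner, polish_space} set" where
  "hbasis = (SOME B. is_hilbert_basis B)"

lemma is_hilbert_basis_hbasis: "is_hilbert_basis hbasis"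
  unfolding hbasis_def by (rule someI_ex) (rule hilbert_basis_exists)

text \<open>The element \<open>Cpx x y\<close> of the complexification stands for \<open>x + \<i>y\<close>.\<close>

datatype 'a complexification = Cpx (hRe: 'a) (hIm: 'a)

definition of_h :: "'a::real_inner \<Rightarrow> 'a complexification" where
  "of_h x = Cpx x 0"

definition conj_h :: "'a::real_inner complexification \<Rightarrow> 'a complexification" where
  "conj_h k = Cpx (hRe k) (- hIm k)"

definition hinner :: "'a::real_inner complexification \<Rightarrow> 'a complexification \<Rightarrow> complex" where
  "hinner k l = Complex (inner (hRe k) (hRe l) + inner (hIm k) (hIm l))
                        (inner (hRe k) (hIm l) - inner (hIm k) (hRe l))"

lemma bessel_real:
  fixes k :: "'a::real_inner"
  assumes "finite S" "pairwise orthogonal S" "\<forall>x\<in>S. norm x = 1"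
  shows "(\<Sum>x\<in>S. (inner x k)\<^sup>2) \<le> (norm k)\<^sup>2"
proof -
  let ?p = "\<Sum>x\<in>S. inner x k *\<^sub>R x"
  have d: "inner y x = (if y = x then 1 else 0)" if "x \<in> S" "y \<in> S" for x y
    using assms(2,3) that by (auto simp: pairwise_def orthogonal_def norm_eq_1)
  have "inner ?p ?p = (\<Sum>x\<in>S. \<Sum>y\<in>S. inner x k * (inner y k * inner y x))"
    by (simp add: inner_sum_left inner_sum_right sum_distrib_left mult_ac inner_commute)
  also have "\<dots> = (\<Sum>x\<in>S. \<Sum>y\<in>S. if y = x then inner x k * inner x k else 0)"
    by (intro sum.cong refl) (simp add: d)
  also have "\<dots> = (\<Sum>x\<in>S. (inner x k)\<^sup>2)" using assms(1) by (simp add: power2_eq_square)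
  finally have pp: "inner ?p ?p = (\<Sum>x\<in>S. (inner x k)\<^sup>2)" .
  have pk: "inner ?p k = (\<Sum>x\<in>S. (inner x k)\<^sup>2)"
    by (simp add: inner_sum_left power2_eq_square)
  have "0 \<le> inner (k - ?p) (k - ?p)" by simp
  also have "\<dots> = inner k k - (\<Sum>x\<in>S. (inner x k)\<^sup>2)"
    using pp pk by (simp add: inner_diff_left inner_diff_right inner_commute)
  finally show ?thesis by (simp add: power2_norm_eq_inner)
qed

lemma bessel:
  fixes k :: "'a::{real_inner, polish_space} complexification"
  assumes "finite S" "S \<subseteq> hbasis"
  shows "(\<Sum>x\<in>S. (cmod (hinner (of_h x) k))\<^sup>2) \<le> (norm (hRe k))\<^sup>2 + (norm (hIm k))\<^sup>2"
proof -
  have "pairwise orthogonal S" "\<forall>x\<in>S. norm x = 1"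
    using is_hilbert_basis_hbasis assms(2) pairwise_subset
    unfolding is_hilbert_basis_def by blast+
  note b = bessel_real[OF assms(1) this]
  have "(\<Sum>x\<in>S. (cmod (hinner (of_h x) k))\<^sup>2)
      = (\<Sum>x\<in>S. (inner x (hRe k))\<^sup>2) + (\<Sum>x\<in>S. (inner x (hIm k))\<^sup>2)"
    by (simp add: hinner_def of_h_def cmod_power2 sum.distrib)
  then show ?thesis using b[of "hRe k"] b[of "hIm k"] by simp
qed


section \<open>The symmetric Fock space\<close>

text \<open>The basis identifies the \<open>n\<close>-th tensor power of the complexification with the
  square-summable families indexed by words of length \<open>n\<close> over \<^const>\<open>hbasis\<close>; the coefficient
  at \<open>[x\<^sub>1, \<dots>, x\<^sub>n]\<close> is the inner product with the tensor of the \<open>x\<^sub>i\<close>.  Symmetric tensors are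
  the families invariant under permutations of the letters.\<close>

definition fock_coeffs :: "('a::{real_inner, polish_space} list \<Rightarrow> complex) set" where
  "fock_coeffs = {F. (\<forall>xs. \<not> set xs \<subseteq> hbasis \<longrightarrow> F xs = 0) \<and>
                     (\<forall>xs ys. mset xs = mset ys \<longrightarrow> F xs = F ys) \<and> square_summable F}"

lemma fock_coeffs_0: "(\<lambda>_. 0) \<in> fock_coeffs"
  by (simp add: fock_coeffs_def square_summable_0)

lemma fock_coeffs_add: "F \<in> fock_coeffs \<Longrightarrow> G \<in> fock_coeffs \<Longrightarrow> (\<lambda>xs. F xs + G xs) \<in> fock_coeffs"
  unfolding fock_coeffs_def mem_Collect_eq
  by (intro conjI allI impI) (simp, metis, blast intro: square_summable_add)

lemma fock_coeffs_scale: "F \<in> fock_coeffs \<Longrightarrow> (\<lambda>xs. c * F xs) \<in> fock_coeffs"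
  unfolding fock_coeffs_def mem_Collect_eq
  by (intro conjI allI impI)
    (simp, metis, metis square_summable_scaleC[of F c, unfolded scaleC_complex_def])

typedef (overloaded) ('a::"{real_inner, polish_space}") fock =
  "fock_coeffs :: ('a list \<Rightarrow> complex) set"
  using fock_coeffs_0 by blast

setup_lifting type_definition_fock

lemma square_summable_Rep_fock: "square_summable (Rep_fock F)"
  using Rep_fock[of F] by (simp add: fock_coeffs_def)

instantiation fock :: ("{real_inner, polish_space}") complex_inner
begin
lift_definition zero_fock :: "'a fock" is "\<lambda>_. 0" by (rule fock_coeffs_0)
lift_definition plus_fock :: "'a fock \<Rightarrow> 'a fock \<Rightarrow> 'a fock" is "\<lambda>F G xs. F xs + G xs"
  by (rule fock_coeffs_add)
lift_definition scaleC_fock :: "complex \<Rightarrow> 'a fock \<Rightarrow> 'a fock" is "\<lambda>c F xs. c * F xs"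
  by (rule fock_coeffs_scale)
lift_definition cinner_fock :: "'a fock \<Rightarrow> 'a fock \<Rightarrow> complex"
  is "\<lambda>F G. \<Sum>\<^sub>\<infinity>xs. cnj (F xs) * G xs" .
definition "scaleR_fock r (F::'a fock) = complex_of_real r *\<^sub>C F"
definition "uminus_fock (F::'a fock) = (-1) *\<^sub>C F"
definition "minus_fock (F::'a fock) G = F + (-1) *\<^sub>C G"
definition "inner_fock (F::'a fock) G = Re (cinner F G)"
definition "norm_fock (F::'a fock) = sqrt (inner F F)"
definition "dist_fock (F::'a fock) G = norm (F - G)"
definition "sgn_fock (F::'a fock) = inverse (norm F) *\<^sub>R F"
definition "uniformity_fock =
  (INF e\<in>{0<..}. principal {(F::'a fock, G). dist F G < e})"
definition "open_fock (U :: 'a fock set) \<longleftrightarrow>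
  (\<forall>x\<in>U. eventually (\<lambda>(x', y). x' = x \<longrightarrow> y \<in> U) uniformity)"

instance
proof
  fix F G H :: "'a fock" and c d :: complex and r s :: real
  note su = square_summable_cinner[OF square_summable_Rep_fock square_summable_Rep_fock,
      unfolded cinner_complex_def]
  show "F + G + H = F + (G + H)" "F + G = G + F" "0 + F = F"
    by (transfer; simp add: add_ac)+
  show "- F + F = 0" "F - G = F + - G"
    unfolding uminus_fock_def minus_fock_def by (transfer; simp)+
  show "r *\<^sub>R (F + G) = r *\<^sub>R F + r *\<^sub>R G" "(r + s) *\<^sub>R F = r *\<^sub>R F + s *\<^sub>R F"
    "r *\<^sub>R s *\<^sub>R F = (r * s) *\<^sub>R F" "1 *\<^sub>R F = F"
    unfolding scaleR_fock_def by (transfer; simp add: algebra_simps)+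
  show "c *\<^sub>C (F + G) = c *\<^sub>C F + c *\<^sub>C G" "(c + d) *\<^sub>C F = c *\<^sub>C F + d *\<^sub>C F"
    "c *\<^sub>C d *\<^sub>C F = (c * d) *\<^sub>C F" "r *\<^sub>R F = complex_of_real r *\<^sub>C F"
    unfolding scaleR_fock_def by (transfer; simp add: algebra_simps)+
  show cc: "cinner F G = cnj (cinner G F)" for F G :: "'a fock"
    unfolding cinner_fock.rep_eq infsum_cnj[symmetric] by (simp add: mult.commute)
  show ca: "cinner F (G + H) = cinner F G + cinner F H" for F G H :: "'a fock"
    unfolding cinner_fock.rep_eq plus_fock.rep_eq distrib_left
    by (rule infsum_add) (rule su)+
  show cs: "cinner F (c *\<^sub>C G) = c * cinner F G" for c F and G :: "'a fock"
    unfolding cinner_fock.rep_eq scaleC_fock.rep_eq mult.left_commute[of _ c]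
    by (rule infsum_cmult_right) (rule su)
  show "inner F G = Re (cinner F G)" by (rule inner_fock_def)
  show "inner F G = inner G F" unfolding inner_fock_def by (subst cc) simp
  have cal: "cinner (F + G) H = cinner F H + cinner G H" by (metis ca cc complex_cnj_add)
  show "inner (F + G) H = inner F H + inner G H" by (simp add: inner_fock_def cal)
  have "cinner (r *\<^sub>R F) G = r * cinner F G"
    unfolding scaleR_fock_def by (metis cc cs complex_cnj_mult complex_cnj_complex_of_real)
  then show "inner (r *\<^sub>R F) G = r * inner F G" by (simp add: inner_fock_def)
  have self: "cinner F F = of_real (\<Sum>\<^sub>\<infinity>xs. (norm (Rep_fock F xs))\<^sup>2)"
    using infsum_cinner_self[OF square_summable_Rep_fock[of F]]
    by (simp add: cinner_fock.rep_eq cinner_complex_def)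
  then show "0 \<le> inner F F" by (simp add: inner_fock_def infsum_nonneg)
  show "(inner F F = 0) = (F = 0)"
  proof
    assume "inner F F = 0"
    then have "cinner F F = 0" using self by (simp add: inner_fock_def)
    then have "Rep_fock F xs = 0" for xs
      using infsum_cinner_self_eq_0[OF square_summable_Rep_fock[of F], of xs]
      by (simp add: cinner_fock.rep_eq cinner_complex_def)
    then show "F = 0" by (simp add: Rep_fock_inject[symmetric] zero_fock.rep_eq fun_eq_iff)
  next
    assume "F = 0"
    then show "inner F F = 0" by (simp add: inner_fock_def cinner_fock.rep_eq zero_fock.rep_eq)
  qed
qed (auto simp: norm_fock_def dist_fock_def sgn_fock_def uniformity_fock_def open_fock_def)
end

text \<open>Creation and annihilation operators are unbounded.  They are given by their action on
  coefficients; a vector outside the natural domain is mapped to \<open>0\<close>.\<close>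

definition to_fock :: "('a::{real_inner, polish_space} list \<Rightarrow> complex) \<Rightarrow> 'a fock" where
  "to_fock F = (if F \<in> fock_coeffs then Abs_fock F else 0)"

definition annihilation ::
    "'a::{real_inner, polish_space} complexification \<Rightarrow> 'a fock \<Rightarrow> 'a fock" where
  "annihilation h F = to_fock (\<lambda>xs.
     of_real (sqrt (length xs + 1)) *
     (\<Sum>\<^sub>\<infinity>x\<in>hbasis. cnj (hinner (of_h x) h) * Rep_fock F (x # xs)))"

text \<open>On \<open>n\<close>-particle vectors, creation is \<open>\<surd>(n + 1)\<close> times the symmetrised tensor product
  with \<open>h\<close>.\<close>

definition creation ::
    "'a::{real_inner, polish_space} complexification \<Rightarrow> 'a fock \<Rightarrow> 'a fock" where
  "creation h F = to_fock (\<lambda>xs. if set xs \<subseteq> hbasis then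
     (\<Sum>i<length xs. hinner (of_h (xs ! i)) h * Rep_fock F (take i xs @ drop (Suc i) xs))
       / of_real (sqrt (length xs)) else 0)"

definition Q_op :: "'a::{real_inner, polish_space} complexification \<Rightarrow> 'a fock \<Rightarrow> 'a fock" where
  "Q_op h F = annihilation (conj_h h) F + creation h F"

definition P_op :: "'a::{real_inner, polish_space} complexification \<Rightarrow> 'a fock \<Rightarrow> 'a fock" where
  "P_op h F = \<i> *\<^sub>C (annihilation (conj_h h) F - creation h F)"

text \<open>\<open>exp(\<i>P(h\<^sub>1) + \<i>Q(h\<^sub>2))\<close> by its power series.  Exponential vectors, the only vectors it is
  applied to below, are entire analytic vectors for the exponent.\<close>

definition weyl :: "'a::{real_inner, polish_space} complexification \<Rightarrow> 'a complexification \<Rightarrow>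
    'a fock \<Rightarrow> 'a fock" where
  "weyl h1 h2 F = (\<Sum>n. (1 / fact n) *\<^sub>R ((\<lambda>G. \<i> *\<^sub>C P_op h1 G + \<i> *\<^sub>C Q_op h2 G) ^^ n) F)"

lemma sum_prod_list:
  fixes g :: "'b \<Rightarrow> real"
  assumes "finite S"
  shows "(\<Sum>xs | set xs \<subseteq> S \<and> length xs = n. prod_list (map g xs)) = (sum g S) ^ n"
proof (induction n)
  case 0
  have "{xs. set xs \<subseteq> S \<and> length xs = 0} = {[]}" by auto
  then show ?case by simp
next
  case (Suc n)
  let ?L = "{xs. set xs \<subseteq> S \<and> length xs = n}"
  have "(\<Sum>xs | set xs \<subseteq> S \<and> length xs = Suc n. prod_list (map g xs))
      = (\<Sum>p\<in>S \<times> ?L. g (fst p) * prod_list (map g (snd p)))"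
    by (rule sum.reindex_bij_witness[of _ "\<lambda>p. fst p # snd p" "\<lambda>xs. (hd xs, tl xs)"])
      (auto simp: length_Suc_conv)
  also have "\<dots> = (\<Sum>x\<in>S. \<Sum>xs\<in>?L. g x * prod_list (map g xs))"
    by (simp add: sum.cartesian_product case_prod_beta)
  also have "\<dots> = sum g S * (\<Sum>xs\<in>?L. prod_list (map g xs))"
    by (rule sum_product[symmetric])
  finally show ?case using Suc by simp
qed

text \<open>The \<open>n\<close>-particle component of the exponential vector is the \<open>n\<close>-th tensor power of \<open>k\<close>
  divided by \<open>\<surd>n!\<close>.\<close>

lift_definition expvec :: "'a::{real_inner, polish_space} complexification \<Rightarrow> 'a fock"
  is "\<lambda>k xs. if set xs \<subseteq> hbasis
        then prod_list (map (\<lambda>x. hinner (of_h x) k) xs) / of_real (sqrt (fact (length xs))) else 0"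
proof -
  fix k :: "'a complexification"
  let ?F = "\<lambda>xs. if set xs \<subseteq> hbasis
        then prod_list (map (\<lambda>x. hinner (of_h x) k) xs) / complex_of_real (sqrt (fact (length xs)))
        else 0"
  define g where "g x = (cmod (hinner (of_h x) k))\<^sup>2" for x :: 'a
  define K where "K = (norm (hRe k))\<^sup>2 + (norm (hIm k))\<^sup>2"
  have pl: "(cmod (prod_list (map (\<lambda>x. hinner (of_h x) k) xs)))\<^sup>2 = prod_list (map g xs)" for xs
    by (induction xs) (auto simp: g_def norm_mult power_mult_distrib)
  have F2: "(norm (?F xs))\<^sup>2 =
      (if set xs \<subseteq> hbasis then prod_list (map g xs) / fact (length xs) else 0)" for xs
    by (simp add: norm_divide power_divide pl)
  have pos: "0 \<le> prod_list (map g xs)" for xs by (induction xs) (auto simp: g_def)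
  have bound: "(\<Sum>xs\<in>X. (norm (?F xs))\<^sup>2) \<le> exp K" if X: "finite X" for X
  proof -
    define S where "S = (\<Union>xs\<in>X. set xs) \<inter> hbasis"
    have S: "finite S" "S \<subseteq> hbasis" using that by (auto simp: S_def)
    obtain N where N: "\<And>xs. xs \<in> X \<Longrightarrow> length xs < N"
      using finite_imageI[OF X, of length] by (auto simp: finite_nat_set_iff_bounded)
    let ?L = "\<lambda>n. {xs. set xs \<subseteq> S \<and> length xs = n}"
    have fL: "finite (?L n)" for n using finite_lists_length_eq[OF S(1)] by simp
    have "(\<Sum>xs\<in>X. (norm (?F xs))\<^sup>2) = (\<Sum>xs\<in>{xs\<in>X. set xs \<subseteq> hbasis}. (norm (?F xs))\<^sup>2)"
      using that by (intro sum.mono_neutral_right) (auto simp: F2)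
    also have "\<dots> \<le> (\<Sum>xs\<in>(\<Union>n<N. ?L n). (norm (?F xs))\<^sup>2)"
      using fL N by (intro sum_mono2) (auto simp: S_def)
    also have "\<dots> = (\<Sum>n<N. \<Sum>xs\<in>?L n. (norm (?F xs))\<^sup>2)"
      using fL by (intro sum.UNION_disjoint) auto
    also have "\<dots> = (\<Sum>n<N. (sum g S) ^ n / fact n)"
    proof (intro sum.cong refl)
      fix n
      have "(\<Sum>xs\<in>?L n. (norm (?F xs))\<^sup>2) = (\<Sum>xs\<in>?L n. prod_list (map g xs) / fact n)"
        unfolding F2 using S(2) by (intro sum.cong) auto
      also have "\<dots> = (sum g S) ^ n / fact n"
        using sum_prod_list[OF S(1), of g n]
        by (simp add: sum_divide_distrib[symmetric] g_def)
      finally show "(\<Sum>xs\<in>?L n. (norm (?F xs))\<^sup>2) = (sum g S) ^ n / fact n" .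
    qed
    also have "\<dots> \<le> (\<Sum>n<N. K ^ n / fact n)"
      using bessel[OF S, of k]
      by (intro sum_mono divide_right_mono power_mono) (auto simp: g_def K_def sum_nonneg)
    also have "\<dots> \<le> exp K"
      using sum_le_suminf[OF sums_summable[OF exp_converges[of K]], of "{..<N}"]
        sums_unique[OF exp_converges[of K]]
      by (simp add: K_def divide_inverse mult.commute)
    finally show ?thesis .
  qed
  have "square_summable ?F" unfolding square_summable_def
  proof (rule nonneg_bdd_above_summable_on)
    show "bdd_above (sum (\<lambda>xs. (norm (?F xs))\<^sup>2) ` {X. X \<subseteq> UNIV \<and> finite X})"
      by (rule bdd_aboveI2[of _ _ "exp K"], rule bound) simp
  qed simp
  moreover have "?F xs = ?F ys" if m: "mset xs = mset ys" for xs ys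
  proof -
    have "prod_list (map (\<lambda>x. hinner (of_h x) k) xs) = prod_list (map (\<lambda>x. hinner (of_h x) k) ys)"
      unfolding prod_mset_prod_list[symmetric] mset_map m ..
    then show ?thesis by (simp only: mset_eq_setD[OF m] mset_eq_length[OF m])
  qed
  moreover have "?F xs = 0" if "\<not> set xs \<subseteq> hbasis" for xs using that by (rule if_not_P)
  ultimately show "?F \<in> fock_coeffs" unfolding fock_coeffs_def mem_Collect_eq by blast
qed


section \<open>The tensor product of the Fock space with the one-particle space\<close>

text \<open>An element is represented by its components along \<^const>\<open>hbasis\<close>, which are vectors of the
  Fock space.\<close>

definition fock_h_coeffs :: "('a::{real_inner, polish_space} \<Rightarrow> 'a fock) set" where
  "fock_h_coeffs = {\<Psi>. (\<forall>x. x \<notin> hbasis \<longrightarrow> \<Psi> x = 0) \<and> square_summable \<Psi>}"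

lemma fock_h_coeffs_0: "(\<lambda>_. 0) \<in> fock_h_coeffs"
  by (simp add: fock_h_coeffs_def square_summable_0)

lemma fock_h_coeffs_add:
  "F \<in> fock_h_coeffs \<Longrightarrow> G \<in> fock_h_coeffs \<Longrightarrow> (\<lambda>x. F x + G x) \<in> fock_h_coeffs"
  by (auto simp: fock_h_coeffs_def square_summable_add)

lemma scaleC_0_right [simp]: "c *\<^sub>C (0::'a::complex_inner) = 0"
  using norm_scaleC[of c "0::'a"] by simp

lemma scaleC_1 [simp]: "1 *\<^sub>C x = (x::'a::complex_inner)"
  using scaleR_scaleC[of 1 x] by simp

lemma scaleC_minus_1 [simp]: "(-1) *\<^sub>C x = - (x::'a::complex_inner)"
  using scaleR_scaleC[of "-1" x] by simp

lemma fock_h_coeffs_scale: "F \<in> fock_h_coeffs \<Longrightarrow> (\<lambda>x. c *\<^sub>C F x) \<in> fock_h_coeffs"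
  by (auto simp: fock_h_coeffs_def square_summable_scaleC)

typedef (overloaded) ('a::"{real_inner, polish_space}") fock_h =
  "fock_h_coeffs :: ('a \<Rightarrow> 'a fock) set"
  using fock_h_coeffs_0 by blast

lifting_forget fock.lifting

setup_lifting type_definition_fock_h

lemma square_summable_Rep_fock_h: "square_summable (Rep_fock_h F)"
  using Rep_fock_h[of F] by (simp add: fock_h_coeffs_def)

instantiation fock_h :: ("{real_inner, polish_space}") complex_inner
begin
lift_definition zero_fock_h :: "'a fock_h" is "\<lambda>_. 0" by (rule fock_h_coeffs_0)
lift_definition plus_fock_h :: "'a fock_h \<Rightarrow> 'a fock_h \<Rightarrow> 'a fock_h" is "\<lambda>F G x. F x + G x"
  by (rule fock_h_coeffs_add)
lift_definition scaleC_fock_h :: "complex \<Rightarrow> 'a fock_h \<Rightarrow> 'a fock_h" is "\<lambda>c F x. c *\<^sub>C F x"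
  by (rule fock_h_coeffs_scale)
lift_definition cinner_fock_h :: "'a fock_h \<Rightarrow> 'a fock_h \<Rightarrow> complex"
  is "\<lambda>F G. \<Sum>\<^sub>\<infinity>x. cinner (F x) (G x)" .
definition "scaleR_fock_h r (F::'a fock_h) = complex_of_real r *\<^sub>C F"
definition "uminus_fock_h (F::'a fock_h) = (-1) *\<^sub>C F"
definition "minus_fock_h (F::'a fock_h) G = F + (-1) *\<^sub>C G"
definition "inner_fock_h (F::'a fock_h) G = Re (cinner F G)"
definition "norm_fock_h (F::'a fock_h) = sqrt (inner F F)"
definition "dist_fock_h (F::'a fock_h) G = norm (F - G)"
definition "sgn_fock_h (F::'a fock_h) = inverse (norm F) *\<^sub>R F"
definition "uniformity_fock_h =
  (INF e\<in>{0<..}. principal {(F::'a fock_h, G). dist F G < e})"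
definition "open_fock_h (U :: 'a fock_h set) \<longleftrightarrow>
  (\<forall>x\<in>U. eventually (\<lambda>(x', y). x' = x \<longrightarrow> y \<in> U) uniformity)"

instance
proof
  fix F G H :: "'a fock_h" and c d :: complex and r s :: real
  note su = square_summable_cinner[OF square_summable_Rep_fock_h square_summable_Rep_fock_h]
  show "F + G + H = F + (G + H)" "F + G = G + F" "0 + F = F"
    by (transfer; simp add: add_ac)+
  show "- F + F = 0" "F - G = F + - G"
    unfolding uminus_fock_h_def minus_fock_h_def by (transfer; simp)+
  show "r *\<^sub>R (F + G) = r *\<^sub>R F + r *\<^sub>R G" "(r + s) *\<^sub>R F = r *\<^sub>R F + s *\<^sub>R F"
    "r *\<^sub>R s *\<^sub>R F = (r * s) *\<^sub>R F" "1 *\<^sub>R F = F"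
    unfolding scaleR_fock_h_def
    by (transfer; simp add: scaleC_add_right scaleC_add_left scaleC_scaleC)+
  show "c *\<^sub>C (F + G) = c *\<^sub>C F + c *\<^sub>C G" "(c + d) *\<^sub>C F = c *\<^sub>C F + d *\<^sub>C F"
    "c *\<^sub>C d *\<^sub>C F = (c * d) *\<^sub>C F" "r *\<^sub>R F = complex_of_real r *\<^sub>C F"
    unfolding scaleR_fock_h_def
    by (transfer; simp add: scaleC_add_right scaleC_add_left scaleC_scaleC)+
  show cc: "cinner F G = cnj (cinner G F)" for F G :: "'a fock_h"
    unfolding cinner_fock_h.rep_eq infsum_cnj[symmetric]
    by (rule infsum_cong) (rule cinner_commute)
  show ca: "cinner F (G + H) = cinner F G + cinner F H" for F G H :: "'a fock_h"
    unfolding cinner_fock_h.rep_eq plus_fock_h.rep_eq cinner_add_right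
    by (rule infsum_add) (rule su)+
  show cs: "cinner F (c *\<^sub>C G) = c * cinner F G" for c F and G :: "'a fock_h"
    unfolding cinner_fock_h.rep_eq scaleC_fock_h.rep_eq cinner_scaleC_right
    by (rule infsum_cmult_right) (rule su)
  show "inner F G = Re (cinner F G)" by (rule inner_fock_h_def)
  show "inner F G = inner G F" unfolding inner_fock_h_def by (subst cc) simp
  have cal: "cinner (F + G) H = cinner F H + cinner G H" by (metis ca cc complex_cnj_add)
  show "inner (F + G) H = inner F H + inner G H" by (simp add: inner_fock_h_def cal)
  have "cinner (r *\<^sub>R F) G = r * cinner F G"
    unfolding scaleR_fock_h_def by (metis cc cs complex_cnj_mult complex_cnj_complex_of_real)
  then show "inner (r *\<^sub>R F) G = r * inner F G" by (simp add: inner_fock_h_def)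
  have self: "cinner F F = of_real (\<Sum>\<^sub>\<infinity>x. (norm (Rep_fock_h F x))\<^sup>2)"
    using infsum_cinner_self[OF square_summable_Rep_fock_h[of F]]
    by (simp add: cinner_fock_h.rep_eq)
  then show "0 \<le> inner F F" by (simp add: inner_fock_h_def infsum_nonneg)
  show "(inner F F = 0) = (F = 0)"
  proof
    assume "inner F F = 0"
    then have "cinner F F = 0" using self by (simp add: inner_fock_h_def)
    then have "Rep_fock_h F x = 0" for x
      using infsum_cinner_self_eq_0[OF square_summable_Rep_fock_h[of F], of x]
      by (simp add: cinner_fock_h.rep_eq)
    then show "F = 0" by (simp add: Rep_fock_h_inject[symmetric] zero_fock_h.rep_eq fun_eq_iff)
  next
    assume "F = 0"
    then have "Rep_fock_h F = (\<lambda>_. 0)" by (simp add: zero_fock_h.rep_eq)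
    then show "inner F F = 0" by (simp add: inner_fock_h_def self)
  qed
qed (auto simp: norm_fock_h_def dist_fock_h_def sgn_fock_h_def uniformity_fock_h_def
      open_fock_h_def)
end

lift_definition tensor_h ::
    "'a::{real_inner, polish_space} fock \<Rightarrow> 'a complexification \<Rightarrow> 'a fock_h" (infixl \<open>\<otimes>\<^sub>h\<close> 70)
  is "\<lambda>\<psi> k x. if x \<in> hbasis then hinner (of_h x) k *\<^sub>C \<psi> else 0"
proof -
  fix \<psi> :: "'a fock" and k :: "'a complexification"
  let ?K = "(norm (hRe k))\<^sup>2 + (norm (hIm k))\<^sup>2"
  have "(\<Sum>x\<in>X. (norm (if x \<in> hbasis then hinner (of_h x) k *\<^sub>C \<psi> else 0))\<^sup>2) \<le> ?K * (norm \<psi>)\<^sup>2"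
    if "finite X" for X
  proof -
    have "(\<Sum>x\<in>X. (norm (if x \<in> hbasis then hinner (of_h x) k *\<^sub>C \<psi> else 0))\<^sup>2)
        = (\<Sum>x\<in>X \<inter> hbasis. (norm (hinner (of_h x) k *\<^sub>C \<psi>))\<^sup>2)"
      using that
      by (simp add: if_distrib[of norm] if_distrib[of "\<lambda>r. r\<^sup>2"] sum.inter_restrict cong: if_cong)
    also have "\<dots> = (\<Sum>x\<in>X \<inter> hbasis. (cmod (hinner (of_h x) k))\<^sup>2) * (norm \<psi>)\<^sup>2"
      by (simp add: norm_scaleC power_mult_distrib sum_distrib_right)
    also have "\<dots> \<le> ?K * (norm \<psi>)\<^sup>2"
      using that by (intro mult_right_mono bessel) auto
    finally show ?thesis .
  qed
  then show "(\<lambda>x. if x \<in> hbasis then hinner (of_h x) k *\<^sub>C \<psi> else 0) \<in> fock_h_coeffs"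
    unfolding fock_h_coeffs_def square_summable_def
    by (auto intro!: nonneg_bdd_above_summable_on bdd_aboveI2[of _ _ "?K * (norm \<psi>)\<^sup>2"])
qed

text \<open>The operator \<open>A \<otimes> 1\<close>, for bounded \<open>A\<close>.\<close>

lift_definition ampliation ::
    "('a::{real_inner, polish_space} fock \<Rightarrow> 'a fock) \<Rightarrow> 'a fock_h \<Rightarrow> 'a fock_h"
  is "\<lambda>A \<Psi>. if bounded_clinear A then (\<lambda>x. A (\<Psi> x)) else (\<lambda>_. 0)"
proof -
  fix A :: "'a fock \<Rightarrow> 'a fock" and \<Psi> :: "'a \<Rightarrow> 'a fock"
  assume \<Psi>: "\<Psi> \<in> fock_h_coeffs"
  show "(if bounded_clinear A then (\<lambda>x. A (\<Psi> x)) else (\<lambda>_. 0)) \<in> fock_h_coeffs"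
  proof (cases "bounded_clinear A")
    case True
    then have bl: "bounded_linear A" by (simp add: bounded_clinear_def)
    then obtain K where K: "\<And>x. norm (A x) \<le> norm x * K" using bounded_linear.bounded by blast
    have "square_summable (\<lambda>x. A (\<Psi> x))" unfolding square_summable_def
    proof (rule summable_on_comparison_test)
      show "(\<lambda>x. (norm (\<Psi> x))\<^sup>2 * K\<^sup>2) summable_on UNIV"
        using \<Psi> by (intro summable_on_cmult_left)
          (simp add: fock_h_coeffs_def square_summable_def)
      show "(norm (A (\<Psi> x)))\<^sup>2 \<le> (norm (\<Psi> x))\<^sup>2 * K\<^sup>2" for x
        using K[of "\<Psi> x"] by (metis norm_ge_zero power_mono power_mult_distrib)
    qed auto
    then show ?thesis
      using \<Psi> True linear_0[OF bounded_linear.linear[OF bl]] by (simp add: fock_h_coeffs_def)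
  qed (simp add: fock_h_coeffs_0)
qed


section \<open>Smooth functions, Fourier transforms and distributions on the plane\<close>

definition partial_x :: "(real \<times> real \<Rightarrow> complex) \<Rightarrow> real \<times> real \<Rightarrow> complex" where
  "partial_x \<phi> = (\<lambda>(x, y). vector_derivative (\<lambda>t. \<phi> (t, y)) (at x))"

definition partial_y :: "(real \<times> real \<Rightarrow> complex) \<Rightarrow> real \<times> real \<Rightarrow> complex" where
  "partial_y \<phi> = (\<lambda>(x, y). vector_derivative (\<lambda>t. \<phi> (x, t)) (at y))"

inductive_set partials :: "(real \<times> real \<Rightarrow> complex) \<Rightarrow> (real \<times> real \<Rightarrow> complex) set"
  for \<phi> where
  "\<phi> \<in> partials \<phi>"
| "\<psi> \<in> partials \<phi> \<Longrightarrow> partial_x \<psi> \<in> partials \<phi>"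
| "\<psi> \<in> partials \<phi> \<Longrightarrow> partial_y \<psi> \<in> partials \<phi>"

definition C_infinity :: "(real \<times> real \<Rightarrow> complex) \<Rightarrow> bool" where
  "C_infinity \<phi> \<longleftrightarrow> (\<forall>\<psi>\<in>partials \<phi>. \<forall>p. \<psi> differentiable (at p))"

definition schwartz :: "(real \<times> real \<Rightarrow> complex) \<Rightarrow> bool" where
  "schwartz g \<longleftrightarrow>
     C_infinity g \<and> (\<forall>\<psi>\<in>partials g. \<forall>N. bounded (range (\<lambda>p. (1 + norm p) ^ N *\<^sub>R \<psi> p)))"

definition inv_fourier :: "(real \<times> real \<Rightarrow> complex) \<Rightarrow> real \<times> real \<Rightarrow> complex" where
  "inv_fourier \<phi> p = (1 / (2 * pi)) *\<^sub>R (LINT q|lborel. \<phi> q * exp (- \<i> * of_real (q \<bullet> p)))"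

text \<open>Functions of at most polynomial growth in the mean: these define tempered distributions.\<close>

definition tempered :: "(real \<times> real \<Rightarrow> complex) \<Rightarrow> bool" where
  "tempered \<phi> \<longleftrightarrow> (\<exists>N. integrable lborel (\<lambda>p. \<phi> p /\<^sub>R (1 + norm p) ^ N))"

text \<open>The value at a Schwartz function \<open>g\<close> of the tempered distribution
  \<open>\<F>\<^sup>-\<^sup>1\<phi>\<close>, namely \<open>\<integral> \<phi> \<F>\<^sup>-\<^sup>1g\<close>.\<close>

definition inv_fourier_dist ::
    "(real \<times> real \<Rightarrow> complex) \<Rightarrow> (real \<times> real \<Rightarrow> complex) \<Rightarrow> complex" where
  "inv_fourier_dist \<phi> g = (LINT p|lborel. \<phi> p * inv_fourier g p)"

text \<open>The integral of \<open>G\<close> against the distribution \<open>\<F>\<^sup>-\<^sup>1\<phi>\<close>.  The function \<open>G\<close> to be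
  integrated below is smooth, but it is a Schwartz function only for \<open>h\<^sub>1 \<noteq> 0 \<noteq> h\<^sub>2\<close>; otherwise it
  does not decay in one of the variables.  The integral is therefore understood as the limit along
  arbitrary Schwartz cut-offs.  It is the usual pairing if \<open>G\<close> is a Schwartz function, and the
  Lebesgue integral if \<open>\<F>\<^sup>-\<^sup>1\<phi>\<close> is a function whose product with \<open>G\<close> is integrable.\<close>

definition has_inv_fourier_integral ::
    "(real \<times> real \<Rightarrow> complex) \<Rightarrow> (real \<times> real \<Rightarrow> complex) \<Rightarrow> complex \<Rightarrow> bool" where
  "has_inv_fourier_integral \<phi> G c \<longleftrightarrow> tempered \<phi> \<and>
     (\<forall>\<kappa>. schwartz \<kappa> \<longrightarrow> \<kappa> 0 = 1 \<longrightarrow>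
       ((\<lambda>\<epsilon>. inv_fourier_dist \<phi> (\<lambda>p. \<kappa> (\<epsilon> *\<^sub>R p) * G p)) \<longlongrightarrow> c) (at_right 0))"


section \<open>The functional calculus and the derivation operator\<close>

text \<open>A pair \<open>h = (h\<^sub>1, h\<^sub>2)\<close> of type \<^typ>\<open>'a \<times> 'a\<close> is an element of the tensor product of the
  real one-particle space with the plane.\<close>

definition is_O :: "'a::{real_inner, polish_space} \<times> 'a \<Rightarrow> (real \<times> real \<Rightarrow> complex) \<Rightarrow>
    ('a fock \<Rightarrow> 'a fock) \<Rightarrow> bool" where
  "is_O h \<phi> M \<longleftrightarrow> bounded_clinear M \<and>
     (\<forall>k1 k2. \<exists>c. cinner (expvec k1) (M (expvec k2)) = (1 / (2 * pi)) *\<^sub>R c \<and>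
        has_inv_fourier_integral \<phi>
          (\<lambda>(u, v). cinner (expvec k1)
             (weyl (of_h (u *\<^sub>R fst h)) (of_h (v *\<^sub>R snd h)) (expvec k2))) c)"

definition Dom_O ::
    "'a::{real_inner, polish_space} \<times> 'a \<Rightarrow> (real \<times> real \<Rightarrow> complex) set" where
  "Dom_O h = {\<phi>. \<exists>M. is_O h \<phi> M}"

definition O_op :: "'a::{real_inner, polish_space} \<times> 'a \<Rightarrow> (real \<times> real \<Rightarrow> complex) \<Rightarrow>
    'a fock \<Rightarrow> 'a fock" where
  "O_op h \<phi> = (THE M. is_O h \<phi> M)"

definition smooth_symbols ::
    "'a::{real_inner, polish_space} \<times> 'a \<Rightarrow> (real \<times> real \<Rightarrow> complex) set" where
  "smooth_symbols h = {\<phi>. C_infinity \<phi> \<and> partials \<phi> \<subseteq> Dom_O h}"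

inductive_set smooth_ops :: "('a::{real_inner, polish_space} fock \<Rightarrow> 'a fock) set" where
  gen: "\<phi> \<in> smooth_symbols h \<Longrightarrow> O_op h \<phi> \<in> smooth_ops"
| add: "A \<in> smooth_ops \<Longrightarrow> B \<in> smooth_ops \<Longrightarrow> (\<lambda>\<psi>. A \<psi> + B \<psi>) \<in> smooth_ops"
| scale: "A \<in> smooth_ops \<Longrightarrow> (\<lambda>\<psi>. c *\<^sub>C A \<psi>) \<in> smooth_ops"
| mult: "A \<in> smooth_ops \<Longrightarrow> B \<in> smooth_ops \<Longrightarrow> A \<circ> B \<in> smooth_ops"

text \<open>The graph of the derivation, with \<^typ>\<open>'a fock_h \<times> 'a fock_h\<close> as the tensor product of
  \<^typ>\<open>'a fock_h\<close> with \<open>\<complex>\<^sup>2\<close>.  The left action of \<open>A\<close> on the module is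
  composition with \<open>A \<otimes> 1\<close>, the right action of \<open>B\<close> is composition with \<open>B\<close>.\<close>

inductive deriv_graph :: "('a::{real_inner, polish_space} fock \<Rightarrow> 'a fock) \<Rightarrow>
    ('a fock \<Rightarrow> 'a fock_h \<times> 'a fock_h) \<Rightarrow> bool" where
  gen: "\<phi> \<in> smooth_symbols h \<Longrightarrow>
     deriv_graph (O_op h \<phi>)
       (\<lambda>\<psi>. (O_op h (partial_x \<phi>) \<psi> \<otimes>\<^sub>h of_h (fst h), O_op h (partial_y \<phi>) \<psi> \<otimes>\<^sub>h of_h (snd h)))"
| add: "deriv_graph A A' \<Longrightarrow> deriv_graph B B' \<Longrightarrow> deriv_graph (\<lambda>\<psi>. A \<psi> + B \<psi>) (\<lambda>\<psi>. A' \<psi> + B' \<psi>)"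
| scale: "deriv_graph A A' \<Longrightarrow> deriv_graph (\<lambda>\<psi>. c *\<^sub>C A \<psi>) (\<lambda>\<psi>. c *\<^sub>C A' \<psi>)"
| mult: "deriv_graph A A' \<Longrightarrow> deriv_graph B B' \<Longrightarrow>
     deriv_graph (A \<circ> B) (\<lambda>\<psi>. A' (B \<psi>) + map_prod (ampliation A) (ampliation A) (B' \<psi>))"

definition deriv_op :: "('a::{real_inner, polish_space} fock \<Rightarrow> 'a fock) \<Rightarrow>
    'a fock \<Rightarrow> 'a fock_h \<times> 'a fock_h" where
  "deriv_op A = (THE A'. deriv_graph A A')"

end

theory Submission
  imports Defs "HOL-Probability.Probability" "HOL-Complex_Analysis.Complex_Analysis"
begin

text \<open>
  Let \<open>W\<^sub>t\<close> be the Weyl operator with argument \<open>t z\<close>.  It maps an exponential vector to a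
  multiple of another one, and it multiplies the Weyl operators \<open>U(u h\<^sub>1, v h\<^sub>2)\<close> defining
  \<open>O\<^sub>h\<close> by a character of \<open>(u, v)\<close> under conjugation, so that conjugation by \<open>W\<^sub>t\<close> translates
  symbols.  Hence, in operator norm, \<open>W\<^sub>-\<^sub>t A W\<^sub>t = A + t A' + O(t\<^sup>2)\<close> for the generators \<open>A\<close>,
  where \<open>A'\<close> is the operator of a directional derivative of the symbol.  This property is stable
  under sums, multiples and products, with the Leibniz rule for \<open>A'\<close>, and it determines \<open>A'\<close>.
  For \<open>z\<close> running through multiples of \<open>x\<close> and \<open>\<i>x\<close> with \<open>x\<close> in the Hilbert basis, the operators
  \<open>A'\<close> are the components of \<open>DA\<close>; so \<open>D\<close> is well defined.  Differentiating matrix elements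
  at \<open>t = 0\<close> gives \<open>\<langle>\<E>(k), A' \<E>(l)\<rangle> = \<langle>X \<E>(k), A \<E>(l)\<rangle> + \<langle>\<E>(k), A X \<E>(l)\<rangle>\<close> with
  \<open>X \<E>(k)\<close> the derivative of \<open>W\<^sub>t \<E>(k)\<close>.  The right-hand side tends to \<open>0\<close> if \<open>A \<rightarrow> 0\<close> weakly,
  and exponential vectors are total.
\<close>

section \<open>Complex inner product spaces\<close>

text \<open>The derivation is a commutator with an unbounded field operator, and composing such
  commutators raises domain questions. Conjugation by the bounded operators W_t avoids them. The
  remainder is required to be quadratic and uniform in the vector because this form survives
  products: the cross terms are again of order t^2. For a generator the estimate comes from the
  second derivative of the conjugated operator, which is controlled by a bounded operator because
  all partial derivatives of the symbol lie in the domain of O_h.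

  The analytic obstacle is the integral defining O_h: if h_1 or h_2 vanishes, the Weyl matrix
  element does not decay in one variable and the integral is only a limit along cut-offs. With a
  Gaussian cut-off all transforms are explicit, and their moments stay bounded as the cut-off is
  removed. Pointwise polynomial growth of the symbols is extracted from temperedness of all their
  derivatives.

  In the closability argument the vectors X E(k) do not depend on the index of the sequence, so weak
  convergence can be applied at fixed vectors.\<close>

interpretation cinner: bounded_bilinear "cinner :: 'a::complex_inner \<Rightarrow> 'a \<Rightarrow> complex"
proof
  fix a b c :: 'a and r :: real
  show "cinner (a + b) c = cinner a c + cinner b c" by (rule cinner_add_left)
  show "cinner a (b + c) = cinner a b + cinner a c" by (rule cinner_add_right)
  show "cinner (r *\<^sub>R a) b = r *\<^sub>R cinner a b"
    by (simp add: scaleR_scaleC cinner_scaleC_left scaleC_complex_def)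
  show "cinner a (r *\<^sub>R b) = r *\<^sub>R cinner a b"
    by (simp add: scaleR_scaleC cinner_scaleC_right scaleC_complex_def)
  show "\<exists>K. \<forall>a b :: 'a. cmod (cinner a b) \<le> norm a * norm b * K"
    by (rule exI[of _ 1]) (simp add: norm_cinner_le)
qed

lemma bounded_clinear_scaleC: "bounded_clinear (\<lambda>x::'a::complex_inner. c *\<^sub>C x)"
  unfolding bounded_clinear_def
proof (intro conjI allI)
  show "bounded_linear (\<lambda>x::'a. c *\<^sub>C x)"
  proof (rule bounded_linear_intro)
    show "norm (c *\<^sub>C x) \<le> norm x * cmod c" for x :: 'a by (simp add: norm_scaleC)
    show "c *\<^sub>C r *\<^sub>R x = r *\<^sub>R c *\<^sub>C x" for r and x :: 'a
      by (simp add: scaleR_scaleC scaleC_scaleC mult.commute)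
  qed (rule scaleC_add_right)
  show "c *\<^sub>C d *\<^sub>C x = d *\<^sub>C c *\<^sub>C x" for d and x :: 'a
    by (simp add: scaleC_scaleC mult.commute)
qed

lemmas bounded_linear_scaleC = bounded_clinear_scaleC[unfolded bounded_clinear_def, THEN conjunct1]

lemma bounded_clinearD:
  assumes "bounded_clinear f"
  shows "f (x + y) = f x + f y" "f (x - y) = f x - f y" "f 0 = 0" "f (c *\<^sub>C x) = c *\<^sub>C f x"
    "f (r *\<^sub>R x) = r *\<^sub>R f x"
  using assms linear_add linear_diff linear_0 linear_scale bounded_linear.linear
  unfolding bounded_clinear_def by blast+

lemma bounded_clinear_bound:
  assumes "bounded_clinear f"
  shows "\<exists>K\<ge>0. \<forall>x. norm (f x) \<le> K * norm x"
  using bounded_linear.nonneg_bounded[of f] assms unfolding bounded_clinear_def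
  by (metis mult.commute)

lemma bounded_clinear_add:
  assumes "bounded_clinear f" "bounded_clinear g"
  shows "bounded_clinear (\<lambda>x. f x + g x)"
  using assms unfolding bounded_clinear_def
  by (auto intro: bounded_linear_add simp: scaleC_add_right)

lemma bounded_clinear_compose:
  assumes "bounded_clinear f" "bounded_clinear g"
  shows "bounded_clinear (\<lambda>x. f (g x))"
  using assms bounded_linear_compose unfolding bounded_clinear_def by auto

lemma cinner_eqI:
  assumes "\<And>z. cinner z x = cinner z (y::'a::complex_inner)"
  shows "x = y"
  using assms[of "x - y"] cinner_self[of "x - y"]
  by (simp add: cinner.diff_right power2_eq_square)

section \<open>Complex spans, orthogonal projection and isometric extension\<close>

definition cspan :: "'a::complex_inner set \<Rightarrow> 'a set" where
  "cspan S = span {c *\<^sub>C x | c x. x \<in> S}"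

lemma cspan_base: "x \<in> S \<Longrightarrow> c *\<^sub>C x \<in> cspan S"
  unfolding cspan_def by (intro span_base) blast

text \<open>The generating set is closed under complex scalars, so its real span is a complex
  subspace. This encoding keeps the facts about real spans available.\<close>

lemma cspan_scaleC:
  assumes "x \<in> cspan S" shows "c *\<^sub>C x \<in> cspan S"
  using assms unfolding cspan_def
proof (induction rule: span_induct_alt)
  case base
  then show ?case by (simp add: span_zero)
next
  case (step r x y)
  then obtain d z where "x = d *\<^sub>C z" "z \<in> S" by blast
  then have "c *\<^sub>C r *\<^sub>R x = ((c * of_real r) * d) *\<^sub>C z"
    by (simp add: scaleR_scaleC scaleC_scaleC mult.assoc)
  then have "c *\<^sub>C r *\<^sub>R x \<in> span {c *\<^sub>C x | c x. x \<in> S}"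
    using \<open>z \<in> S\<close> by (auto intro!: span_base)
  then show ?case using step by (simp add: scaleC_add_right span_add)
qed

lemma cspan_induct [consumes 1, case_names zero add]:
  assumes "x \<in> cspan S" "P 0"
    "\<And>c x y. x \<in> S \<Longrightarrow> P y \<Longrightarrow> P (c *\<^sub>C x + y)"
  shows "P x"
  using assms(1) unfolding cspan_def
proof (induction rule: span_induct_alt)
  case base
  then show ?case by (rule assms(2))
next
  case (step r x y)
  then obtain d z where "x = d *\<^sub>C z" "z \<in> S" by blast
  then show ?case using assms(3)[of z y "of_real r * d"] step
    by (simp add: scaleR_scaleC scaleC_scaleC)
qed

lemma subspace_closure:
  fixes S :: "'a::real_normed_vector set"
  assumes "subspace S" shows "subspace (closure S)"
proof (rule subspaceI)
  show "0 \<in> closure S" using subspace_0[OF assms] closure_subset by blast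
  show "x + y \<in> closure S" if xy: "x \<in> closure S" "y \<in> closure S" for x y
  proof -
    obtain X Y where "\<And>n. X n \<in> S" "X \<longlonglongrightarrow> x" "\<And>n. Y n \<in> S" "Y \<longlonglongrightarrow> y"
      using xy unfolding closure_sequential by blast
    then show ?thesis unfolding closure_sequential
      by (intro exI[of _ "\<lambda>n. X n + Y n"]) (simp add: subspace_add[OF assms] tendsto_add)
  qed
  show "c *\<^sub>R x \<in> closure S" if x: "x \<in> closure S" for c x
  proof -
    obtain X where "\<And>n. X n \<in> S" "X \<longlonglongrightarrow> x" using x unfolding closure_sequential by blast
    then show ?thesis unfolding closure_sequential
      by (intro exI[of _ "\<lambda>n. c *\<^sub>R X n"])
        (simp add: subspace_scale[OF assms] tendsto_scaleR[OF tendsto_const])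
  qed
qed

text \<open>A minimising sequence for the distance to V is Cauchy by the parallelogram identity, and
  completeness gives a minimiser; a variation argument yields orthogonality, here for the real inner
  product.\<close>

lemma orthogonal_projection:
  fixes V :: "'a::{real_inner, complete_space} set"
  assumes V: "subspace V" "closed V"
  obtains v where "v \<in> V" "\<And>w. w \<in> V \<Longrightarrow> inner (x - v) w = 0"
proof -
  define d where "d = (INF v\<in>V. (norm (x - v))\<^sup>2)"
  have bdd: "bdd_below ((\<lambda>v. (norm (x - v))\<^sup>2) ` V)" by (rule bdd_belowI2[of _ 0]) simp
  have ne: "V \<noteq> {}" using subspace_0[OF V(1)] by blast
  have dle: "d \<le> (norm (x - v))\<^sup>2" if "v \<in> V" for v
    unfolding d_def using bdd that by (rule cINF_lower)
  have "\<exists>v\<in>V. (norm (x - v))\<^sup>2 < d + inverse (real (Suc n))" for n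
  proof -
    have "d < d + inverse (real (Suc n))" by simp
    then show ?thesis unfolding d_def using cINF_less_iff[OF ne bdd] by metis
  qed
  then obtain u where u: "\<And>n. u n \<in> V" "\<And>n. (norm (x - u n))\<^sup>2 < d + inverse (real (Suc n))"
    by metis
  have par: "(norm (u m - u n))\<^sup>2 \<le> 2 * inverse (real (Suc m)) + 2 * inverse (real (Suc n))" for m n
  proof -
    have "(1/2) *\<^sub>R (u m + u n) \<in> V" using u(1) V(1) by (simp add: subspace_add subspace_scale)
    then have "d \<le> (norm (x - (1/2) *\<^sub>R (u m + u n)))\<^sup>2" by (rule dle)
    moreover have "(norm (u m - u n))\<^sup>2 = 2 * (norm (x - u m))\<^sup>2 + 2 * (norm (x - u n))\<^sup>2
        - 4 * (norm (x - (1/2) *\<^sub>R (u m + u n)))\<^sup>2"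
      by (simp add: power2_norm_eq_inner algebra_simps inner_commute)
    ultimately show ?thesis using u(2)[of m] u(2)[of n] by simp
  qed
  have "Cauchy u"
  proof (rule CauchyI)
    fix e :: real assume "0 < e"
    then obtain M where M: "inverse (real (Suc M)) < e\<^sup>2 / 4"
      using reals_Archimedean[of "e\<^sup>2 / 4"] by auto
    show "\<exists>M. \<forall>m\<ge>M. \<forall>n\<ge>M. norm (u m - u n) < e"
    proof (intro exI[of _ M] allI impI)
      fix m n assume "M \<le> m" "M \<le> n"
      then have "inverse (real (Suc m)) \<le> inverse (real (Suc M))"
        "inverse (real (Suc n)) \<le> inverse (real (Suc M))" by (simp_all add: le_imp_inverse_le)
      then have "(norm (u m - u n))\<^sup>2 < e\<^sup>2" using par[of m n] M by linarith
      then show "norm (u m - u n) < e" using \<open>0 < e\<close> by (simp add: power_less_imp_less_base)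
    qed
  qed
  then obtain v where v: "u \<longlonglongrightarrow> v" using Cauchy_convergent_iff convergent_def by blast
  have vV: "v \<in> V" using V(2) u(1) v closed_sequentially by blast
  have "(\<lambda>n. (norm (x - u n))\<^sup>2) \<longlonglongrightarrow> (norm (x - v))\<^sup>2" by (intro tendsto_intros v)
  moreover have "(\<lambda>n. d + inverse (real (Suc n))) \<longlonglongrightarrow> d + 0"
    by (intro tendsto_intros LIMSEQ_inverse_real_of_nat)
  ultimately have "(norm (x - v))\<^sup>2 \<le> d"
    using u(2) by (intro LIMSEQ_le[of "\<lambda>n. (norm (x - u n))\<^sup>2" _ "\<lambda>n. d + inverse (real (Suc n))"])
      (auto intro: less_imp_le)
  then have min: "(norm (x - v))\<^sup>2 \<le> (norm (x - w))\<^sup>2" if "w \<in> V" for w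
    using dle[OF that] order_trans by blast
  have "inner (x - v) w = 0" if "w \<in> V" for w
  proof (rule ccontr)
    assume ne: "inner (x - v) w \<noteq> 0"
    then have w0: "inner w w > 0" by (metis inner_gt_zero_iff inner_zero_right)
    \<comment> \<open>The multiple of w closest to x - v; minimality of v then forces
      \<open>t * inner (x - v) w \<le> 0\<close>.\<close>
    define t where "t = inner (x - v) w / inner w w"
    have "v + t *\<^sub>R w \<in> V" using vV that V(1) by (simp add: subspace_add subspace_scale)
    then have "(norm (x - v))\<^sup>2 \<le> (norm ((x - v) - t *\<^sub>R w))\<^sup>2"
      using min[of "v + t *\<^sub>R w"] by (simp add: algebra_simps)
    also have "\<dots> = (norm (x - v))\<^sup>2 - 2 * t * inner (x - v) w + t * t * inner w w"
      by (simp add: power2_norm_eq_inner inner_diff_left inner_diff_right inner_commute)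
    also have "t * t * inner w w = t * inner (x - v) w" using w0 by (simp add: t_def)
    finally have "t * inner (x - v) w \<le> 0" by simp
    moreover have "t * inner (x - v) w > 0"
      using ne w0 by (simp add: t_def zero_less_mult_iff zero_less_divide_iff linorder_neq_iff) linarith
    ultimately show False by simp
  qed
  with vV that show ?thesis by blast
qed

text \<open>The defect of the projection onto the closed span is orthogonal to that span, hence zero
  by totality. The projection is orthogonal for the real inner product; testing with y and i y
  upgrades this to the complex one.\<close>

lemma cspan_dense_if_total:
  fixes S :: "'a::{complex_inner, complete_space} set"
  assumes total: "\<And>y. (\<And>x. x \<in> S \<Longrightarrow> cinner x y = 0) \<Longrightarrow> y = 0"
  shows "closure (cspan S) = UNIV"
proof -
  have "x \<in> closure (cspan S)" for x
  proof -
    have "subspace (closure (cspan S))" unfolding cspan_def by (rule subspace_closure) simp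
    then obtain v where v: "v \<in> closure (cspan S)"
      "\<And>w. w \<in> closure (cspan S) \<Longrightarrow> inner (x - v) w = 0"
      using orthogonal_projection[of "closure (cspan S)" x] by auto
    have re: "Re (cinner (x - v) w) = 0" if "w \<in> cspan S" for w
      using v(2) that closure_subset by (metis inner_eq_Re_cinner subsetD)
    have "cinner y (x - v) = 0" if "y \<in> S" for y
    proof -
      have "Re (cinner (x - v) (1 *\<^sub>C y)) = 0" "Re (cinner (x - v) (\<i> *\<^sub>C y)) = 0"
        using cspan_base[OF that] re by blast+
      then have "cinner (x - v) y = 0" by (simp add: cinner_scaleC_right complex_eq_iff)
      then show ?thesis by (metis cinner_commute complex_cnj_zero)
    qed
    then have "x - v = 0" by (rule total)
    then show ?thesis using v(1) by simp
  qed
  then show ?thesis by blast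
qed

lemma bounded_linear_eq_on_dense:
  fixes f g :: "'a::complex_inner \<Rightarrow> 'b::complex_inner"
  assumes "bounded_clinear f" "bounded_clinear g" "closure (cspan S) = UNIV"
    "\<And>x. x \<in> S \<Longrightarrow> f x = g x"
  shows "f = g"
proof -
  have "f x = g x" if "x \<in> cspan S" for x
    using that by (induction rule: cspan_induct)
      (use assms in \<open>auto simp: bounded_clinearD\<close>)
  moreover have "continuous_on UNIV f" "continuous_on UNIV g"
    using assms(1,2) by (auto simp: bounded_clinear_def linear_continuous_on)
  ultimately have "f x = g x" for x
    using continuous_closed_preimage_constant[of UNIV "\<lambda>x. f x - g x" 0]
      closure_minimal[of "cspan S" "{x \<in> UNIV. f x - g x = 0}"] assms(3)
    by (force intro: continuous_on_diff)
  then show ?thesis by blast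
qed

text \<open>The family \<open>f\<close> may satisfy linear relations, so a definition on linear
  combinations would need a consistency proof. The map is obtained from its graph instead: the
  closed span of all pairs (f i, g i) preserves inner products and is therefore
  single-valued.\<close>

lemma isometric_extension:
  fixes f :: "'i \<Rightarrow> 'a::complex_inner" and g :: "'i \<Rightarrow> 'b::{complex_inner, complete_space}"
  assumes iso: "\<And>i j. cinner (g i) (g j) = cinner (f i) (f j)"
    and dense: "closure (cspan (range f)) = UNIV"
  obtains W where "bounded_clinear W" "\<And>x y. cinner (W x) (W y) = cinner x y" "\<And>i. W (f i) = g i"
proof -
  define B where "B = range (\<lambda>i. (f i, g i))"
  define G where "G = closure (cspan B)"
  have sub: "subspace G" unfolding G_def cspan_def by (rule subspace_closure) simp
  have iso1: "cinner (snd p) (snd q) = cinner (fst p) (fst q)" if "p \<in> cspan B" "q \<in> B" for p q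
    using that by (induction rule: cspan_induct)
      (auto simp: B_def iso scaleC_prod_def cinner.add_left cinner_scaleC_left cinner.zero_left)
  have iso2: "cinner (snd p) (snd q) = cinner (fst p) (fst q)" if "q \<in> cspan B" "p \<in> cspan B" for p q
    using that by (induction rule: cspan_induct)
      (auto simp: iso1 scaleC_prod_def cinner.add_right cinner_scaleC_right cinner.zero_right)
  have isoG: "cinner (snd p) (snd q) = cinner (fst p) (fst q)" if pq: "p \<in> G" "q \<in> G" for p q
  proof -
    obtain P where "\<And>n. P n \<in> cspan B" "P \<longlonglongrightarrow> p"
      using pq(1) unfolding G_def closure_sequential by auto
    note P = this
    obtain Q where Q: "\<And>n. Q n \<in> cspan B" "Q \<longlonglongrightarrow> q"
      using pq(2) unfolding G_def closure_sequential by auto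
    have "(\<lambda>n. cinner (snd (P n)) (snd (Q n))) \<longlonglongrightarrow> cinner (snd p) (snd q)"
      by (intro cinner.tendsto tendsto_snd P(2) Q(2))
    moreover have "(\<lambda>n. cinner (fst (P n)) (fst (Q n))) \<longlonglongrightarrow> cinner (fst p) (fst q)"
      by (intro cinner.tendsto tendsto_fst P(2) Q(2))
    ultimately have "(\<lambda>n. cinner (snd (P n)) (snd (Q n))) \<longlonglongrightarrow> cinner (snd p) (snd q)"
      "(\<lambda>n. cinner (snd (P n)) (snd (Q n))) \<longlonglongrightarrow> cinner (fst p) (fst q)"
      by (simp_all only: iso2[OF Q(1) P(1)])
    then show ?thesis using LIMSEQ_unique by blast
  qed
  \<comment> \<open>The isometry identity for the pair (0, y - y') says that y - y' has norm
    zero.\<close>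
  have fn: "y = y'" if "(x, y) \<in> G" "(x, y') \<in> G" for x y y'
  proof -
    have "(0, y - y') \<in> G" using subspace_diff[OF sub that] by simp
    then have "cinner (y - y') (y - y') = 0"
      using isoG[of "(0, y - y')" "(0, y - y')"] by (simp add: cinner.zero_left)
    then show ?thesis by (simp add: cinner_self)
  qed
  have sc: "(c *\<^sub>C x, c *\<^sub>C y) \<in> G" if xy: "(x, y) \<in> G" for c x y
  proof -
    obtain P where P: "\<And>n. P n \<in> cspan B" "P \<longlonglongrightarrow> (x, y)"
      using xy unfolding G_def closure_sequential by auto
    have "(\<lambda>n. c *\<^sub>C P n) \<longlonglongrightarrow> c *\<^sub>C (x, y)"
      by (rule bounded_linear.tendsto[OF bounded_linear_scaleC P(2)])
    moreover have "c *\<^sub>C P n \<in> cspan B" for n using P(1) by (rule cspan_scaleC)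
    ultimately have "c *\<^sub>C (x, y) \<in> G" unfolding G_def closure_sequential
      by (intro exI[of _ "\<lambda>n. c *\<^sub>C P n"] conjI allI)
    then show ?thesis by (simp add: scaleC_prod_def)
  qed
  have fG: "x \<in> fst ` cspan B" if "x \<in> cspan (range f)" for x
    using that
  proof (induction rule: cspan_induct)
    case zero
    then show ?case by (force simp: cspan_def intro: span_zero)
  next
    case (add c x y)
    then obtain i q where "x = f i" "y = fst q" "q \<in> cspan B" by blast
    moreover have "c *\<^sub>C (f i, g i) + q \<in> cspan B"
      using \<open>q \<in> cspan B\<close> cspan_base[of "(f i, g i)" B c] unfolding cspan_def
      by (intro span_add) (auto simp: B_def cspan_def)
    ultimately show ?case by (force simp: scaleC_prod_def)
  qed
  have ex: "\<exists>y. (x, y) \<in> G" for x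
  proof -
    have "x \<in> closure (cspan (range f))" using dense by simp
    then obtain X where X: "\<And>n. X n \<in> cspan (range f)" "X \<longlonglongrightarrow> x"
      unfolding closure_sequential by blast
    then have "\<forall>n. \<exists>y. (X n, y) \<in> cspan B" using fG by force
    then obtain Y where Y: "\<And>n. (X n, Y n) \<in> cspan B" by metis
    \<comment> \<open>The second components inherit the Cauchy property of the first ones, and
      completeness of the codomain supplies the limit.\<close>
    have "norm (Y m - Y n) = norm (X m - X n)" for m n
    proof -
      have "(X m - X n, Y m - Y n) \<in> cspan B"
        using span_diff[OF Y[of m, unfolded cspan_def] Y[of n, unfolded cspan_def]]
        by (simp add: cspan_def)
      then have "cinner (Y m - Y n) (Y m - Y n) = cinner (X m - X n) (X m - X n)"
        using iso2[of "(X m - X n, Y m - Y n)" "(X m - X n, Y m - Y n)"] by simp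
      then show ?thesis unfolding cinner_self of_real_eq_iff by simp
    qed
    moreover have "Cauchy X" using X(2) by (rule LIMSEQ_imp_Cauchy)
    ultimately have "Cauchy Y" by (simp add: Cauchy_iff)
    then obtain y where "Y \<longlonglongrightarrow> y" using Cauchy_convergent_iff convergent_def by blast
    then have "(\<lambda>n. (X n, Y n)) \<longlonglongrightarrow> (x, y)" by (intro tendsto_Pair X(2))
    then show ?thesis using Y unfolding G_def closure_sequential by (intro exI conjI allI)
  qed
  define W where "W x = (SOME y. (x, y) \<in> G)" for x
  have W: "(x, W x) \<in> G" for x unfolding W_def using ex by (rule someI_ex)
  have WI: "W x = y" if "(x, y) \<in> G" for x y using fn[OF W that] .
  have Wiso: "cinner (W x) (W y) = cinner x y" for x y using isoG[OF W W] by simp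
  have nW: "norm (W x) = norm x" for x
    using Wiso[of x x] unfolding cinner_self of_real_eq_iff by simp
  have "bounded_linear W"
  proof (rule bounded_linear_intro[where K = 1])
    show "W (x + y) = W x + W y" for x y
      using subspace_add[OF sub W W, of x y] by (intro WI) simp
    show "W (r *\<^sub>R x) = r *\<^sub>R W x" for r x
      using sc[OF W] by (intro WI) (simp add: scaleR_scaleC)
  qed (simp add: nW)
  moreover have "W (c *\<^sub>C x) = c *\<^sub>C W x" for c x using sc[OF W] by (rule WI)
  moreover have "W (f i) = g i" for i
  proof (rule WI)
    have "1 *\<^sub>C (f i, g i) \<in> cspan B" by (rule cspan_base) (simp add: B_def)
    then show "(f i, g i) \<in> G" unfolding G_def using closure_subset by auto
  qed
  ultimately show ?thesis using that[of W] Wiso by (auto simp: bounded_clinear_def)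
qed

section \<open>The Fock space\<close>

lemma norm_fock_sq: "(norm (F::'a::{real_inner, polish_space} fock))\<^sup>2 = (\<Sum>\<^sub>\<infinity>xs. (cmod (Rep_fock F xs))\<^sup>2)"
proof -
  have "complex_of_real ((norm F)\<^sup>2) = of_real (\<Sum>\<^sub>\<infinity>xs. (cmod (Rep_fock F xs))\<^sup>2)"
    unfolding cinner_self[symmetric] cinner_fock.rep_eq
    using infsum_cinner_self[OF square_summable_Rep_fock[of F]] by (simp add: cinner_complex_def)
  then show ?thesis using of_real_eq_iff by blast
qed

lemma sum_Rep_fock_le:
  "finite X \<Longrightarrow> (\<Sum>xs\<in>X. (cmod (Rep_fock F xs))\<^sup>2) \<le> (norm F)\<^sup>2"
  unfolding norm_fock_sq
  using square_summable_Rep_fock[of F] unfolding square_summable_def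
  by (intro finite_sum_le_infsum) auto

lemma norm_fock_le_finite:
  assumes "\<And>X. finite X \<Longrightarrow> (\<Sum>xs\<in>X. (cmod (Rep_fock F xs))\<^sup>2) \<le> e\<^sup>2" "0 \<le> e"
  shows "norm F \<le> e"
proof -
  have "(norm F)\<^sup>2 \<le> e\<^sup>2" unfolding norm_fock_sq
    using square_summable_Rep_fock[of F] assms(1) unfolding square_summable_def
    by (intro infsum_le_finite_sums) auto
  then show ?thesis using assms(2) by (rule power2_le_imp_le)
qed

lemma square_summable_complex_bound:
  fixes H :: "'i \<Rightarrow> real" and f :: "'i \<Rightarrow> complex"
  assumes "(\<lambda>i. (H i)\<^sup>2) summable_on UNIV" "\<And>i. cmod (f i) \<le> H i"
  shows "square_summable f"
  unfolding square_summable_def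
  by (rule summable_on_comparison_test[OF assms(1)]) (auto intro: power_mono assms(2))

text \<open>Estimates below are proved word by word against one fixed square-summable family; this
  turns them into norm estimates with the same constant.\<close>

lemma norm_fock_le:
  assumes "(\<lambda>xs. (H xs)\<^sup>2) summable_on UNIV" "\<And>xs. cmod (Rep_fock F xs) \<le> c * H xs" "0 \<le> c"
  shows "norm F \<le> c * sqrt (\<Sum>\<^sub>\<infinity>xs. (H xs)\<^sup>2)"
proof (rule power2_le_imp_le)
  have "(norm F)\<^sup>2 \<le> (\<Sum>\<^sub>\<infinity>xs. c\<^sup>2 * (H xs)\<^sup>2)" unfolding norm_fock_sq
  proof (rule infsum_mono)
    show "(\<lambda>xs. (cmod (Rep_fock F xs))\<^sup>2) summable_on UNIV"
      using square_summable_Rep_fock[of F] by (simp add: square_summable_def)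
    show "(\<lambda>xs. c\<^sup>2 * (H xs)\<^sup>2) summable_on UNIV"
      by (rule summable_on_cmult_right[OF assms(1)])
    show "(cmod (Rep_fock F xs))\<^sup>2 \<le> c\<^sup>2 * (H xs)\<^sup>2" for xs
      using power_mono[OF assms(2)[of xs], of 2] by (simp add: power_mult_distrib)
  qed
  also have "\<dots> = c\<^sup>2 * (\<Sum>\<^sub>\<infinity>xs. (H xs)\<^sup>2)" by (rule infsum_cmult_right') 
  also have "\<dots> = (c * sqrt (\<Sum>\<^sub>\<infinity>xs. (H xs)\<^sup>2))\<^sup>2"
    by (simp add: power_mult_distrib infsum_nonneg)
  finally show "(norm F)\<^sup>2 \<le> (c * sqrt (\<Sum>\<^sub>\<infinity>xs. (H xs)\<^sup>2))\<^sup>2" .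
  show "0 \<le> c * sqrt (\<Sum>\<^sub>\<infinity>xs. (H xs)\<^sup>2)" using assms(3) by (simp add: infsum_nonneg)
qed

lemma Rep_fock_diff: "Rep_fock (F - G) xs = Rep_fock F xs - Rep_fock G xs"
  unfolding minus_fock_def plus_fock.rep_eq scaleC_fock.rep_eq by simp

lemma Rep_fock_scaleR: "Rep_fock (r *\<^sub>R F) xs = of_real r * Rep_fock F xs"
  by (simp add: scaleR_fock_def scaleC_fock.rep_eq)

lemma Rep_fock_sum: "Rep_fock (sum F I) xs = (\<Sum>i\<in>I. Rep_fock (F i) xs)"
  by (induction I rule: infinite_finite_induct) (auto simp: zero_fock.rep_eq plus_fock.rep_eq)

lemma fock_eqI: "(\<And>xs. Rep_fock F xs = Rep_fock G xs) \<Longrightarrow> F = G"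
  by (simp add: Rep_fock_inject[symmetric] fun_eq_iff)

lemma Rep_fock_to_fock: "F \<in> fock_coeffs \<Longrightarrow> Rep_fock (to_fock F) = F"
  unfolding to_fock_def by (simp only: if_True Abs_fock_inverse)

lemma Rep_fock_perm: "mset xs = mset ys \<Longrightarrow> Rep_fock F xs = Rep_fock F ys"
  by (rule Rep_fock[of F, unfolded fock_coeffs_def mem_Collect_eq, THEN conjunct2, THEN conjunct1,
        rule_format])

lemma Rep_fock_outside: "\<not> set xs \<subseteq> hbasis \<Longrightarrow> Rep_fock F xs = 0"
  by (rule Rep_fock[of F, unfolded fock_coeffs_def mem_Collect_eq, THEN conjunct1, rule_format])

text \<open>Coefficients converge individually. Bounds on finite partial sums of squares survive
  this limit, which gives both square-summability of the limit and convergence in norm.\<close>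

instance fock :: ("{real_inner, polish_space}") complete_space
proof
  fix X :: "nat \<Rightarrow> 'a fock" assume C: "Cauchy X"
  have le: "cmod (Rep_fock F xs) \<le> norm F" for F :: "'a fock" and xs
    using sum_Rep_fock_le[of "{xs}" F] by (simp add: abs_le_square_iff[symmetric])
  have "Cauchy (\<lambda>n. Rep_fock (X n) xs)" for xs
  proof (rule CauchyI)
    fix e :: real assume "0 < e"
    then obtain M where M: "\<And>m n. M \<le> m \<Longrightarrow> M \<le> n \<Longrightarrow> norm (X m - X n) < e"
      using C unfolding Cauchy_iff by blast
    then show "\<exists>M. \<forall>m\<ge>M. \<forall>n\<ge>M. norm (Rep_fock (X m) xs - Rep_fock (X n) xs) < e"
      using le[of "X _ - X _" xs] unfolding Rep_fock_diff by (meson le_less_trans)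
  qed
  then have "\<forall>xs. \<exists>f. (\<lambda>n. Rep_fock (X n) xs) \<longlonglongrightarrow> f"
    by (simp add: Cauchy_convergent_iff convergent_def)
  then obtain f where f: "\<And>xs. (\<lambda>n. Rep_fock (X n) xs) \<longlonglongrightarrow> f xs" by metis
  have lim: "\<exists>M. \<forall>n\<ge>M. \<forall>X'. finite X' \<longrightarrow>
      (\<Sum>xs\<in>X'. (cmod (f xs - Rep_fock (X n) xs))\<^sup>2) \<le> e\<^sup>2" if e: "0 < e" for e :: real
  proof -
    obtain M where M: "\<And>m n. M \<le> m \<Longrightarrow> M \<le> n \<Longrightarrow> norm (X m - X n) < e"
      using C e unfolding Cauchy_iff by blast
    have "(\<Sum>xs\<in>X'. (cmod (f xs - Rep_fock (X n) xs))\<^sup>2) \<le> e\<^sup>2" if "M \<le> n" "finite X'" for n X'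
    proof (rule LIMSEQ_le_const2)
      show "(\<lambda>m. \<Sum>xs\<in>X'. (cmod (Rep_fock (X m) xs - Rep_fock (X n) xs))\<^sup>2)
          \<longlonglongrightarrow> (\<Sum>xs\<in>X'. (cmod (f xs - Rep_fock (X n) xs))\<^sup>2)"
        by (intro tendsto_intros f)
      show "\<exists>N. \<forall>m\<ge>N. (\<Sum>xs\<in>X'. (cmod (Rep_fock (X m) xs - Rep_fock (X n) xs))\<^sup>2) \<le> e\<^sup>2"
      proof (intro exI[of _ M] allI impI)
        fix m assume "M \<le> m"
        have "(norm (X m - X n))\<^sup>2 \<le> e\<^sup>2"
          using M[OF \<open>M \<le> m\<close> \<open>M \<le> n\<close>] by (intro power_mono) auto
        then show "(\<Sum>xs\<in>X'. (cmod (Rep_fock (X m) xs - Rep_fock (X n) xs))\<^sup>2) \<le> e\<^sup>2"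
          using sum_Rep_fock_le[OF \<open>finite X'\<close>, of "X m - X n"] unfolding Rep_fock_diff by linarith
      qed
    qed
    then show ?thesis by blast
  qed
  obtain M where M: "\<And>n X'. n \<ge> M \<Longrightarrow> finite X' \<Longrightarrow>
      (\<Sum>xs\<in>X'. (cmod (f xs - Rep_fock (X n) xs))\<^sup>2) \<le> 1\<^sup>2"
    using lim[of 1] by auto
  have "square_summable (\<lambda>xs. f xs - Rep_fock (X M) xs)" unfolding square_summable_def
    by (rule nonneg_bdd_above_summable_on) (auto intro!: bdd_aboveI2[of _ _ 1] M[of M, simplified])
  from square_summable_add[OF this square_summable_Rep_fock[of "X M"]]
  have su: "square_summable f" by simp
  have out: "f xs = 0" if "\<not> set xs \<subseteq> hbasis" for xs
    using f[of xs] Rep_fock_outside[OF that] by (simp add: LIMSEQ_const_iff)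
  have perm: "f xs = f ys" if "mset xs = mset ys" for xs ys
    using f[of xs] f[of ys] unfolding Rep_fock_perm[OF that] by (rule LIMSEQ_unique)
  have "f \<in> fock_coeffs" unfolding fock_coeffs_def mem_Collect_eq
    by (intro conjI allI impI su out perm)
  then have F: "Rep_fock (to_fock f) = f" by (rule Rep_fock_to_fock)
  have "X \<longlonglongrightarrow> to_fock f"
  proof (rule metric_LIMSEQ_I)
    fix e :: real assume "0 < e"
    then obtain M where M: "\<And>n X'. n \<ge> M \<Longrightarrow> finite X' \<Longrightarrow>
        (\<Sum>xs\<in>X'. (cmod (f xs - Rep_fock (X n) xs))\<^sup>2) \<le> (e/2)\<^sup>2"
      using lim[of "e/2"] by auto
    have "norm (to_fock f - X n) \<le> e / 2" if "n \<ge> M" for n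
      using M[OF that] \<open>0 < e\<close> by (intro norm_fock_le_finite) (auto simp: Rep_fock_diff F)
    then show "\<exists>M. \<forall>n\<ge>M. dist (X n) (to_fock f) < e"
      using \<open>0 < e\<close> by (force simp: dist_norm norm_minus_commute)
  qed
  then show "convergent X" by (auto simp: convergent_def)
qed

text \<open>Density of the span gives a finite combination v close to k. For every finite S
  containing its basis vectors, the partial sum over S is the inner product of l with the projection
  of k onto the span of S, and this projection is at least as close to k as v.\<close>

lemma parseval_hbasis:
  fixes k l :: "'a::{real_inner, polish_space}"
  shows "((\<lambda>x. inner x k * inner x l) has_sum inner k l) hbasis"
  unfolding has_sum_def tendsto_iff eventually_finite_subsets_at_top
proof (intro allI impI)
  fix e :: real assume "0 < e"
  note B = is_hilbert_basis_hbasis[where 'a = 'a, unfolded is_hilbert_basis_def]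
  \<comment> \<open>The summand 1 makes the quotient positive also for l = 0.\<close>
  define d where "d = e / (norm l + 1)"
  have "d > 0" using \<open>0 < e\<close> by (simp add: d_def add_nonneg_pos)
  moreover have "k \<in> closure (span hbasis)" using B by simp
  ultimately obtain v where v: "v \<in> span hbasis" "dist v k < d"
    unfolding closure_approachable by blast
  then obtain S0 r where S0: "finite S0" "S0 \<subseteq> hbasis" and v': "v = (\<Sum>a\<in>S0. r a *\<^sub>R a)"
    unfolding span_explicit by blast
  have "v \<in> span S0" unfolding v' by (intro span_sum span_scale span_base)
  note S0 = S0 this
  show "\<exists>X. finite X \<and> X \<subseteq> hbasis \<and> (\<forall>Y. finite Y \<and> X \<subseteq> Y \<and> Y \<subseteq> hbasis \<longrightarrow>
      dist (\<Sum>x\<in>Y. inner x k * inner x l) (inner k l) < e)"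
  proof (intro exI[of _ S0] conjI allI impI S0(1,2))
    fix S assume S: "finite S \<and> S0 \<subseteq> S \<and> S \<subseteq> hbasis"
    define p where "p = (\<Sum>x\<in>S. inner x k *\<^sub>R x)"
    have o: "inner x y = (if x = y then 1 else 0)" if "x \<in> S" "y \<in> S" for x y
      using B S that by (auto simp: pairwise_def orthogonal_def norm_eq_1 subset_iff)
    have orth0: "inner x (k - p) = 0" if "x \<in> S" for x
    proof -
      have "inner x p = (\<Sum>y\<in>S. if x = y then inner y k else 0)"
        unfolding p_def inner_sum_right by (intro sum.cong) (auto simp: o that)
      then show ?thesis using that S by (simp add: inner_diff_right)
    qed
    have orth: "orthogonal (k - p) w" if "w \<in> span S" for w
      using that
    proof (rule orthogonal_to_span)
      show "orthogonal (k - p) x" if "x \<in> S" for x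
        using orth0[OF that] by (simp only: orthogonal_def inner_commute)
    qed
    have "v \<in> span S" using S0(3) S span_mono by blast
    moreover have "p \<in> span S" unfolding p_def by (intro span_sum span_scale span_base)
    ultimately have "inner (k - p) (p - v) = 0"
      using orth[OF span_diff] by (simp only: orthogonal_def)
    then have "(norm (k - v))\<^sup>2 = (norm (k - p))\<^sup>2 + (norm (p - v))\<^sup>2"
      using norm_add_Pythagorean[of "k - p" "p - v"] by (simp add: orthogonal_def)
    then have "(norm (k - p))\<^sup>2 \<le> (norm (k - v))\<^sup>2" by simp
    then have "norm (k - p) \<le> norm (k - v)" by (rule power2_le_imp_le) simp
    then have kp: "norm (k - p) < d" using v(2) by (simp add: dist_norm norm_minus_commute)
    have "(\<Sum>x\<in>S. inner x k * inner x l) = inner p l" by (simp add: p_def inner_sum_left)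
    then have "dist (\<Sum>x\<in>S. inner x k * inner x l) (inner k l) = \<bar>inner (k - p) l\<bar>"
      by (simp add: dist_real_def inner_diff_left abs_minus_commute)
    also have "\<dots> \<le> norm (k - p) * norm l" by (rule Cauchy_Schwarz_ineq2)
    also have "\<dots> \<le> norm (k - p) * (norm l + 1)" by (simp add: mult_left_mono)
    also have "\<dots> < d * (norm l + 1)" using kp by (intro mult_strict_right_mono add_nonneg_pos) auto
    also have "\<dots> = e" using norm_ge_zero[of l] by (simp add: d_def add_nonneg_eq_0_iff)
    finally show "dist (\<Sum>x\<in>S. inner x k * inner x l) (inner k l) < e" .
  qed
qed

lemma hinner_parseval:
  fixes k l :: "'a::{real_inner, polish_space} complexification"
  shows "((\<lambda>x. cnj (hinner (of_h x) k) * hinner (of_h x) l) has_sum hinner k l) hbasis"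
proof -
  note P = has_sum_of_real[OF parseval_hbasis, where 'a = complex]
  have "((\<lambda>x. (of_real (inner x (hRe k) * inner x (hRe l)) + of_real (inner x (hIm k) * inner x (hIm l)))
      + \<i> * (of_real (inner x (hRe k) * inner x (hIm l)) - of_real (inner x (hIm k) * inner x (hRe l))))
      has_sum ((of_real (inner (hRe k) (hRe l)) + of_real (inner (hIm k) (hIm l)))
      + \<i> * (of_real (inner (hRe k) (hIm l)) - of_real (inner (hIm k) (hRe l))))) hbasis"
    unfolding diff_conv_add_uminus
    by (intro has_sum_add has_sum_cmult_right has_sum_uminusI P)
  also have "(of_real (inner (hRe k) (hRe l)) + of_real (inner (hIm k) (hIm l)))
      + \<i> * (of_real (inner (hRe k) (hIm l)) - of_real (inner (hIm k) (hRe l))) = hinner k l"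
    by (simp add: hinner_def complex_eq_iff)
  also have "(\<lambda>x. (of_real (inner x (hRe k) * inner x (hRe l)) + of_real (inner x (hIm k) * inner x (hIm l)))
      + \<i> * (of_real (inner x (hRe k) * inner x (hIm l)) - of_real (inner x (hIm k) * inner x (hRe l))))
      = (\<lambda>x. cnj (hinner (of_h x) k) * hinner (of_h x) l)"
    by (simp add: fun_eq_iff hinner_def of_h_def complex_eq_iff)
  finally show ?thesis .
qed

section \<open>Sums over words and the inner product of exponential vectors\<close>

abbreviation words :: "'b set \<Rightarrow> nat \<Rightarrow> 'b list set" where
  "words B n \<equiv> {xs. set xs \<subseteq> B \<and> length xs = n}"

text \<open>Splitting off the first letter identifies words of length n + 1 with pairs, and Fubini
  multiplies the sums. Absolute summability runs through the same induction because Fubini requires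
  it at each stage.\<close>

lemma has_sum_words:
  fixes a :: "'b \<Rightarrow> 'c::{real_normed_field, banach}"
  assumes a: "(\<lambda>x. norm (a x)) summable_on B"
  shows "((\<lambda>xs. prod_list (map a xs)) has_sum infsum a B ^ n) (words B n)"
    and "(\<lambda>xs. norm (prod_list (map a xs))) summable_on words B n"
proof (induction n)
  case 0
  have eq: "words B 0 = {[]}" by auto
  show "((\<lambda>xs. prod_list (map a xs)) has_sum infsum a B ^ 0) (words B 0)"
    unfolding eq by (rule has_sum_finiteI) simp_all
  show "(\<lambda>xs. norm (prod_list (map a xs))) summable_on words B 0"
    unfolding eq by simp
next
  case (Suc n)
  have bij: "bij_betw (\<lambda>p. fst p # snd p) (B \<times> words B n) (words B (Suc n))"
    by (rule bij_betwI[where g = "\<lambda>xs. (hd xs, tl xs)"]) (auto simp: length_Suc_conv)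
  have abs: "(\<lambda>p. norm (a (fst p) * prod_list (map a (snd p)))) summable_on B \<times> words B n"
    unfolding Infinite_Sum.abs_summable_on_Sigma_iff
    unfolding fst_conv snd_conv norm_mult
  proof (intro conjI ballI)
    show "(\<lambda>xs. norm (a x) * norm (prod_list (map a xs))) summable_on words B n" for x
      by (rule summable_on_cmult_right[OF Suc(2)])
    show "(\<lambda>x. norm (\<Sum>\<^sub>\<infinity>xs\<in>words B n. norm (a x) * norm (prod_list (map a xs)))) summable_on B"
      unfolding infsum_cmult_right' using a by (simp add: abs_mult infsum_nonneg summable_on_cmult_left)
  qed
  have "((\<lambda>p. a (fst p) * prod_list (map a (snd p))) has_sum infsum a B * infsum a B ^ n) (B \<times> words B n)"
  proof (rule has_sum_SigmaI)
    show "((\<lambda>xs. a (fst (x, xs)) * prod_list (map a (snd (x, xs)))) has_sum a x * infsum a B ^ n) (words B n)"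
      for x using has_sum_cmult_right[OF Suc(1)] by simp
    show "((\<lambda>x. a x * infsum a B ^ n) has_sum infsum a B * infsum a B ^ n) B"
      by (rule has_sum_cmult_left[OF has_sum_infsum[OF abs_summable_summable[OF a]]])
  qed (rule abs_summable_summable[OF abs])
  then show "((\<lambda>xs. prod_list (map a xs)) has_sum infsum a B ^ Suc n) (words B (Suc n))"
    unfolding has_sum_reindex_bij_betw[OF bij, symmetric] by simp
  show "(\<lambda>xs. norm (prod_list (map a xs))) summable_on words B (Suc n)"
    using abs unfolding summable_on_reindex_bij_betw[OF bij, symmetric] by simp
qed

text \<open>Partition the words by length: length n contributes the n-th power of the letter sum
  divided by n!, a term of the exponential series.\<close>

lemma has_sum_words_exp:
  fixes a :: "'b \<Rightarrow> complex"
  assumes a: "(\<lambda>x. norm (a x)) summable_on B"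
  shows "((\<lambda>xs. prod_list (map a xs) / fact (length xs)) has_sum exp (infsum a B)) {xs. set xs \<subseteq> B}"
    and "(\<lambda>xs. norm (prod_list (map a xs) / fact (length xs))) summable_on {xs. set xs \<subseteq> B}"
proof -
  let ?f = "\<lambda>p. prod_list (map a (snd p)) / (fact (fst p) :: complex)"
  let ?N = "infsum (\<lambda>x. norm (a x)) B"
  have "norm (prod_list (map a xs)) = prod_list (map (\<lambda>x. norm (a x)) xs)" for xs
    by (induction xs) (auto simp: norm_mult)
  then have nw: "((\<lambda>xs. norm (prod_list (map a xs))) has_sum ?N ^ n) (words B n)" for n
    using has_sum_words(1)[of "\<lambda>x. norm (a x)" B n] a by simp
  have abs: "(\<lambda>p. norm (?f p)) summable_on Sigma UNIV (words B)"
    unfolding Infinite_Sum.abs_summable_on_Sigma_iff unfolding fst_conv snd_conv norm_divide norm_fact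
  proof (intro conjI ballI)
    show "(\<lambda>xs. norm (prod_list (map a xs)) / fact n) summable_on words B n" for n
      using has_sum_imp_summable[OF nw]
      unfolding divide_inverse by (rule summable_on_cmult_left)
    have "(\<Sum>\<^sub>\<infinity>xs\<in>words B n. norm (prod_list (map a xs)) / fact n) = ?N ^ n / fact n" for n
      unfolding divide_inverse by (rule infsumI[OF has_sum_cmult_left[OF nw]])
    moreover have "(\<lambda>n. ?N ^ n / fact n) summable_on UNIV"
      using exp_converges[of ?N] sums_summable
      by (intro norm_summable_imp_summable_on)
        (auto simp: abs_mult divide_inverse infsum_nonneg power_abs mult.commute dest: sums_summable)
    ultimately show "(\<lambda>n. norm (\<Sum>\<^sub>\<infinity>xs\<in>words B n. norm (prod_list (map a xs)) / fact n)) summable_on UNIV"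
      by (simp add: infsum_nonneg)
  qed
  have bij: "bij_betw snd (Sigma UNIV (words B)) {xs. set xs \<subseteq> B}"
    by (rule bij_betwI[where g = "\<lambda>xs. (length xs, xs)"]) auto
  have "(?f has_sum exp (infsum a B)) (Sigma UNIV (words B))"
  proof (rule has_sum_SigmaI)
    show "((\<lambda>xs. ?f (n, xs)) has_sum infsum a B ^ n / fact n) (words B n)" for n
      using has_sum_cmult_left[OF has_sum_words(1)[OF a, of n], of "inverse (fact n)"]
      by (simp add: divide_inverse)
    have "norm (infsum a B ^ n /\<^sub>R fact n) = norm (infsum a B) ^ n /\<^sub>R fact n" for n
      by (simp add: norm_power)
    then have "summable (\<lambda>n. norm (infsum a B ^ n /\<^sub>R fact n))"
      using sums_summable[OF exp_converges[of "norm (infsum a B)"]] by simp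
    from norm_summable_imp_has_sum[OF this exp_converges]
    show "((\<lambda>n. infsum a B ^ n / fact n) has_sum exp (infsum a B)) UNIV"
      by (simp add: scaleR_conv_of_real divide_inverse mult.commute)
    show "?f summable_on Sigma UNIV (words B)" by (rule abs_summable_summable[OF abs])
  qed
  moreover have eq: "\<And>p. p \<in> Sigma UNIV (words B) \<Longrightarrow> ?f p = prod_list (map a (snd p)) / fact (length (snd p))"
    by auto
  ultimately show "((\<lambda>xs. prod_list (map a xs) / fact (length xs)) has_sum exp (infsum a B)) {xs. set xs \<subseteq> B}"
    unfolding has_sum_reindex_bij_betw[OF bij, symmetric] by (subst has_sum_cong[OF eq[symmetric]])
  show "(\<lambda>xs. norm (prod_list (map a xs) / fact (length xs))) summable_on {xs. set xs \<subseteq> B}"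
    using abs unfolding summable_on_reindex_bij_betw[OF bij, symmetric]
    by (subst summable_on_cong[OF arg_cong[where f = norm, OF eq[symmetric]]])
qed

lemma hinner_abs_summable:
  fixes k l :: "'a::{real_inner, polish_space} complexification"
  shows "(\<lambda>x. norm (cnj (hinner (of_h x) k) * hinner (of_h x) l)) summable_on hbasis"
proof -
  have s: "(\<lambda>x. (cmod (hinner (of_h x) k))\<^sup>2) summable_on hbasis" for k :: "'a complexification"
    by (rule nonneg_bdd_above_summable_on)
      (auto intro!: bdd_aboveI2[of _ _ "(norm (hRe k))\<^sup>2 + (norm (hIm k))\<^sup>2"] bessel)
  show ?thesis
    using abs_summable_product[of "\<lambda>x. cnj (hinner (of_h x) k)" hbasis "\<lambda>x. hinner (of_h x) l"] s[of k] s[of l]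
    by (simp add: norm_mult power2_eq_square)
qed

text \<open>The two factors 1 / sqrt(n!) combine to 1 / n!, which leaves an exponential series over
  words; its letter weights add up to \<open>hinner k l\<close> by Parseval.\<close>

lemma cinner_expvec:
  fixes k l :: "'a::{real_inner, polish_space} complexification"
  shows "cinner (expvec k) (expvec l) = exp (hinner k l)"
proof -
  let ?a = "\<lambda>x. cnj (hinner (of_h x) k) * hinner (of_h x) l"
  have pl: "cnj (prod_list (map (\<lambda>x. hinner (of_h x) k) xs)) * prod_list (map (\<lambda>x. hinner (of_h x) l) xs)
      = prod_list (map ?a xs)" for xs :: "'a list"
    by (induction xs) (auto simp: mult_ac)
  have sq: "complex_of_real (sqrt (fact n)) * complex_of_real (sqrt (fact n)) = fact n" for n
    by (simp add: of_real_mult[symmetric] del: of_real_mult)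
  have "cnj (Rep_fock (expvec k) xs) * Rep_fock (expvec l) xs
      = (if set xs \<subseteq> hbasis then prod_list (map ?a xs) / fact (length xs) else 0)" for xs
    using sq[of "length xs"] by (simp add: expvec.rep_eq pl[symmetric])
  then have "cinner (expvec k) (expvec l) =
      (\<Sum>\<^sub>\<infinity>xs. if set xs \<subseteq> hbasis then prod_list (map ?a xs) / fact (length xs) else 0)"
    by (simp add: cinner_fock.rep_eq)
  also have "\<dots> = (\<Sum>\<^sub>\<infinity>xs\<in>{xs. set xs \<subseteq> hbasis}. prod_list (map ?a xs) / fact (length xs))"
    by (rule infsum_cong_neutral) auto
  also have "\<dots> = exp (infsum ?a hbasis)"
    by (rule infsumI[OF has_sum_words_exp(1)[OF hinner_abs_summable]])
  also have "infsum ?a hbasis = hinner k l" by (rule infsumI[OF hinner_parseval])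
  finally show ?thesis .
qed

section \<open>Totality of the exponential vectors\<close>

lemma hbasis_inner:
  assumes "x \<in> hbasis" "y \<in> hbasis"
  shows "inner x (y::'a::{real_inner, polish_space}) = (if x = y then 1 else 0)"
  using is_hilbert_basis_hbasis[where 'a = 'a] assms
  by (auto simp: is_hilbert_basis_def pairwise_def orthogonal_def norm_eq_1)

text \<open>Unique factorisation: the prime factorisation of the product is the image of the
  multiset of letters, and injectivity of \<open>p\<close> recovers the letters.\<close>

lemma mset_eq_if_prod_primes_eq:
  fixes p :: "'b \<Rightarrow> nat"
  assumes p: "inj_on p S" "\<And>x. x \<in> S \<Longrightarrow> prime (p x)"
    and xs: "set xs \<subseteq> S" "set ys \<subseteq> S" "prod_list (map p xs) = prod_list (map p ys)"
  shows "mset xs = mset ys"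
proof -
  have pf: "prime_factorization (prod_list (map p zs)) = image_mset p (mset zs)" if "set zs \<subseteq> S" for zs
  proof -
    have "prod_list (map p zs) = prod_mset (image_mset p (mset zs))"
      by (simp add: prod_mset_prod_list[symmetric])
    then show ?thesis
      using that p(2) by (subst prime_factorization_prod_mset_primes[symmetric]) auto
  qed
  have id: "image_mset (inv_into S p) (image_mset p (mset zs)) = mset zs" if "set zs \<subseteq> S" for zs
    unfolding image_mset.compositionality
    using that p(1) by (subst image_mset_cong[of _ _ id]) auto
  show ?thesis using pf[OF xs(1)] pf[OF xs(2)] id[OF xs(1)] id[OF xs(2)] xs(3) by simp
qed

text \<open>Distinct words up to permutation have distinct products of primes, so a polynomial in that
  product separates them.\<close>

lemma symmetric_coeffs_eq_0:
  fixes b :: "'b list \<Rightarrow> complex"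
  assumes S: "finite S" and sym: "\<And>xs ys. mset xs = mset ys \<Longrightarrow> b xs = b ys"
    and zero: "\<And>r. (\<Sum>xs | set xs \<subseteq> S \<and> length xs = n. of_real (prod_list (map r xs)) * b xs) = 0"
    and xs0: "set xs0 \<subseteq> S" "length xs0 = n"
  shows "b xs0 = 0"
proof -
  let ?L = "words S n"
  have fL: "finite ?L" using finite_lists_length_eq[OF S] by simp
  obtain P where P: "P \<subseteq> {p::nat. prime p}" "finite P" "card P = card S"
    using infinite_arbitrarily_large[OF primes_infinite] by blast
  then obtain p where "bij_betw p S P" using S finite_same_card_bij by metis
  then have p: "inj_on p S" "\<And>x. x \<in> S \<Longrightarrow> prime (p x)"
    using P(1) by (auto simp: bij_betw_def)
  define N where "N xs = (of_nat (prod_list (map p xs)) :: complex)" for xs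
  \<comment> \<open>With \<open>r\<close> the j-th power of the chosen primes, the word weight
    becomes the j-th power of N.\<close>
  have Nj: "(\<Sum>xs\<in>?L. N xs ^ j * b xs) = 0" for j
  proof -
    have "complex_of_real (prod_list (map (\<lambda>x. real (p x) ^ j) xs)) = N xs ^ j" for xs
      by (induction xs) (auto simp: N_def power_mult_distrib)
    then show ?thesis using zero[of "\<lambda>x. real (p x) ^ j"] by simp
  qed
  \<comment> \<open>Vanishes at every value of N on words of this length other than
    \<open>N xs0\<close>, so that only words with the prime product of \<open>xs0\<close>
    survive.\<close>
  define q where "q = (\<Prod>m\<in>N ` ?L - {N xs0}. [:- m, 1:])"
  have "(\<Sum>xs\<in>?L. poly q (N xs) * b xs) = (\<Sum>i\<le>degree q. coeff q i * (\<Sum>xs\<in>?L. N xs ^ i * b xs))"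
    unfolding poly_altdef sum_distrib_left sum_distrib_right by (subst sum.swap) (simp add: mult.assoc)
  then have "(\<Sum>xs\<in>?L. poly q (N xs) * b xs) = 0" by (simp add: Nj)
  also have "(\<Sum>xs\<in>?L. poly q (N xs) * b xs) = (\<Sum>xs\<in>{xs \<in> ?L. N xs = N xs0}. poly q (N xs0) * b xs0)"
  proof (rule sum.mono_neutral_cong_right[OF fL])
    show "\<forall>xs\<in>?L - {xs \<in> ?L. N xs = N xs0}. poly q (N xs) * b xs = 0"
      using fL by (auto simp: q_def poly_prod)
    fix xs assume "xs \<in> {xs \<in> ?L. N xs = N xs0}"
    then have "prod_list (map p xs) = prod_list (map p xs0)" "set xs \<subseteq> S" "N xs = N xs0"
      by (auto simp: N_def)
    then show "poly q (N xs) * b xs = poly q (N xs0) * b xs0"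
      using mset_eq_if_prod_primes_eq[OF p, of xs xs0] sym[of xs xs0] xs0 by simp
  qed auto
  \<comment> \<open>The surviving words are permutations of \<open>xs0\<close> and share its
    coefficient; their number is positive because \<open>xs0\<close> is one of them.\<close>
  finally have "of_nat (card {xs \<in> ?L. N xs = N xs0}) * (poly q (N xs0) * b xs0) = 0" by simp
  moreover have "card {xs \<in> ?L. N xs = N xs0} \<noteq> 0"
  proof
    assume "card {xs \<in> ?L. N xs = N xs0} = 0"
    moreover have "finite {xs \<in> ?L. N xs = N xs0}" by (rule finite_subset[OF _ fL]) blast
    ultimately have "{xs \<in> ?L. N xs = N xs0} = {}" by (simp only: card_0_eq)
    moreover have "xs0 \<in> {xs \<in> ?L. N xs = N xs0}" using xs0 by simp
    ultimately show False by blast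
  qed
  moreover have "poly q (N xs0) \<noteq> 0" using fL by (auto simp: q_def poly_prod)
  ultimately show ?thesis by auto
qed

lemma real_powser_eq_0:
  fixes a :: "nat \<Rightarrow> real"
  assumes "\<And>s. (\<lambda>n. a n * s ^ n) sums 0"
  shows "a n = 0"
proof (rule ccontr)
  assume an: "a n \<noteq> 0"
  have "a 0 = 0" using assms[of 0] by simp
  with an have "n > 0" by (cases n) auto
  \<comment> \<open>Isolation of the zero at 0 of a nontrivial power series, applied to the function
    that is constantly 0.\<close>
  obtain s where "0 < s" "\<And>z. z \<in> cball 0 s - {0::real} \<Longrightarrow> (0::real) \<noteq> 0"
    by (rule powser_0_nonzero[of 1 "0::real" a "\<lambda>_. 0" n]) (use assms an \<open>n > 0\<close> in auto)
  from this(2)[of s] this(1) show False by simp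
qed

text \<open>Inner products with exponential vectors of s times a fixed real combination of basis
  vectors form a power series in s. Its n-th coefficient is, up to 1 / sqrt(n!), a sum of
  coefficients of \<psi> over words of length n with product weights, and its vanishing for all
  weights separates the symmetric coefficients.\<close>

lemma expvec_total:
  fixes \<psi> :: "'a::{real_inner, polish_space} fock"
  assumes zero: "\<And>k. cinner (expvec k) \<psi> = 0"
  shows "\<psi> = 0"
proof (rule fock_eqI)
  fix xs0 :: "'a list"
  show "Rep_fock \<psi> xs0 = Rep_fock 0 xs0"
  proof (cases "set xs0 \<subseteq> hbasis")
    case True
    define S where "S = set xs0"
    define n0 where "n0 = length xs0"
    have S: "finite S" "S \<subseteq> hbasis" using True by (auto simp: S_def)
    let ?L = "\<lambda>n. words S n"
    have fL: "finite (?L n)" for n using finite_lists_length_eq[OF S(1)] by simp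
    have "(\<Sum>xs\<in>?L n0. of_real (prod_list (map r xs)) * Rep_fock \<psi> xs) = 0" for r
    proof -
      define a where "a n = (\<Sum>xs\<in>?L n. of_real (prod_list (map r xs)) * Rep_fock \<psi> xs) / of_real (sqrt (fact n))" for n
      have sums: "(\<lambda>n. a n * of_real s ^ n) sums 0" for s :: real
      proof -
        \<comment> \<open>Supported on the letters of \<open>xs0\<close>: only words over the finite
          set S contribute, so that each length gives a finite sum.\<close>
        define k where "k = of_h (\<Sum>x\<in>S. (s * r x) *\<^sub>R x)"
        have hk: "hinner (of_h y) k = (if y \<in> S then of_real (s * r y) else 0)" if "y \<in> hbasis" for y
        proof -
          have "inner y (\<Sum>x\<in>S. (s * r x) *\<^sub>R x) = (\<Sum>x\<in>S. if y = x then s * r x else 0)"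
            unfolding inner_sum_right using that S(2) by (intro sum.cong) (auto simp: hbasis_inner subset_iff)
          then show ?thesis using S(1) by (simp add: k_def hinner_def of_h_def complex_eq_iff)
        qed
        have pl: "prod_list (map (\<lambda>x. hinner (of_h x) k) xs) =
            (if set xs \<subseteq> S then of_real s ^ length xs * of_real (prod_list (map r xs)) else 0)"
          if "set xs \<subseteq> hbasis" for xs
          using that by (induction xs) (auto simp: hk)
        have E: "cnj (Rep_fock (expvec k) xs) * Rep_fock \<psi> xs = (if set xs \<subseteq> S then
            of_real s ^ length xs * (of_real (prod_list (map r xs)) * Rep_fock \<psi> xs / of_real (sqrt (fact (length xs)))) else 0)" for xs
          using S(2) by (auto simp: expvec.rep_eq pl)
        have bij: "bij_betw snd (Sigma UNIV ?L) {xs. set xs \<subseteq> S}"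
          by (rule bij_betwI[where g = "\<lambda>xs. (length xs, xs)"]) auto
        have "((\<lambda>xs. cnj (Rep_fock (expvec k) xs) * Rep_fock \<psi> xs) has_sum 0) UNIV"
          using square_summable_cinner[OF square_summable_Rep_fock[of "expvec k"] square_summable_Rep_fock[of \<psi>]]
            zero[of k] unfolding cinner_complex_def cinner_fock.rep_eq by (simp add: has_sum_iff)
        then have "((\<lambda>xs. cnj (Rep_fock (expvec k) xs) * Rep_fock \<psi> xs) has_sum 0) {xs. set xs \<subseteq> S}"
          by (subst has_sum_cong_neutral[where T = UNIV]) (auto simp: E)
        then have "((\<lambda>p. cnj (Rep_fock (expvec k) (snd p)) * Rep_fock \<psi> (snd p)) has_sum 0) (Sigma UNIV ?L)"
          by (simp only: has_sum_reindex_bij_betw[OF bij,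
              of "\<lambda>xs. cnj (Rep_fock (expvec k) xs) * Rep_fock \<psi> xs"])
        then have "((\<lambda>n. \<Sum>xs\<in>?L n. cnj (Rep_fock (expvec k) xs) * Rep_fock \<psi> xs) has_sum 0) UNIV"
          by (rule has_sum_SigmaD) (use fL in \<open>auto intro!: has_sum_finiteI\<close>)
        also have "(\<lambda>n. \<Sum>xs\<in>?L n. cnj (Rep_fock (expvec k) xs) * Rep_fock \<psi> xs) = (\<lambda>n. a n * of_real s ^ n)"
          by (rule ext)
            (auto simp: E a_def sum_divide_distrib sum_distrib_right intro!: sum.cong)
        finally show ?thesis by (rule has_sum_imp_sums)
      qed
      \<comment> \<open>The series is known for real s, so the identity theorem is used on real and
        imaginary parts separately.\<close>
      have "a n0 = 0"
      proof (rule complex_eqI)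
        have "(\<lambda>n. Re (a n) * s ^ n) sums 0" for s
          using sums_Re[OF sums[of s]] by (simp flip: of_real_power)
        then show "Re (a n0) = Re 0"
          using real_powser_eq_0[of "\<lambda>n. Re (a n)" n0] by simp
        have "(\<lambda>n. Im (a n) * s ^ n) sums 0" for s
          using sums_Im[OF sums[of s]] by (simp flip: of_real_power)
        then show "Im (a n0) = Im 0"
          using real_powser_eq_0[of "\<lambda>n. Im (a n)" n0] by simp
      qed
      then show ?thesis by (simp add: a_def)
    qed
    then have "Rep_fock \<psi> xs0 = 0"
      by (intro symmetric_coeffs_eq_0[OF S(1) Rep_fock_perm, where n = n0]) (auto simp: S_def n0_def)
    then show ?thesis by (simp add: zero_fock.rep_eq)
  qed (simp add: Rep_fock_outside)
qed

section \<open>Weyl operators on exponential vectors\<close>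

definition shift_h :: "'a::real_inner complexification \<Rightarrow> real \<Rightarrow> 'a complexification \<Rightarrow>
    'a complexification" where
  "shift_h z t k = Cpx (hRe k + t *\<^sub>R hRe z) (hIm k + t *\<^sub>R hIm z)"

lemma hinner_shift_right: "hinner l (shift_h z t k) = hinner l k + of_real t * hinner l z"
  by (simp add: hinner_def shift_h_def complex_eq_iff inner_add_right algebra_simps)

lemma hinner_cnj: "cnj (hinner k l) = hinner l k"
  by (simp add: hinner_def complex_eq_iff inner_commute)

lemma hinner_shift_left: "hinner (shift_h z t k) l = hinner k l + of_real t * hinner z l"
  by (metis complex_cnj_add complex_cnj_complex_of_real complex_cnj_mult hinner_cnj hinner_shift_right)

lemma hinner_self: "hinner z z = of_real ((norm (hRe z))\<^sup>2 + (norm (hIm z))\<^sup>2)"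
  by (simp add: hinner_def complex_eq_iff power2_norm_eq_inner inner_commute)

text \<open>Has the shape of the coefficients of an exponential vector with letter weights
  \<open>g\<close>; it serves as a square-summable majorant.\<close>

definition word_weight :: "('a::{real_inner, polish_space} \<Rightarrow> real) \<Rightarrow> 'a list \<Rightarrow> real" where
  "word_weight g xs = (if set xs \<subseteq> hbasis then prod_list (map g xs) / sqrt (fact (length xs)) else 0)"

lemma word_weight_nonneg: "(\<And>x. 0 \<le> g x) \<Longrightarrow> 0 \<le> word_weight g xs"
  by (auto simp: word_weight_def intro!: divide_nonneg_nonneg prod_list_nonneg)

lemma hinner_square_summable:
  "(\<lambda>x. (cmod (hinner (of_h x) k))\<^sup>2) summable_on (hbasis :: 'a::{real_inner, polish_space} set)"
  by (rule nonneg_bdd_above_summable_on)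
    (auto intro!: bdd_aboveI2[of _ _ "(norm (hRe k))\<^sup>2 + (norm (hIm k))\<^sup>2"] bessel)

text \<open>Squaring gives the terms of the exponential series over words with letter weights
  \<open>(g x)\<^sup>2\<close>.\<close>

lemma word_weight_summable:
  fixes g :: "'a::{real_inner, polish_space} \<Rightarrow> real"
  assumes "(\<lambda>x. (g x)\<^sup>2) summable_on hbasis"
  shows "(\<lambda>xs. (word_weight g xs)\<^sup>2) summable_on UNIV"
proof -
  have "norm (prod_list (map (\<lambda>x. complex_of_real ((g x)\<^sup>2)) xs)) = (prod_list (map g xs))\<^sup>2" for xs
    by (induction xs) (auto simp: norm_mult power_mult_distrib simp del: of_real_power)
  then have "norm (prod_list (map (\<lambda>x. complex_of_real ((g x)\<^sup>2)) xs) / fact (length xs))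
      = (prod_list (map g xs))\<^sup>2 / fact (length xs)" for xs
    by (simp add: norm_divide del: of_real_power)
  then have "(\<lambda>xs. (prod_list (map g xs))\<^sup>2 / fact (length xs)) summable_on {xs. set xs \<subseteq> hbasis}"
    using has_sum_words_exp(2)[of "\<lambda>x. complex_of_real ((g x)\<^sup>2)" hbasis] assms by (simp del: of_real_power)
  also have "?this \<longleftrightarrow> (\<lambda>xs. (word_weight g xs)\<^sup>2) summable_on UNIV"
    by (rule summable_on_cong_neutral) (auto simp: word_weight_def power_divide)
  finally show ?thesis .
qed

text \<open>The power series in \<open>s\<close> of the coefficients of the image of \<open>expvec k\<close> under the Weyl
  operator with argument \<open>s z\<close>.\<close>

definition weyl_factor :: "'a::real_inner complexification \<Rightarrow> 'a complexification \<Rightarrow> complex \<Rightarrow> complex" where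
  "weyl_factor z k s = exp (- (s\<^sup>2 * hinner z z / 2) - s * hinner z k)"

definition weyl_fps :: "'a::{real_inner, polish_space} complexification \<Rightarrow> 'a complexification \<Rightarrow>
    'a list \<Rightarrow> complex fps" where
  "weyl_fps z k xs = (if set xs \<subseteq> hbasis then
     fps_const (1 / of_real (sqrt (fact (length xs)))) * (fps_expansion (weyl_factor z k) 0 *
     prod_list (map (\<lambda>x. fps_const (hinner (of_h x) k) + fps_const (hinner (of_h x) z) * fps_X) xs)) else 0)"

text \<open>Here s is complex, and it enters the Gaussian factor through its square rather than its
  squared modulus. The coefficients are thus entire in s and Cauchy estimates apply.\<close>

definition weyl_fun :: "'a::{real_inner, polish_space} complexification \<Rightarrow> 'a complexification \<Rightarrow>
    complex \<Rightarrow> 'a list \<Rightarrow> complex" where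
  "weyl_fun z k s xs = (if set xs \<subseteq> hbasis then
     1 / of_real (sqrt (fact (length xs))) * (weyl_factor z k s *
     prod_list (map (\<lambda>x. hinner (of_h x) k + hinner (of_h x) z * s) xs)) else 0)"

lemma weyl_factor_holomorphic: "weyl_factor z k holomorphic_on A"
  unfolding weyl_factor_def by (intro holomorphic_intros) auto

lemma weyl_factor_expansion: "weyl_factor z k has_fps_expansion fps_expansion (weyl_factor z k) 0"
  by (rule has_fps_expansion_fps_expansion[of UNIV]) (auto intro: weyl_factor_holomorphic)

text \<open>The Gaussian factor solves a first-order linear equation; its formal version is later
  matched with the action of the generator on coefficients.\<close>

lemma weyl_factor_deriv:
  "fps_deriv (fps_expansion (weyl_factor z k) 0) =
    - (fps_const (hinner z z) * fps_X + fps_const (hinner z k)) * fps_expansion (weyl_factor z k) 0"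
proof (rule fps_expansion_unique_complex)
  show "deriv (weyl_factor z k) has_fps_expansion fps_deriv (fps_expansion (weyl_factor z k) 0)"
    by (rule has_fps_expansion_deriv[OF weyl_factor_expansion])
  have "(weyl_factor z k has_field_derivative - (hinner z z * s
      + hinner z k) * weyl_factor z k s) (at s)" for s
    unfolding weyl_factor_def by (auto intro!: derivative_eq_intros simp: algebra_simps)
  then have "deriv (weyl_factor z k) = (\<lambda>s. - (hinner z z * s + hinner z k) * weyl_factor z k s)"
    by (auto intro: DERIV_imp_deriv)
  moreover have "(\<lambda>s. - (hinner z z * s + hinner z k) * weyl_factor z k s) has_fps_expansion
      - (fps_const (hinner z z) * fps_X + fps_const (hinner z k)) * fps_expansion (weyl_factor z k) 0"
    by (intro fps_expansion_intros weyl_factor_expansion)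
  ultimately show "deriv (weyl_factor z k) has_fps_expansion
      - (fps_const (hinner z z) * fps_X + fps_const (hinner z k)) * fps_expansion (weyl_factor z k) 0"
    by simp
qed

lemma weyl_fun_expansion: "(\<lambda>s. weyl_fun z k s xs) has_fps_expansion weyl_fps z k xs"
proof (cases "set xs \<subseteq> hbasis")
  case True
  have "(\<lambda>s. prod_list (map (\<lambda>x. hinner (of_h x) k + hinner (of_h x) z * s) xs)) has_fps_expansion
     prod_list (map (\<lambda>x. fps_const (hinner (of_h x) k) + fps_const (hinner (of_h x) z) * fps_X) xs)"
    by (induction xs) (auto intro!: fps_expansion_intros)
  then show ?thesis unfolding weyl_fun_def weyl_fps_def if_P[OF True]
    by (intro fps_expansion_intros weyl_factor_expansion)
qed (simp add: weyl_fun_def weyl_fps_def)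

lemma weyl_fun_holomorphic: "(\<lambda>s. weyl_fun z k s xs) holomorphic_on A"
proof -
  have "(\<lambda>s. prod_list (map (\<lambda>x. hinner (of_h x) k + hinner (of_h x) z * s) xs)) holomorphic_on A"
    by (induction xs) (auto intro!: holomorphic_intros)
  then show ?thesis unfolding weyl_fun_def
    by (cases "set xs \<subseteq> hbasis") (auto intro!: holomorphic_intros weyl_factor_holomorphic[unfolded fun_eq_iff])
qed

lemma weyl_fps_sums: "(\<lambda>n. fps_nth (weyl_fps z k xs) n * s ^ n) sums weyl_fun z k s xs"
  by (rule has_fps_expansion_imp_sums_complex[OF weyl_fun_expansion weyl_fun_holomorphic, of _ "\<infinity>"]) simp

text \<open>Dominates the letter factor of \<open>weyl_fun\<close> on the circle of radius 2, whence
  the constant 2.\<close>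

definition weyl_weight :: "'a::real_inner complexification \<Rightarrow> 'a complexification \<Rightarrow> 'a \<Rightarrow> real" where
  "weyl_weight z k x = cmod (hinner (of_h x) k) + 2 * cmod (hinner (of_h x) z)"

lemma weyl_weight_nonneg: "0 \<le> weyl_weight z k x"
  by (simp add: weyl_weight_def)

definition weyl_bound :: "'a::real_inner complexification \<Rightarrow> 'a complexification \<Rightarrow> real" where
  "weyl_bound z k = exp (2 * cmod (hinner z z) + 2 * cmod (hinner z k))"

text \<open>Cauchy's inequality on the circle of radius 2. A radius above 1 gives geometric
  convergence of the Taylor series up to t = 1, where the Weyl operator itself is read off.\<close>

lemma weyl_fps_bound:
  "cmod (fps_nth (weyl_fps z k xs) n) \<le> weyl_bound z k * word_weight (weyl_weight z k) xs / 2 ^ n"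
proof -
  have "norm ((deriv ^^ n) (\<lambda>s. weyl_fun z k s xs) 0)
      \<le> fact n * (weyl_bound z k * word_weight (weyl_weight z k) xs) / 2 ^ n"
  proof (rule Cauchy_inequality)
    fix s :: complex assume "norm (0 - s) = 2"
    then have s: "cmod s = 2" by simp
    have "cmod (weyl_factor z k s) \<le> exp (cmod (- (s\<^sup>2 * hinner z z / 2) - s * hinner z k))"
      unfolding weyl_factor_def by (rule norm_exp)
    also have "cmod (- (s\<^sup>2 * hinner z z / 2) - s * hinner z k)
        \<le> cmod (- (s\<^sup>2 * hinner z z / 2)) + cmod (s * hinner z k)" by (rule norm_triangle_ineq4)
    also have "\<dots> = 2 * cmod (hinner z z) + 2 * cmod (hinner z k)"
      by (simp add: norm_mult norm_divide norm_power s)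
    finally have f: "cmod (weyl_factor z k s) \<le> weyl_bound z k" by (simp add: weyl_bound_def)
    have p: "cmod (prod_list (map (\<lambda>x. hinner (of_h x) k + hinner (of_h x) z * s) ys))
        \<le> prod_list (map (weyl_weight z k) ys)" for ys
    proof (induction ys)
      case (Cons y ys)
      have "cmod (hinner (of_h y) k + hinner (of_h y) z * s) \<le> weyl_weight z k y"
        using norm_triangle_ineq[of "hinner (of_h y) k" "hinner (of_h y) z * s"]
        by (simp add: weyl_weight_def norm_mult s)
      then show ?case using Cons by (auto simp: norm_mult weyl_weight_nonneg intro!: mult_mono)
    qed simp
    show "cmod (weyl_fun z k s xs) \<le> weyl_bound z k * word_weight (weyl_weight z k) xs"
      unfolding weyl_fun_def word_weight_def
      using mult_mono[OF f p[of xs]]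
      by (auto simp: norm_mult norm_divide weyl_bound_def intro!: divide_right_mono)
  qed (auto intro!: weyl_fun_holomorphic holomorphic_on_imp_continuous_on)
  then show ?thesis
    unfolding fps_nth_fps_expansion[OF weyl_fun_expansion] by (simp add: norm_divide divide_simps mult_ac)
qed

lemma weyl_weight_summable:
  "(\<lambda>x. (weyl_weight z k x)\<^sup>2) summable_on (hbasis :: 'a::{real_inner, polish_space} set)"
proof (rule summable_on_comparison_test)
  show "(\<lambda>x. 2 * (cmod (hinner (of_h x) k))\<^sup>2 + 8 * (cmod (hinner (of_h x) z))\<^sup>2) summable_on hbasis"
    by (intro summable_on_add summable_on_cmult_right hinner_square_summable)
  fix x :: 'a
  have "0 \<le> (cmod (hinner (of_h x) k) - 2 * cmod (hinner (of_h x) z))\<^sup>2" by simp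
  then show "(weyl_weight z k x)\<^sup>2 \<le> 2 * (cmod (hinner (of_h x) k))\<^sup>2 + 8 * (cmod (hinner (of_h x) z))\<^sup>2"
    unfolding weyl_weight_def by (simp add: power2_sum power2_diff power_mult_distrib)
qed auto

lemma weyl_fps_perm:
  assumes m: "mset xs = mset ys" shows "weyl_fps z k xs = weyl_fps z k ys"
proof -
  have "prod_list (map f xs) = prod_list (map f ys)" for f :: "'a \<Rightarrow> complex fps"
    unfolding prod_mset_prod_list[symmetric] mset_map m ..
  then show ?thesis unfolding weyl_fps_def by (simp only: mset_eq_setD[OF m] mset_eq_length[OF m])
qed

section \<open>Taylor expansion of the Weyl orbit of an exponential vector\<close>

lemma fock_coeffsI:
  assumes "\<And>xs. \<not> set xs \<subseteq> hbasis \<Longrightarrow> F xs = 0" "\<And>xs ys. mset xs = mset ys \<Longrightarrow> F xs = F ys"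
    "(\<lambda>xs. (H xs)\<^sup>2) summable_on UNIV" "\<And>xs. cmod (F xs) \<le> H xs"
  shows "F \<in> fock_coeffs"
  unfolding fock_coeffs_def mem_Collect_eq
  by (intro conjI allI impI square_summable_complex_bound[OF assms(3,4)] assms(1,2))

text \<open>This vector is 1 / n! times the n-th iterate of the generator on
  \<open>expvec k\<close>; the identification is made in the proof of
  \<open>weyl_expvec\<close>.\<close>

definition weyl_taylor :: "'a::{real_inner, polish_space} complexification \<Rightarrow> 'a complexification \<Rightarrow>
    nat \<Rightarrow> 'a fock" where
  "weyl_taylor z k n = to_fock (\<lambda>xs. fps_nth (weyl_fps z k xs) n)"

lemma Rep_weyl_taylor: "Rep_fock (weyl_taylor z k n) xs = fps_nth (weyl_fps z k xs) n"
proof -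
  have "(\<lambda>xs. fps_nth (weyl_fps z k xs) n) \<in> fock_coeffs"
  proof (rule fock_coeffsI)
    show "(\<lambda>xs. (weyl_bound z k * word_weight (weyl_weight z k) xs / 2 ^ n)\<^sup>2) summable_on UNIV"
      using summable_on_cmult_right[OF word_weight_summable[OF weyl_weight_summable[of z k]],
          of "(weyl_bound z k / 2 ^ n)\<^sup>2"]
      by (simp add: power_mult_distrib power_divide)
    show "fps_nth (weyl_fps z k xs) n = fps_nth (weyl_fps z k ys) n" if "mset xs = mset ys" for xs ys
      by (simp only: weyl_fps_perm[OF that])
    show "fps_nth (weyl_fps z k xs) n = 0" if "\<not> set xs \<subseteq> hbasis" for xs
      using that by (simp add: weyl_fps_def)
  qed (rule weyl_fps_bound)
  then show ?thesis by (simp add: weyl_taylor_def Rep_fock_to_fock)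
qed

text \<open>The closed formula for the Weyl operator with argument t z on an exponential vector. Its
  agreement with the operator series at t = 1 is \<open>weyl_expvec\<close>.\<close>

definition weyl_vec :: "'a::{real_inner, polish_space} complexification \<Rightarrow> real \<Rightarrow> 'a complexification \<Rightarrow>
    'a fock" where
  "weyl_vec z t k = weyl_factor z k (of_real t) *\<^sub>C expvec (shift_h z t k)"

lemma Rep_weyl_vec: "Rep_fock (weyl_vec z t k) xs = weyl_fun z k (of_real t) xs"
  by (simp add: weyl_vec_def scaleC_fock.rep_eq expvec.rep_eq weyl_fun_def hinner_shift_right mult.commute)

text \<open>The coefficientwise tails are dominated by a geometric series times one fixed
  square-summable family. At t = 1 this yields convergence of the Taylor series; with N = 2 it
  yields the derivative at t = 0.\<close>

lemma weyl_taylor_remainder: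
  "\<exists>C\<ge>0. \<forall>t N. \<bar>t\<bar> \<le> 1 \<longrightarrow>
     norm (weyl_vec z t k - (\<Sum>n<N. t ^ n *\<^sub>R weyl_taylor z k n)) \<le> C * (\<bar>t\<bar> / 2) ^ N"
proof -
  let ?H = "word_weight (weyl_weight z k)"
  \<comment> \<open>The factor 2 is the sum of the geometric series with ratio 1/2.\<close>
  let ?B = "2 * weyl_bound z k"
  have B: "0 \<le> weyl_bound z k" by (simp add: weyl_bound_def)
  have "norm (weyl_vec z t k - (\<Sum>n<N. t ^ n *\<^sub>R weyl_taylor z k n))
      \<le> ?B * (\<bar>t\<bar> / 2) ^ N * sqrt (\<Sum>\<^sub>\<infinity>xs. (?H xs)\<^sup>2)" if t: "\<bar>t\<bar> \<le> 1" for t N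
  proof (rule norm_fock_le[OF word_weight_summable[OF weyl_weight_summable]])
    fix xs :: "'a list"
    let ?c = "\<lambda>n. fps_nth (weyl_fps z k xs) n * of_real t ^ n"
    define M where "M = weyl_bound z k * ?H xs"
    have M: "0 \<le> M" using B by (simp add: M_def word_weight_nonneg weyl_weight_nonneg)
    have s: "?c sums weyl_fun z k (of_real t) xs" by (rule weyl_fps_sums)
    have b: "norm (?c (n + N)) \<le> M * (\<bar>t\<bar> / 2) ^ N * (1/2) ^ n" for n
    proof -
      have "norm (?c (n + N)) = cmod (fps_nth (weyl_fps z k xs) (n + N)) * \<bar>t\<bar> ^ (n + N)"
        by (simp add: norm_mult norm_power)
      also have "\<dots> \<le> M / 2 ^ (n + N) * \<bar>t\<bar> ^ (n + N)"
        using weyl_fps_bound[of z k xs "n + N"] by (intro mult_right_mono) (auto simp: M_def)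
      also have "\<dots> = M * (\<bar>t\<bar> / 2) ^ N * (1/2) ^ n * \<bar>t\<bar> ^ n" by (simp add: power_add power_divide mult_ac)
      also have "\<dots> \<le> M * (\<bar>t\<bar> / 2) ^ N * (1/2) ^ n * 1"
        using t M by (intro mult_left_mono power_le_one) auto
      finally show ?thesis by simp
    qed
    have "weyl_fun z k (of_real t) xs - (\<Sum>n<N. ?c n) = (\<Sum>n. ?c (n + N))"
      using suminf_minus_initial_segment[OF sums_summable[OF s], of N] sums_unique[OF s] by simp
    moreover have "norm (\<Sum>n. ?c (n + N)) \<le> (\<Sum>n. M * (\<bar>t\<bar> / 2) ^ N * (1/2) ^ n)"
      by (rule norm_suminf_le[OF b]) (intro summable_mult summable_geometric, simp)
    moreover have "(\<Sum>n. M * (\<bar>t\<bar> / 2) ^ N * (1/2) ^ n) = 2 * M * (\<bar>t\<bar> / 2) ^ N"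
      by (subst suminf_mult) (auto simp: suminf_geometric intro: summable_geometric)
    ultimately have "cmod (weyl_fun z k (of_real t) xs - (\<Sum>n<N. ?c n)) \<le> 2 * M * (\<bar>t\<bar> / 2) ^ N" by simp
    then show "cmod (Rep_fock (weyl_vec z t k - (\<Sum>n<N. t ^ n *\<^sub>R weyl_taylor z k n)) xs)
        \<le> ?B * (\<bar>t\<bar> / 2) ^ N * ?H xs"
      by (simp add: Rep_fock_diff Rep_fock_sum Rep_fock_scaleR Rep_weyl_taylor Rep_weyl_vec M_def mult_ac)
  qed (use B in auto)
  then show ?thesis using B
    by (intro exI[of _ "?B * sqrt (\<Sum>\<^sub>\<infinity>xs. (?H xs)\<^sup>2)"]) (auto simp: mult_ac infsum_nonneg)
qed

lemma weyl_taylor_sums: "weyl_taylor z k sums weyl_vec z 1 k"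
proof -
  obtain C where "\<And>t N. \<bar>t\<bar> \<le> 1 \<Longrightarrow>
      norm (weyl_vec z t k - (\<Sum>n<N. t ^ n *\<^sub>R weyl_taylor z k n)) \<le> C * (\<bar>t\<bar> / 2) ^ N"
    using weyl_taylor_remainder[of z k] by blast
  from this[of 1] have C: "norm (weyl_vec z 1 k - (\<Sum>n<N. weyl_taylor z k n)) \<le> C * (1/2) ^ N" for N
    by simp
  have "(\<lambda>N. C * (1/2) ^ N) \<longlonglongrightarrow> C * 0"
    by (intro tendsto_mult tendsto_const LIMSEQ_power_zero) simp
  then have "(\<lambda>N. weyl_vec z 1 k - (\<Sum>n<N. weyl_taylor z k n)) \<longlonglongrightarrow> 0"
    by (intro Lim_null_comparison[OF always_eventually[OF allI[OF C]]]) simp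
  then have "(\<lambda>N. weyl_vec z 1 k - (weyl_vec z 1 k - (\<Sum>n<N. weyl_taylor z k n))) \<longlonglongrightarrow> weyl_vec z 1 k - 0"
    by (intro tendsto_diff tendsto_const)
  then show ?thesis by (simp add: sums_def)
qed

section \<open>Creation and annihilation operators on the Taylor vectors\<close>

lemma to_fock_Rep: "to_fock (Rep_fock F) = F"
  using Rep_fock[of F] by (simp add: to_fock_def Rep_fock_inverse)

text \<open>The default value 0 of \<open>to_fock\<close> respects scaling: for c nonzero,
  membership in \<open>fock_coeffs\<close> is unaffected, and for c = 0 both sides vanish.\<close>

lemma to_fock_scale:
  fixes F :: "'a::{real_inner, polish_space} list \<Rightarrow> complex"
  shows "to_fock (\<lambda>xs. c * F xs) = c *\<^sub>C to_fock F"
proof (cases "c = 0")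
  case True
  have "Rep_fock (to_fock (\<lambda>xs. c * F xs)) xs = Rep_fock (c *\<^sub>C to_fock F) xs" for xs
    using Rep_fock_to_fock[OF fock_coeffs_0[where 'a = 'a]] True by (simp add: scaleC_fock.rep_eq)
  then show ?thesis by (rule fock_eqI)
next
  case False
  show ?thesis
  proof (cases "F \<in> fock_coeffs")
    case True
    then have "Rep_fock (to_fock (\<lambda>xs. c * F xs)) xs = Rep_fock (c *\<^sub>C to_fock F) xs" for xs
      by (simp only: Rep_fock_to_fock fock_coeffs_scale scaleC_fock.rep_eq)
    then show ?thesis by (rule fock_eqI)
  next
    case nF: False
    have "(\<lambda>xs. c * F xs) \<notin> fock_coeffs"
    proof
      assume "(\<lambda>xs. c * F xs) \<in> fock_coeffs"
      then have "(\<lambda>xs. inverse c * (c * F xs)) \<in> fock_coeffs" by (rule fock_coeffs_scale)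
      then show False using nF False by (simp add: mult.assoc[symmetric])
    qed
    then show ?thesis using nF by (simp add: to_fock_def)
  qed
qed

lemma annihilation_scaleC: "annihilation h (c *\<^sub>C F) = c *\<^sub>C annihilation h F"
  unfolding annihilation_def to_fock_scale[symmetric] scaleC_fock.rep_eq
    mult.left_commute[of _ c] infsum_cmult_right' ..

lemma creation_scaleC: "creation h (c *\<^sub>C F) = c *\<^sub>C creation h F"
  unfolding creation_def to_fock_scale[symmetric] scaleC_fock.rep_eq
  by (rule arg_cong[of _ _ to_fock]) (auto simp: fun_eq_iff sum_distrib_left mult_ac)

lemma scaleC_commute: "c *\<^sub>C d *\<^sub>C x = d *\<^sub>C c *\<^sub>C (x::'a::complex_inner)"
  by (simp add: scaleC_scaleC mult.commute)

lemma scaleC_diff_right: "c *\<^sub>C (x - y) = c *\<^sub>C x - c *\<^sub>C (y::'a::complex_inner)"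
  by (rule bounded_clinearD(2)[OF bounded_clinear_scaleC])

lemma P_op_scaleC: "P_op h (c *\<^sub>C F) = c *\<^sub>C P_op h F"
  unfolding P_op_def annihilation_scaleC creation_scaleC scaleC_diff_right[symmetric]
  by (rule scaleC_commute)

lemma Q_op_scaleC: "Q_op h (c *\<^sub>C F) = c *\<^sub>C Q_op h F"
  unfolding Q_op_def annihilation_scaleC creation_scaleC scaleC_add_right ..

text \<open>Coefficient n of s times the series; the value 0 at n = 0 stands for the coefficient of
  index -1.\<close>

definition weyl_taylor_prev :: "'a::{real_inner, polish_space} complexification \<Rightarrow>
    'a complexification \<Rightarrow> nat \<Rightarrow> 'a fock" where
  "weyl_taylor_prev z k n = (if n = 0 then 0 else weyl_taylor z k (n - 1))"

lemma Rep_weyl_taylor_prev: "Rep_fock (weyl_taylor_prev z k n) xs = fps_nth (fps_X * weyl_fps z k xs) n"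
  by (simp add: weyl_taylor_prev_def Rep_weyl_taylor zero_fock.rep_eq fps_X_mult_nth)

lemma weyl_fps_Cons:
  assumes "x \<in> hbasis"
  shows "fps_const (of_real (sqrt (real (length xs + 1)))) * weyl_fps z k (x # xs) =
    (fps_const (hinner (of_h x) k) + fps_const (hinner (of_h x) z) * fps_X) * weyl_fps z k xs"
proof -
  define n where "n = length xs"
  have "complex_of_real (sqrt (real (n + 1))) * (1 / of_real (sqrt (fact (Suc n))))
      = 1 / of_real (sqrt (fact n))"
    by (simp add: real_sqrt_mult divide_simps)
  then have c: "fps_const (complex_of_real (sqrt (real (n
      + 1)))) * fps_const (1 / of_real (sqrt (fact (Suc n))))
      = fps_const (1 / of_real (sqrt (fact n)))" by (simp only: fps_const_mult)
  show ?thesis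
  proof (cases "set xs \<subseteq> hbasis")
    case True
    then show ?thesis
      using assms c unfolding weyl_fps_def n_def[symmetric]
      by (simp only: set_simps insert_subset if_True list.size add_0_right add_Suc_right simp_thms
          mult.assoc[symmetric] One_nat_def list.map prod_list.Cons n_def[symmetric] plus_1_eq_Suc Suc_eq_plus1[symmetric])
        (simp only: mult_ac)
  qed (simp add: weyl_fps_def)
qed

text \<open>Exponential vectors are eigenvectors of annihilation; for k + t z the eigenvalue is <h,
  k> + t <h, z>. This is that relation at order n, with the sum over the removed letter evaluated by
  Parseval.\<close>

lemma annihilation_weyl_taylor:
  "annihilation h (weyl_taylor z k n) =
     hinner h k *\<^sub>C weyl_taylor z k n + hinner h z *\<^sub>C weyl_taylor_prev z k n"
proof -
  let ?F = "hinner h k *\<^sub>C weyl_taylor z k n + hinner h z *\<^sub>C weyl_taylor_prev z k n"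
  have "of_real (sqrt (length xs + 1)) *
     (\<Sum>\<^sub>\<infinity>x\<in>hbasis. cnj (hinner (of_h x) h) * Rep_fock (weyl_taylor z k n) (x # xs)) = Rep_fock ?F xs" for xs
  proof -
    define p where "p = Rep_fock (weyl_taylor z k n) xs"
    define q where "q = Rep_fock (weyl_taylor_prev z k n) xs"
    have "cnj (hinner (of_h x) h) * (of_real (sqrt (length xs + 1)) * Rep_fock (weyl_taylor z k n) (x # xs))
        = cnj (hinner (of_h x) h) * hinner (of_h x) k * p + cnj (hinner (of_h x) h) * hinner (of_h x) z * q"
      if "x \<in> hbasis" for x
    proof -
      have "of_real (sqrt (length xs + 1)) * Rep_fock (weyl_taylor z k n) (x # xs) =
          fps_nth (fps_const (of_real (sqrt (real (length xs + 1)))) * weyl_fps z k (x # xs)) n"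
        by (simp add: Rep_weyl_taylor)
      also have "\<dots> = hinner (of_h x) k * p + hinner (of_h x) z * q"
        unfolding weyl_fps_Cons[OF that] p_def q_def Rep_weyl_taylor Rep_weyl_taylor_prev
        by (simp add: distrib_right mult.assoc)
      finally show ?thesis by (simp add: algebra_simps)
    qed
    then have "(\<Sum>\<^sub>\<infinity>x\<in>hbasis. cnj (hinner (of_h x) h) * (of_real (sqrt (length xs
        + 1)) * Rep_fock (weyl_taylor z k n) (x # xs)))
        = (\<Sum>\<^sub>\<infinity>x\<in>hbasis. cnj (hinner (of_h x) h) * hinner (of_h x) k * p
            + cnj (hinner (of_h x) h) * hinner (of_h x) z * q)"
      by (rule infsum_cong)
    also have "\<dots> = hinner h k * p + hinner h z * q"
      by (intro infsumI has_sum_add has_sum_cmult_left hinner_parseval)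
    finally show ?thesis
      unfolding plus_fock.rep_eq scaleC_fock.rep_eq p_def[symmetric] q_def[symmetric]
        infsum_cmult_right'[symmetric] by (simp only: mult_ac)
  qed
  then show ?thesis unfolding annihilation_def by (simp only: to_fock_Rep)
qed

lemma mset_take_drop:
  assumes "i < length xs" shows "mset (take i xs @ drop (Suc i) xs) = mset xs - {#xs ! i#}"
proof -
  have "mset xs = mset (take i xs @ xs ! i # drop (Suc i) xs)"
    using assms by (simp only: id_take_nth_drop[symmetric])
  then show ?thesis by simp
qed

text \<open>The sum over positions is a sum over the multiset of letters: by symmetry of F, the word
  left after a deletion may be replaced by a fixed list with the same multiset.\<close>

lemma sum_delete_perm:
  fixes a :: "'b \<Rightarrow> complex" and F :: "'b list \<Rightarrow> complex"
  assumes F: "\<And>xs ys. mset xs = mset ys \<Longrightarrow> F xs = F ys" and m: "mset xs = mset ys"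
  shows "(\<Sum>i<length xs. a (xs ! i) * F (take i xs @ drop (Suc i) xs))
      = (\<Sum>i<length ys. a (ys ! i) * F (take i ys @ drop (Suc i) ys))"
proof -
  define G where "G M x = a x * F (SOME l. mset l = M - {#x#})" for M x
  have "(\<Sum>i<length xs. a (xs ! i) * F (take i xs @ drop (Suc i) xs))
      = sum_mset (image_mset (G (mset xs)) (mset xs))" for xs
  proof -
    have "a (xs ! i) * F (take i xs @ drop (Suc i) xs) = G (mset xs) (xs ! i)" if "i < length xs" for i
    proof -
      have "mset (SOME l. mset l = mset xs - {#xs ! i#}) = mset xs - {#xs ! i#}"
        by (rule someI[of _ "take i xs @ drop (Suc i) xs"]) (rule mset_take_drop[OF that])
      then show ?thesis unfolding G_def using F mset_take_drop[OF that] by metis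
    qed
    then have "(\<Sum>i<length xs. a (xs ! i) * F (take i xs @ drop (Suc i) xs))
        = (\<Sum>i<length xs. G (mset xs) (xs ! i))"
      by simp
    also have "\<dots> = sum_list (map (G (mset xs)) xs)"
      by (simp add: sum_list_sum_nth atLeast0LessThan)
    finally show ?thesis by (simp add: sum_mset_sum_list[symmetric])
  qed
  then show ?thesis using m by simp
qed

text \<open>The left-hand side collects the terms linear in \<open>a\<close> in the expansion of the
  product on the right, all of whose terms are nonnegative. It dominates the coefficients produced
  by creation.\<close>

lemma prod_list_delete_le:
  fixes g a :: "'b \<Rightarrow> real"
  assumes "\<And>x. 0 \<le> g x" "\<And>x. 0 \<le> a x"
  shows "(\<Sum>i<length xs. a (xs ! i) * prod_list (map g (take i xs @ drop (Suc i) xs)))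
      \<le> prod_list (map (\<lambda>x. g x + a x) xs)"
proof (induction xs)
  case (Cons x xs)
  let ?P = "\<lambda>xs. prod_list (map g xs)" and ?Q = "prod_list (map (\<lambda>x. g x + a x) xs)"
  have "?P xs \<le> ?Q" using assms by (induction xs) (auto intro!: mult_mono prod_list_nonneg)
  have "(\<Sum>i<length (x # xs). a ((x # xs) ! i) * ?P (take i (x # xs) @ drop (Suc i) (x # xs)))
      = a x * ?P xs + g x * (\<Sum>i<length xs. a (xs ! i) * ?P (take i xs @ drop (Suc i) xs))"
    unfolding list.size add_0_right add_Suc_right sum.lessThan_Suc_shift
    by (simp add: sum_distrib_left mult_ac)
  also have "\<dots> \<le> a x * ?Q + g x * ?Q"
    using Cons \<open>?P xs \<le> ?Q\<close> assms by (intro add_mono mult_left_mono) auto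
  finally show ?case by (simp add: algebra_simps)
qed simp

lemma fps_deriv_prod_list:
  "fps_deriv (prod_list (map f xs)) =
    (\<Sum>i<length xs. fps_deriv (f (xs ! i)) * prod_list (map f (take i xs @ drop (Suc i) xs)) :: complex fps)"
proof (induction xs)
  case (Cons x xs)
  show ?case
    unfolding list.size add_0_right add_Suc_right sum.lessThan_Suc_shift
    by (simp add: Cons sum_distrib_left mult_ac)
qed simp

text \<open>Places the Taylor vectors in the natural domain of creation, so that the default value
  of \<open>to_fock\<close> does not intervene. Adding |<x, h>| to the letter weights yields the
  majorant.\<close>

lemma creation_coeffs:
  "(\<lambda>xs. if set xs \<subseteq> hbasis then
     (\<Sum>i<length xs. hinner (of_h (xs ! i)) h * Rep_fock (weyl_taylor z k n) (take i xs @ drop (Suc i) xs))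
       / of_real (sqrt (length xs)) else 0) \<in> fock_coeffs" (is "?F \<in> _")
proof (rule fock_coeffsI)
  show "?F xs = 0" if "\<not> set xs \<subseteq> hbasis" for xs using that by (rule if_not_P)
  show "?F xs = ?F ys" if m: "mset xs = mset ys" for xs ys
  proof -
    have "(\<Sum>i<length xs. hinner (of_h (xs ! i)) h * Rep_fock (weyl_taylor z k n) (take i xs @ drop (Suc i) xs))
      = (\<Sum>i<length ys. hinner (of_h (ys ! i)) h * Rep_fock (weyl_taylor z k n) (take i ys @ drop (Suc i) ys))"
      using Rep_fock_perm m by (rule sum_delete_perm)
    then show ?thesis by (simp only: mset_eq_setD[OF m] mset_eq_length[OF m])
  qed
  let ?a = "\<lambda>x. cmod (hinner (of_h x) h)" and ?g = "weyl_weight z k"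
  let ?H = "word_weight (\<lambda>x. ?g x + ?a x)" and ?B = "weyl_bound z k / 2 ^ n"
  have sg: "(\<lambda>x. (?g x + ?a x)\<^sup>2) summable_on (hbasis :: 'a set)"
  proof (rule summable_on_comparison_test)
    show "(\<lambda>x. 2 * (?g x)\<^sup>2 + 2 * (?a x)\<^sup>2) summable_on (hbasis :: 'a set)"
      by (intro summable_on_add summable_on_cmult_right hinner_square_summable weyl_weight_summable)
    fix x :: 'a
    show "(?g x + ?a x)\<^sup>2 \<le> 2 * (?g x)\<^sup>2 + 2 * (?a x)\<^sup>2"
      using sum_squares_bound[of "?g x" "?a x"] by (simp add: power2_sum)
  qed auto
  show "(\<lambda>xs. (?B * ?H xs)\<^sup>2) summable_on UNIV"
    unfolding power_mult_distrib by (rule summable_on_cmult_right[OF word_weight_summable[OF sg]])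
  show "cmod (?F xs) \<le> ?B * ?H xs" for xs
  proof (cases "set xs \<subseteq> hbasis \<and> xs \<noteq> []")
    case True
    define N where "N = length xs"
    have N: "0 < N" using True by (simp add: N_def)
    \<comment> \<open>The division by sqrt N in creation turns the normalisation for N - 1 letters
      into the one for N letters.\<close>
    then have fN: "sqrt (fact N) = sqrt (fact (N - 1)) * sqrt N"
      by (metis fact_reduce mult.commute of_nat_fact real_sqrt_mult)
    let ?del = "\<lambda>i. take i xs @ drop (Suc i) xs"
    have del: "set (?del i) \<subseteq> hbasis" "length (?del i) = N - 1" if "i < N" for i
      using True that set_take_subset[of i xs] set_drop_subset[of "Suc i" xs] by (auto simp: N_def)
    have "cmod (\<Sum>i<N. hinner (of_h (xs ! i)) h * Rep_fock (weyl_taylor z k n) (?del i))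
        \<le> (\<Sum>i<N. cmod (hinner (of_h (xs ! i)) h * Rep_fock (weyl_taylor z k n) (?del i)))"
      by (rule norm_sum)
    also have "\<dots> \<le> (\<Sum>i<N. ?a (xs ! i) * (?B * (prod_list (map ?g (?del i)) / sqrt (fact (N - 1)))))"
    proof (rule sum_mono)
      fix i assume "i \<in> {..<N}"
      then have "cmod (Rep_fock (weyl_taylor z k n) (?del i))
          \<le> ?B * (prod_list (map ?g (?del i)) / sqrt (fact (N - 1)))"
        using weyl_fps_bound[of z k "?del i" n]
        unfolding Rep_weyl_taylor word_weight_def by (simp only: del if_True lessThan_iff times_divide_eq_left)
      then show "cmod (hinner (of_h (xs ! i)) h * Rep_fock (weyl_taylor z k n) (?del i))
          \<le> ?a (xs ! i) * (?B * (prod_list (map ?g (?del i)) / sqrt (fact (N - 1))))"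
        unfolding norm_mult by (intro mult_left_mono) auto
    qed
    also have "\<dots> = ?B / sqrt (fact (N - 1)) * (\<Sum>i<N. ?a (xs ! i) * prod_list (map ?g (?del i)))"
      by (simp add: sum_distrib_left mult_ac)
    also have "\<dots> \<le> ?B / sqrt (fact (N - 1)) * prod_list (map (\<lambda>x. ?g x + ?a x) xs)"
      unfolding N_def by (intro mult_left_mono prod_list_delete_le) (auto simp: weyl_weight_nonneg weyl_bound_def)
    finally have "cmod (\<Sum>i<N. hinner (of_h (xs ! i)) h * Rep_fock (weyl_taylor z k n) (?del i)) / sqrt N
        \<le> ?B / sqrt (fact (N - 1)) * prod_list (map (\<lambda>x. ?g x + ?a x) xs) / sqrt N"
      by (rule divide_right_mono) simp
    also have "\<dots> = ?B * ?H xs" using True unfolding word_weight_def N_def[symmetric] fN by simp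
    finally show ?thesis using True by (simp add: norm_divide N_def)
  next
    case False
    have "0 \<le> ?B * ?H xs"
      by (intro mult_nonneg_nonneg word_weight_nonneg) (auto simp: weyl_bound_def weyl_weight_nonneg)
    then show ?thesis using False by auto
  qed
qed

lemma Rep_creation_weyl_taylor:
  "Rep_fock (creation h (weyl_taylor z k n)) xs = (if set xs \<subseteq> hbasis then
     (\<Sum>i<length xs. hinner (of_h (xs ! i)) h * Rep_fock (weyl_taylor z k n) (take i xs @ drop (Suc i) xs))
       / of_real (sqrt (length xs)) else 0)"
  unfolding creation_def by (simp only: Rep_fock_to_fock[OF creation_coeffs])

text \<open>Coefficient form of d/ds W_s E(k) = (a^+(z) - a(z)) W_s E(k): the Gaussian factor
  contributes the annihilation term, the letter factors contribute the creation sum.\<close>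

lemma weyl_fps_deriv:
  assumes xs: "set xs \<subseteq> hbasis"
  shows "fps_deriv (weyl_fps z k xs) =
    - (fps_const (hinner z z) * fps_X + fps_const (hinner z k)) * weyl_fps z k xs +
    fps_const (1 / of_real (sqrt (length xs))) *
      (\<Sum>i<length xs. fps_const (hinner (of_h (xs ! i)) z) * weyl_fps z k (take i xs @ drop (Suc i) xs))"
proof -
  define N where "N = length xs"
  define g where "g = fps_expansion (weyl_factor z k) 0"
  let ?f = "\<lambda>x. fps_const (hinner (of_h x) k) + fps_const (hinner (of_h x) z) * fps_X"
  let ?del = "\<lambda>i. take i xs @ drop (Suc i) xs"
  let ?c = "\<lambda>n. fps_const (1 / complex_of_real (sqrt (fact n)))"
  have del: "set (?del i) \<subseteq> hbasis" "length (?del i) = N - 1" if "i < N" for i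
    using xs that set_take_subset[of i xs] set_drop_subset[of "Suc i" xs] by (auto simp: N_def)
  have W: "weyl_fps z k xs = ?c N * (g * prod_list (map ?f xs))"
    using xs by (simp add: weyl_fps_def N_def g_def)
  have "fps_deriv (prod_list (map ?f xs)) = (\<Sum>i<N. fps_const (hinner (of_h (xs ! i)) z) * prod_list (map ?f (?del i)))"
    unfolding fps_deriv_prod_list N_def by simp
  then have "fps_deriv (weyl_fps z k xs) = - (fps_const (hinner z z) * fps_X
      + fps_const (hinner z k)) * weyl_fps z k xs
      + ?c N * (g * (\<Sum>i<N. fps_const (hinner (of_h (xs ! i)) z) * prod_list (map ?f (?del i))))"
    unfolding W by (simp add: weyl_factor_deriv[of z k, folded g_def] algebra_simps)
  also have "?c N * (g * (\<Sum>i<N. fps_const (hinner (of_h (xs ! i)) z) * prod_list (map ?f (?del i))))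
      = (\<Sum>i<N. fps_const (hinner (of_h (xs ! i)) z) * (?c N * (g * prod_list (map ?f (?del i)))))"
    by (simp only: sum_distrib_left mult_ac)
  also have "\<dots> = (\<Sum>i<N. fps_const (1 / of_real (sqrt N)) * (fps_const (hinner (of_h (xs ! i)) z) * weyl_fps z k (?del i)))"
  proof (rule sum.cong[OF refl])
    fix i assume "i \<in> {..<N}"
    then have i: "i < N" by simp
    then have fN: "sqrt (fact N) = sqrt (fact (N - 1)) * sqrt N"
      by (metis fact_reduce mult.commute of_nat_fact real_sqrt_mult gr_zeroI not_less0)
    have c: "?c N = fps_const (1 / of_real (sqrt N)) * ?c (N - 1)" unfolding fN by (simp add: mult.commute)
    have "weyl_fps z k (?del i) = ?c (N - 1) * (g * prod_list (map ?f (?del i)))"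
      unfolding weyl_fps_def using del[OF i] by (simp only: if_True g_def)
    then show "fps_const (hinner (of_h (xs ! i)) z) * (?c N * (g * prod_list (map ?f (?del i))))
        = fps_const (1 / of_real (sqrt N)) * (fps_const (hinner (of_h (xs ! i)) z) * weyl_fps z k (?del i))"
      unfolding c by (simp only: mult_ac)
  qed
  also have "\<dots> = fps_const (1 / of_real (sqrt N)) * (\<Sum>i<N. fps_const (hinner (of_h (xs ! i)) z) * weyl_fps z k (?del i))"
    by (simp only: sum_distrib_left)
  finally show ?thesis by (simp only: N_def)
qed

text \<open>For z = a + i b the generator i P(a) + i Q(b) equals a^+(z) - a(z). It acts on the
  series as differentiation in s, hence the factor n + 1 at the next coefficient.\<close>

lemma weyl_generator_taylor:
  fixes a b :: "'a::{real_inner, polish_space}"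
  defines "z \<equiv> Cpx a b"
  shows "\<i> *\<^sub>C P_op (of_h a) (weyl_taylor z k n) + \<i> *\<^sub>C Q_op (of_h b) (weyl_taylor z k n)
    = of_nat (Suc n) *\<^sub>C weyl_taylor z k (Suc n)"
proof (rule fock_eqI)
  fix xs :: "'a list"
  let ?V = "weyl_taylor z k n"
  define p where "p = Rep_fock ?V xs"
  define q where "q = Rep_fock (weyl_taylor_prev z k n) xs"
  let ?S = "\<lambda>h. Rep_fock (creation h ?V) xs"
  have c: "conj_h (of_h x) = of_h x" for x :: 'a by (simp add: conj_h_def of_h_def)
  have "Rep_fock (\<i> *\<^sub>C P_op (of_h a) ?V + \<i> *\<^sub>C Q_op (of_h b) ?V) xs =
     - (hinner (of_h a) k * p + hinner (of_h a) z * q - ?S (of_h a))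
     + \<i> * (hinner (of_h b) k * p + hinner (of_h b) z * q + ?S (of_h b))"
    unfolding P_op_def Q_op_def c annihilation_weyl_taylor plus_fock.rep_eq scaleC_fock.rep_eq Rep_fock_diff
      p_def q_def by (simp add: algebra_simps)
  also have "\<dots> = - hinner z k * p - hinner z z * q + (?S (of_h a) + \<i> * ?S (of_h b))"
  proof -
    \<comment> \<open>The inner product is antilinear in its first argument: annihilation pairs with
      the conjugate combination - i b, creation with + i b.\<close>
    have h: "hinner z l = hinner (of_h a) l - \<i> * hinner (of_h b) l" for l
      by (simp add: z_def hinner_def of_h_def complex_eq_iff)
    show ?thesis unfolding h by (simp add: algebra_simps)
  qed
  also have "?S (of_h a) + \<i> * ?S (of_h b) = ?S z"
  proof -
    have h: "hinner (of_h x) z = hinner (of_h x) (of_h a) + \<i> * hinner (of_h x) (of_h b)" for x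
      by (simp add: z_def hinner_def of_h_def complex_eq_iff)
    show ?thesis unfolding Rep_creation_weyl_taylor h
      by (simp add: distrib_right sum.distrib sum_distrib_left add_divide_distrib mult.assoc)
  qed
  also have "- hinner z k * p - hinner z z * q + ?S z = of_nat (Suc n) * Rep_fock (weyl_taylor z k (Suc n)) xs"
  proof (cases "set xs \<subseteq> hbasis")
    case True
    have "of_nat (Suc n) * Rep_fock (weyl_taylor z k (Suc n)) xs = fps_nth (fps_deriv (weyl_fps z k xs)) n"
      by (simp add: Rep_weyl_taylor)
    also have "\<dots> = - hinner z k * p - hinner z z * q + ?S z"
      unfolding weyl_fps_deriv[OF True] Rep_creation_weyl_taylor p_def q_def Rep_weyl_taylor Rep_weyl_taylor_prev
      using True by (simp add: distrib_right left_diff_distrib mult.assoc fps_sum_nth sum_divide_distrib)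
    finally show ?thesis by simp
  next
    case False
    then show ?thesis
      by (simp add: p_def q_def Rep_fock_outside)
  qed
  finally show "Rep_fock (\<i> *\<^sub>C P_op (of_h a) ?V + \<i> *\<^sub>C Q_op (of_h b) ?V) xs
      = Rep_fock (of_nat (Suc n) *\<^sub>C weyl_taylor z k (Suc n)) xs"
    by (simp add: scaleC_fock.rep_eq)
qed

section \<open>The Weyl series on exponential vectors\<close>

lemma weyl_taylor_0: "weyl_taylor z k 0 = expvec k"
proof (rule fock_eqI)
  fix xs
  have "fps_nth (weyl_fps z k xs) 0 = weyl_fun z k 0 xs"
    unfolding fps_nth_fps_expansion[OF weyl_fun_expansion] by simp
  then show "Rep_fock (weyl_taylor z k 0) xs = Rep_fock (expvec k) xs"
    by (simp add: Rep_weyl_taylor weyl_fun_def weyl_factor_def expvec.rep_eq)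
qed

text \<open>Each application of the generator moves to the next Taylor vector. The accumulated
  factor n! cancels the 1 / n! of the operator series, which leaves the Taylor series at t =
  1.\<close>

lemma weyl_expvec:
  "weyl (of_h a) (of_h b) (expvec k) = weyl_vec (Cpx a b) 1 k"
proof -
  let ?T = "\<lambda>G. \<i> *\<^sub>C P_op (of_h a) G + \<i> *\<^sub>C Q_op (of_h b) G"
  let ?V = "weyl_taylor (Cpx a b) k"
  have sc: "?T (c *\<^sub>C G) = c *\<^sub>C ?T G" for c G
    unfolding P_op_scaleC Q_op_scaleC scaleC_add_right by (simp only: scaleC_commute[of \<i>])
  have "(?T ^^ n) (expvec k) = fact n *\<^sub>C ?V n" for n
  proof (induction n)
    case (Suc n)
    have "(?T ^^ Suc n) (expvec k) = ?T ((?T ^^ n) (expvec k))" by simp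
    also have "\<dots> = fact n *\<^sub>C ?T (?V n)" unfolding Suc by (rule sc)
    also have "\<dots> = fact (Suc n) *\<^sub>C ?V (Suc n)"
      unfolding weyl_generator_taylor scaleC_scaleC by (simp add: mult.commute)
    finally show ?case .
  qed (simp add: weyl_taylor_0)
  then have "(\<lambda>n. (1 / fact n) *\<^sub>R (?T ^^ n) (expvec k)) = ?V"
    by (simp add: scaleR_scaleC scaleC_scaleC)
  then show ?thesis unfolding weyl_def using sums_unique[OF weyl_taylor_sums[of "Cpx a b" k]] by simp
qed

text \<open>All terms in t cancel in the exponent; the isometric extension to the whole Fock space
  rests on this.\<close>

lemma cinner_weyl_vec:
  "cinner (weyl_vec z t k) (weyl_vec z t l) = exp (hinner k l)"
proof -
  have "cinner (weyl_vec z t k) (weyl_vec z t l)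
      = cnj (weyl_factor z k t) * weyl_factor z l t * exp (hinner (shift_h z t k) (shift_h z t l))"
    by (simp add: weyl_vec_def cinner_scaleC_left cinner_scaleC_right cinner_expvec)
  also have "cnj (weyl_factor z k t) = exp (- ((of_real t)\<^sup>2 * hinner z z / 2) - of_real t * hinner k z)"
    by (simp add: weyl_factor_def exp_cnj hinner_cnj)
  finally show ?thesis
    unfolding weyl_factor_def hinner_shift_left hinner_shift_right exp_add[symmetric]
    by (simp add: algebra_simps power2_eq_square)
qed

lemma weyl_vec_inverse:
  "weyl_factor z k (of_real t) *\<^sub>C weyl_vec z (- t) (shift_h z t k) = expvec k"
proof -
  have "shift_h z (- t) (shift_h z t k) = k" by (cases k) (simp add: shift_h_def)
  moreover have "weyl_factor z k (of_real t) * weyl_factor z (shift_h z t k) (of_real (- t)) = 1"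
    unfolding weyl_factor_def hinner_shift_right exp_add[symmetric]
        by (simp add: algebra_simps power2_eq_square)
  ultimately show ?thesis by (simp add: weyl_vec_def scaleC_scaleC)
qed

section \<open>Smooth functions with tempered derivatives\<close>

text \<open>Two uses of the mean value inequality, first for f' and then for f minus its linear
  part. This works for vector values and gives the constant B instead of B / 2.\<close>

lemma taylor_bound_2:
  fixes f :: "real \<Rightarrow> 'b::real_normed_vector"
  assumes f: "\<And>t. (f has_vector_derivative f' t) (at t)" "\<And>t. (f' has_vector_derivative f'' t) (at t)"
    and B: "\<And>t. \<bar>t\<bar> \<le> 1 \<Longrightarrow> norm (f'' t) \<le> B" and h: "\<bar>h\<bar> \<le> 1"
  shows "norm (f h - f 0 - h *\<^sub>R f' 0) \<le> B * h\<^sup>2"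
proof -
  let ?S = "closed_segment 0 h"
  have S: "\<bar>t\<bar> \<le> \<bar>h\<bar>" "\<bar>t\<bar> \<le> 1" if "t \<in> ?S" for t
    using that h by (auto simp: closed_segment_eq_real_ivl split: if_splits)
  have f1: "norm (f' t - f' 0) \<le> B * \<bar>h\<bar>" if t: "t \<in> ?S" for t
  proof -
    have "norm (f' t - f' 0) \<le> B * norm (t - 0)"
    proof (rule differentiable_bound[where S = ?S and f = f' and x = t and y = 0 and f'
        = "\<lambda>x s. s *\<^sub>R f'' x"])
      show "(f' has_derivative (\<lambda>s. s *\<^sub>R f'' x)) (at x within ?S)" for x
        using f(2)[of x] unfolding has_vector_derivative_def by (rule has_derivative_at_withinI)
      show "onorm (\<lambda>s. s *\<^sub>R f'' x) \<le> B" if "x \<in> ?S" for x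
      proof (rule onorm_bound)
        show "0 \<le> B" using B[OF S(2)[OF that]] norm_ge_zero order_trans by blast
        show "norm (s *\<^sub>R f'' x) \<le> B * norm s" for s
          using mult_right_mono[OF B[OF S(2)[OF that]], of "\<bar>s\<bar>"] by (simp add: mult.commute)
      qed
    qed (use t in auto)
    also have "\<dots> \<le> B * \<bar>h\<bar>"
      using S(1)[OF t] B[of 0] order_trans[OF norm_ge_zero[of "f'' 0"]] by (auto intro!: mult_left_mono)
    finally show ?thesis .
  qed
  have "norm ((f h - h *\<^sub>R f' 0) - (f 0 - 0 *\<^sub>R f' 0)) \<le> B * \<bar>h\<bar> * norm (h - 0)"
  proof (rule differentiable_bound[where S = ?S and f = "\<lambda>s. f s - s *\<^sub>R f' 0" and x = h and y = 0
        and f' = "\<lambda>x s. s *\<^sub>R (f' x - f' 0)"])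
    show "((\<lambda>s. f s - s *\<^sub>R f' 0) has_derivative (\<lambda>s. s *\<^sub>R (f' x - f' 0))) (at x within ?S)" for x
      unfolding scaleR_diff_right
      by (rule has_derivative_at_withinI, intro has_derivative_diff has_derivative_scaleR_left
          has_derivative_ident f(1)[unfolded has_vector_derivative_def])
    show "onorm (\<lambda>s. s *\<^sub>R (f' x - f' 0)) \<le> B * \<bar>h\<bar>" if "x \<in> ?S" for x
    proof (rule onorm_bound)
      show "0 \<le> B * \<bar>h\<bar>" using f1[OF that] norm_ge_zero order_trans by blast
      show "norm (s *\<^sub>R (f' x - f' 0)) \<le> B * \<bar>h\<bar> * norm s" for s
        using mult_right_mono[OF f1[OF that], of "\<bar>s\<bar>"] by (simp add: mult.commute)
    qed
  qed auto
  then show ?thesis by (simp add: power2_eq_square algebra_simps)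
qed

text \<open>Integrate the derivative of (x + 1 - t) u(t) over the unit interval: the weight is 1 at
  the left end, 0 at the right end and at most 1 between. The extended nonnegative form allows
  iteration in two variables by Tonelli.\<close>

lemma norm_le_unit_integral:
  fixes u :: "real \<Rightarrow> complex"
  assumes u: "\<And>t. (u has_vector_derivative u' t) (at t)" and c: "continuous_on UNIV u'"
  shows "ennreal (norm (u x)) \<le> (\<integral>\<^sup>+t. ennreal (norm (u t) + norm (u' t)) * indicator {x..x+1} t \<partial>lborel)"
proof -
  let ?I = "{x..x+1}" and ?g = "\<lambda>t. norm (u t) + norm (u' t)"
  have cu: "continuous_on UNIV u"
    by (rule continuous_at_imp_continuous_on) (use u has_vector_derivative_continuous in blast)
  have cg: "continuous_on ?I ?g" by (intro continuous_intros continuous_on_subset[OF cu] continuous_on_subset[OF c]) auto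
  have "((\<lambda>t. (x + 1 - t) *\<^sub>R u' t - u t) has_integral (x + 1 - (x + 1)) *\<^sub>R u (x + 1) - (x + 1
      - x) *\<^sub>R u x) ?I"
    by (rule fundamental_theorem_of_calculus)
      (auto intro!: derivative_eq_intros has_vector_derivative_at_within[OF u])
  then have I: "((\<lambda>t. (x + 1 - t) *\<^sub>R u' t - u t) has_integral - u x) ?I" by simp
  have gi: "?g integrable_on ?I" by (rule integrable_continuous_real[OF cg])
  have "norm (- u x) \<le> integral ?I ?g"
    unfolding integral_unique[OF I, symmetric]
  proof (rule integral_norm_bound_integral)
    show "(\<lambda>t. (x + 1 - t) *\<^sub>R u' t - u t) integrable_on ?I" using I by blast
    fix t assume t: "t \<in> ?I"
    have "norm ((x + 1 - t) *\<^sub>R u' t - u t) \<le> norm ((x + 1 - t) *\<^sub>R u' t) + norm (u t)"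
      by (rule norm_triangle_ineq4)
    also have "norm ((x + 1 - t) *\<^sub>R u' t) \<le> 1 * norm (u' t)"
      unfolding norm_scaleR using t by (intro mult_right_mono) auto
    finally show "norm ((x + 1 - t) *\<^sub>R u' t - u t) \<le> ?g t" by simp
  qed (rule gi)
  also have si: "set_integrable lborel ?I ?g" by (rule borel_integrable_atLeastAtMost'[OF cg])
  have "integral ?I ?g = (LINT t|lborel. indicator ?I t *\<^sub>R ?g t)"
    using set_borel_integral_eq_integral(2)[OF si] by (simp add: set_lebesgue_integral_def)
  finally have "ennreal (norm (u x)) \<le> ennreal (LINT t|lborel. indicator ?I t *\<^sub>R ?g t)"
    by (simp add: ennreal_leI)
  also have "\<dots> = (\<integral>\<^sup>+t. ennreal (indicator ?I t *\<^sub>R ?g t) \<partial>lborel)"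
    using si unfolding set_integrable_def by (intro nn_integral_eq_integral[symmetric]) auto
  also have "\<dots> = (\<integral>\<^sup>+t. ennreal (?g t) * indicator ?I t \<partial>lborel)"
    by (intro nn_integral_cong) (auto simp: indicator_def)
  finally show ?thesis .
qed

section \<open>Partial derivatives, and pointwise growth from growth in the mean\<close>

lemma differentiable_partial_x:
  assumes "\<phi> differentiable (at (x, y))"
  shows "((\<lambda>t. \<phi> (t, y)) has_vector_derivative partial_x \<phi> (x, y)) (at x)"
proof -
  have "(\<lambda>t. \<phi> (t, y)) differentiable (at x)"
    using differentiable_chain_at[of "\<lambda>t. (t, y)" x \<phi>] assms by (simp add: o_def)
  then show ?thesis by (simp add: partial_x_def vector_derivative_works[symmetric])
qed

lemma differentiable_partial_y:
  assumes "\<phi> differentiable (at (x, y))"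
  shows "((\<lambda>t. \<phi> (x, t)) has_vector_derivative partial_y \<phi> (x, y)) (at y)"
proof -
  have "(\<lambda>t. \<phi> (x, t)) differentiable (at y)"
    using differentiable_chain_at[of "\<lambda>t. (x, t)" y \<phi>] assms by (simp add: o_def)
  then show ?thesis by (simp add: partial_y_def vector_derivative_works[symmetric])
qed

text \<open>Total differentiability gives the chain rule along lines; the values of the derivative
  on the unit vectors are the two partial derivatives.\<close>

lemma differentiable_line:
  assumes d: "\<phi> differentiable (at (p + t *\<^sub>R (c1, c2)))"
  shows "((\<lambda>t. \<phi> (p + t *\<^sub>R (c1, c2))) has_vector_derivative
    c1 *\<^sub>R partial_x \<phi> (p + t *\<^sub>R (c1, c2)) + c2 *\<^sub>R partial_y \<phi> (p + t *\<^sub>R (c1, c2))) (at t)"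
proof -
  obtain L where L: "(\<phi> has_derivative L) (at (p + t *\<^sub>R (c1, c2)))" using d
      by (auto simp: differentiable_def)
  obtain x y where xy: "p + t *\<^sub>R (c1, c2) = (x, y)" by (cases "p + t *\<^sub>R (c1, c2)")
  have lin: "linear L" using L by (rule has_derivative_linear)
  define l1 l2 where "l1 = L (1, 0)" and "l2 = L (0, 1)"
  have l: "L (s, 0) = s *\<^sub>R l1" "L (0, s) = s *\<^sub>R l2" for s
    using linear_scale[OF lin, of s "(1, 0)"] linear_scale[OF lin, of s "(0, 1)"]
    by (simp_all add: l1_def l2_def)
  have "((\<lambda>s. \<phi> (s, y)) has_derivative (\<lambda>s. L (s, 0))) (at x)"
    using diff_chain_at[OF has_derivative_Pair[OF has_derivative_ident has_derivative_const], of \<phi> L] L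
    unfolding xy by (simp add: o_def)
  then have "((\<lambda>s. \<phi> (s, y)) has_vector_derivative l1) (at x)"
    by (simp only: has_vector_derivative_def l)
  then have x: "l1 = partial_x \<phi> (x, y)"
    by (rule vector_derivative_unique_at[OF _ differentiable_partial_x[OF d[unfolded xy]]])
  have "((\<lambda>s. \<phi> (x, s)) has_derivative (\<lambda>s. L (0, s))) (at y)"
    using diff_chain_at[OF has_derivative_Pair[OF has_derivative_const has_derivative_ident], of \<phi> L] L
    unfolding xy by (simp add: o_def)
  then have "((\<lambda>s. \<phi> (x, s)) has_vector_derivative l2) (at y)"
    by (simp only: has_vector_derivative_def l)
  then have y: "l2 = partial_y \<phi> (x, y)"
    by (rule vector_derivative_unique_at[OF _ differentiable_partial_y[OF d[unfolded xy]]])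
  have "((\<lambda>t. \<phi> (p + t *\<^sub>R (c1, c2))) has_derivative (\<lambda>s. L (s *\<^sub>R (c1, c2)))) (at t)"
  proof -
    have "((\<lambda>t. p + t *\<^sub>R (c1, c2)) has_derivative (\<lambda>s. s *\<^sub>R (c1, c2))) (at t)"
      using has_derivative_add[OF has_derivative_const[of p]
          has_derivative_scaleR_left[OF has_derivative_ident, of "(c1, c2)"]]
      by (simp only: add_0)
    from diff_chain_at[OF this L] show ?thesis by (simp add: o_def)
  qed
  moreover have "L (s *\<^sub>R (c1, c2)) = s *\<^sub>R (c1 *\<^sub>R partial_x \<phi> (x, y) + c2 *\<^sub>R partial_y \<phi> (x, y))" for s
  proof -
    have "s *\<^sub>R (c1, c2) = (s * c1) *\<^sub>R (1, 0) + (s * c2) *\<^sub>R (0, 1)" by simp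
    then have "L (s *\<^sub>R (c1, c2)) = (s * c1) *\<^sub>R l1 + (s * c2) *\<^sub>R l2"
      by (simp only: linear_add[OF lin] linear_scale[OF lin] l1_def l2_def)
    then show ?thesis by (simp add: x y algebra_simps)
  qed
  ultimately show ?thesis unfolding has_vector_derivative_def xy by simp
qed

lemma partials_trans: "\<psi> \<in> partials \<eta> \<Longrightarrow> \<eta> \<in> partials \<phi> \<Longrightarrow> \<psi> \<in> partials \<phi>"
  by (induction rule: partials.induct) (auto intro: partials.intros)

lemma norm_pair_le: "norm (p :: real \<times> real) \<le> \<bar>fst p\<bar> + \<bar>snd p\<bar>"
  using norm_Pair_le[of "fst p" "snd p"] by simp

lemma tempered_nn_integral_finite:
  assumes "tempered \<phi>"
  shows "\<exists>M. \<forall>N\<ge>M. (\<integral>\<^sup>+p. ennreal (norm (\<phi> p) / (1 + norm p) ^ N) \<partial>lborel) < \<infinity>"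
proof -
  obtain M where M: "integrable lborel (\<lambda>p. \<phi> p /\<^sub>R (1 + norm p) ^ M)"
    using assms by (auto simp: tempered_def)
  have "(\<integral>\<^sup>+p. ennreal (norm (\<phi> p) / (1 + norm p) ^ N) \<partial>lborel) < \<infinity>" if "N \<ge> M" for N
  proof -
    have "(\<integral>\<^sup>+p. ennreal (norm (\<phi> p) / (1 + norm p) ^ N) \<partial>lborel)
        \<le> (\<integral>\<^sup>+p. ennreal (norm (\<phi> p /\<^sub>R (1 + norm p) ^ M)) \<partial>lborel)"
    proof (intro nn_integral_mono ennreal_leI)
      fix p :: "real \<times> real"
      have "norm (\<phi> p) / (1 + norm p) ^ N \<le> norm (\<phi> p) / (1 + norm p) ^ M"
        by (intro divide_left_mono power_increasing that) (auto simp: add_pos_nonneg)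
      then show "norm (\<phi> p) / (1 + norm p) ^ N \<le> norm (\<phi> p /\<^sub>R (1 + norm p) ^ M)"
        by (simp add: divide_inverse mult.commute)
    qed
    also have "\<dots> < \<infinity>" using M by (simp add: integrable_iff_bounded)
    finally show ?thesis .
  qed
  then show ?thesis by blast
qed

text \<open>A Sobolev estimate on unit squares turns polynomial growth in the mean of all derivatives
  into pointwise polynomial growth.\<close>

lemma tempered_partials_poly_bounded:
  assumes smooth: "C_infinity \<phi>" and temp: "\<And>\<psi>. \<psi> \<in> partials \<phi> \<Longrightarrow> tempered \<psi>"
    and \<eta>: "\<eta> \<in> partials \<phi>"
  shows "\<exists>C N. 0 \<le> C \<and> (\<forall>p. norm (\<eta> p) \<le> C * (1 + norm p) ^ N)"
proof -
  \<comment> \<open>The functions that arise when the one-dimensional estimate is used first in x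
    and then in y.\<close>
  let ?D = "{\<eta>, partial_x \<eta>, partial_y \<eta>, partial_y (partial_x \<eta>)}"
  have D: "\<psi> \<in> partials \<phi>" if "\<psi> \<in> ?D" for \<psi> using that \<eta> by (auto intro: partials.intros)
  have diff: "\<psi> differentiable (at p)" if "\<psi> \<in> partials \<phi>" for \<psi> p
    using smooth that unfolding C_infinity_def by blast
  have cont: "continuous_on UNIV \<psi>" if "\<psi> \<in> partials \<phi>" for \<psi>
    by (rule continuous_at_imp_continuous_on) (use diff[OF that] differentiable_imp_continuous_within in blast)
  have meas: "\<psi> \<in> borel_measurable borel" if "\<psi> \<in> ?D" for \<psi>
    using cont[OF D[OF that]] by (rule borel_measurable_continuous_onI)
  have [measurable]: "\<eta> \<in> borel_measurable borel" "partial_x \<eta> \<in> borel_measurable borel"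
    "partial_y \<eta> \<in> borel_measurable borel" "partial_y (partial_x \<eta>) \<in> borel_measurable borel"
    by (rule meas, simp)+
  have "\<forall>\<psi>\<in>?D. \<exists>M. \<forall>N\<ge>M. (\<integral>\<^sup>+p. ennreal (norm (\<psi> p) / (1 + norm p) ^ N) \<partial>lborel) < \<infinity>"
    using D temp tempered_nn_integral_finite by blast
  from bchoice[OF this] obtain M where
    M: "\<forall>\<psi>\<in>?D. \<forall>N\<ge>M \<psi>. (\<integral>\<^sup>+p. ennreal (norm (\<psi> p) / (1 + norm p) ^ N) \<partial>lborel) < \<infinity>" ..
  \<comment> \<open>A common exponent: increasing an exponent preserves finiteness, and the sum
    dominates each summand.\<close>
  define N where "N = (\<Sum>\<psi>\<in>?D. M \<psi>)"
  have fin: "(\<integral>\<^sup>+p. ennreal (norm (\<psi> p) / (1 + norm p) ^ N) \<partial>lborel) < \<infinity>" if "\<psi> \<in> ?D" for \<psi>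
  proof -
    have "M \<psi> \<le> N" unfolding N_def by (rule member_le_sum[OF that]) simp_all
    then show ?thesis by (rule M[rule_format, OF that])
  qed
  define \<Psi> where "\<Psi> p = norm (\<eta> p) + norm (partial_x \<eta> p) + norm (partial_y \<eta> p)
      + norm (partial_y (partial_x \<eta>) p)" for p
  have \<Psi>0: "0 \<le> \<Psi> p" for p by (simp add: \<Psi>_def)
  have [measurable]: "\<Psi> \<in> borel_measurable borel" unfolding \<Psi>_def by measurable
  define I where "I = (\<integral>\<^sup>+p. ennreal (\<Psi> p / (1 + norm p) ^ N) \<partial>lborel)"
  have "I = (\<integral>\<^sup>+p. ennreal (norm (\<eta> p) / (1 + norm p) ^ N) + ennreal (norm (partial_x \<eta> p) / (1 + norm p) ^ N)
      + ennreal (norm (partial_y \<eta> p) / (1 + norm p) ^ N)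
          + ennreal (norm (partial_y (partial_x \<eta>) p) / (1 + norm p) ^ N) \<partial>lborel)"
    unfolding I_def \<Psi>_def
    by (intro nn_integral_cong) (simp add: add_divide_distrib ennreal_plus[symmetric] del: ennreal_plus)
  also have "\<dots> = (\<integral>\<^sup>+p. ennreal (norm (\<eta> p) / (1 + norm p) ^ N) \<partial>lborel)
      + (\<integral>\<^sup>+p. ennreal (norm (partial_x \<eta> p) / (1 + norm p) ^ N) \<partial>lborel)
      + (\<integral>\<^sup>+p. ennreal (norm (partial_y \<eta> p) / (1 + norm p) ^ N) \<partial>lborel)
          + (\<integral>\<^sup>+p. ennreal (norm (partial_y (partial_x \<eta>) p) / (1 + norm p) ^ N) \<partial>lborel)"
    by (simp add: nn_integral_add)
  also have "\<dots> < \<infinity>" using fin by (simp add: less_top[symmetric])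
  finally have Ifin: "I < \<infinity>" .
  have "norm (\<eta> p) \<le> (3 ^ N * enn2real I) * (1 + norm p) ^ N" for p
  proof -
    obtain x y where p: "p = (x, y)" by (cases p)
    let ?X = "{x..x+1}" and ?Y = "{y..y+1}"
    have ly: "ennreal (norm (\<psi> (s, y))) \<le> (\<integral>\<^sup>+t. ennreal (norm (\<psi> (s, t))
        + norm (partial_y \<psi> (s, t))) * indicator ?Y t \<partial>lborel)"
      if "\<psi> \<in> partials \<phi>" for \<psi> s
    proof (rule norm_le_unit_integral)
      show "((\<lambda>t. \<psi> (s, t)) has_vector_derivative partial_y \<psi> (s, t)) (at t)" for t
        by (rule differentiable_partial_y[OF diff[OF that]])
      show "continuous_on UNIV (\<lambda>t. partial_y \<psi> (s, t))"
        by (rule continuous_on_compose2[OF cont[OF partials.intros(3)[OF that]]]) (auto intro!: continuous_intros)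
    qed
    have "ennreal (norm (\<eta> p)) \<le> (\<integral>\<^sup>+s. ennreal (norm (\<eta> (s, y))
        + norm (partial_x \<eta> (s, y))) * indicator ?X s \<partial>lborel)"
      unfolding p
    proof (rule norm_le_unit_integral)
      show "((\<lambda>t. \<eta> (t, y)) has_vector_derivative partial_x \<eta> (t, y)) (at t)" for t
        by (rule differentiable_partial_x[OF diff[OF \<eta>]])
      show "continuous_on UNIV (\<lambda>t. partial_x \<eta> (t, y))"
        by (rule continuous_on_compose2[OF cont[OF partials.intros(2)[OF \<eta>]]]) (auto intro!: continuous_intros)
    qed
    also have "\<dots> \<le> (\<integral>\<^sup>+s. (\<integral>\<^sup>+t. ennreal (\<Psi> (s, t)) * indicator ?Y t \<partial>lborel) * indicator ?X s \<partial>lborel)"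
    proof (intro nn_integral_mono mult_right_mono)
      fix s
      have "ennreal (norm (\<eta> (s, y)) + norm (partial_x \<eta> (s, y)))
          = ennreal (norm (\<eta> (s, y))) + ennreal (norm (partial_x \<eta> (s, y)))"
        by simp
      also have "\<dots> \<le> (\<integral>\<^sup>+t. ennreal (norm (\<eta> (s, t)) + norm (partial_y \<eta> (s, t))) * indicator ?Y t \<partial>lborel)
         + (\<integral>\<^sup>+t. ennreal (norm (partial_x \<eta> (s, t)) + norm (partial_y (partial_x \<eta>) (s, t))) * indicator ?Y t \<partial>lborel)"
        by (intro add_mono ly \<eta> partials.intros(2))
      also have "\<dots> = (\<integral>\<^sup>+t. ennreal (\<Psi> (s, t)) * indicator ?Y t \<partial>lborel)"
        by (subst nn_integral_add[symmetric], (measurable; auto)+)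
          (auto intro!: nn_integral_cong simp: \<Psi>_def indicator_def ennreal_plus[symmetric] simp del: ennreal_plus)
      finally show "ennreal (norm (\<eta> (s, y)) + norm (partial_x \<eta> (s, y)))
          \<le> (\<integral>\<^sup>+t. ennreal (\<Psi> (s, t)) * indicator ?Y t \<partial>lborel)" .
    qed simp
    also have "\<dots> = (\<integral>\<^sup>+s. (\<integral>\<^sup>+t. ennreal (\<Psi> (s, t)) * indicator ?Y t * indicator ?X s \<partial>lborel) \<partial>lborel)"
      by (intro nn_integral_cong nn_integral_multc[symmetric]) measurable
    also have "\<dots> = (\<integral>\<^sup>+q. ennreal (\<Psi> q) * indicator ?Y (snd q) * indicator ?X (fst q) \<partial>(lborel \<Otimes>\<^sub>M lborel))"
    proof (subst lborel.nn_integral_fst[symmetric])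
      have [measurable]: "(fst :: real \<times> real \<Rightarrow> real) \<in> borel_measurable borel"
        "(snd :: real \<times> real \<Rightarrow> real) \<in> borel_measurable borel"
        by (auto intro!: borel_measurable_continuous_onI continuous_intros)
      show "(\<lambda>q. ennreal (\<Psi> q) * indicator ?Y (snd q) * indicator ?X (fst q)) \<in> borel_measurable (lborel \<Otimes>\<^sub>M lborel)"
        unfolding lborel_prod by measurable
    qed simp
    also have "\<dots> = (\<integral>\<^sup>+q. ennreal (\<Psi> q) * indicator ?Y (snd q) * indicator ?X (fst q) \<partial>lborel)"
      by (simp only: lborel_prod)
    also have "\<dots> \<le> (\<integral>\<^sup>+q. ennreal ((3 * (1 + norm p)) ^ N) * ennreal (\<Psi> q / (1 + norm q) ^ N) \<partial>lborel)"
    proof (rule nn_integral_mono)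
      fix q :: "real \<times> real"
      show "ennreal (\<Psi> q) * indicator ?Y (snd q) * indicator ?X (fst q)
          \<le> ennreal ((3 * (1 + norm p)) ^ N) * ennreal (\<Psi> q / (1 + norm q) ^ N)"
      proof (cases "fst q \<in> ?X \<and> snd q \<in> ?Y")
        case True
        \<comment> \<open>On the unit square at p this gives 1 + |q| \<le> 3 (1 + |p|), the origin
          of the factor \<open>3 ^ N\<close>.\<close>
        have "norm (q - p) \<le> 2" using norm_pair_le[of "q - p"] True by (auto simp: p)
        then have "norm q \<le> norm p + 2" using norm_triangle_sub[of q p] by linarith
        then have "1 + norm q \<le> 3 * (1 + norm p)"
          using norm_ge_zero[of p] unfolding distrib_left by linarith
        then have "(1 + norm q) ^ N \<le> (3 * (1 + norm p)) ^ N" by (intro power_mono) auto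
        then have "\<Psi> q * (1 + norm q) ^ N \<le> \<Psi> q * (3 * (1 + norm p)) ^ N" using \<Psi>0 by (intro mult_left_mono)
        moreover have "(1 + norm q) ^ N > 0" by (simp add: add_pos_nonneg)
        ultimately have "\<Psi> q \<le> (3 * (1 + norm p)) ^ N * (\<Psi> q / (1 + norm q) ^ N)"
          by (simp add: pos_le_divide_eq mult.commute)
        then show ?thesis using True \<Psi>0[of q] by (simp add: ennreal_mult[symmetric] ennreal_leI)
      qed (auto simp: indicator_def)
    qed
    also have "\<dots> = ennreal ((3 * (1 + norm p)) ^ N) * I" unfolding I_def by (rule nn_integral_cmult) simp
    also have "\<dots> = ennreal ((3 * (1 + norm p)) ^ N * enn2real I)"
      using Ifin by (simp add: ennreal_mult less_top[symmetric])
    finally have "norm (\<eta> p) \<le> (3 * (1 + norm p)) ^ N * enn2real I"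
      by (simp add: ennreal_le_iff)
    then show ?thesis by (simp only: power_mult_distrib mult_ac)
  qed
  then show ?thesis by (intro exI[of _ "3 ^ N * enn2real I"] exI[of _ N]) auto
qed

section \<open>Gaussian cut-offs\<close>

text \<open>Its value at the origin is 1, as required of a cut-off. This choice of cut-off preserves
  the Gaussian form of the Weyl matrix elements.\<close>

definition gauss_plane :: "real \<times> real \<Rightarrow> real" where
  "gauss_plane p = exp (- (p \<bullet> p) / 2)"

text \<open>An arbitrary direction v lets one induction serve both partial derivatives.\<close>

lemma real_polynomial_directional_derivative:
  fixes P :: "'a::real_normed_vector \<Rightarrow> real"
  assumes "real_polynomial_function P"
  shows "\<exists>Q. real_polynomial_function Q \<and> (\<forall>p. ((\<lambda>t. P (p + t *\<^sub>R v)) has_real_derivative Q p) (at 0))"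
  using assms
proof (induction rule: real_polynomial_function.induct)
  case (linear f)
  have "((\<lambda>t. f (p + t *\<^sub>R v)) has_real_derivative f v) (at 0)" for p
    unfolding linear_simps[OF linear] by (auto intro!: derivative_eq_intros)
  then show ?case by (intro exI[of _ "\<lambda>_. f v"] conjI real_polynomial_function.intros(2)) auto
next
  case (const c)
  show ?case by (rule exI[of _ "\<lambda>_. 0"]) auto
next
  case (add f g)
  then obtain f' g' where
    "real_polynomial_function f'" "\<And>p. ((\<lambda>t. f (p + t *\<^sub>R v)) has_real_derivative f' p) (at 0)"
    "real_polynomial_function g'" "\<And>p. ((\<lambda>t. g (p + t *\<^sub>R v)) has_real_derivative g' p) (at 0)"
    by blast
  then show ?case
    by (intro exI[of _ "\<lambda>p. f' p + g' p"] conjI allI DERIV_add real_polynomial_function.intros(3))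
next
  case (mult f g)
  then obtain f' g' where
    "real_polynomial_function f'" "\<And>p. ((\<lambda>t. f (p + t *\<^sub>R v)) has_real_derivative f' p) (at 0)"
    "real_polynomial_function g'" "\<And>p. ((\<lambda>t. g (p + t *\<^sub>R v)) has_real_derivative g' p) (at 0)"
    by blast
  note fg = this
  have "((\<lambda>t. f (p + t *\<^sub>R v) * g (p + t *\<^sub>R v)) has_real_derivative f' p * g p + g' p * f p) (at 0)" for p
    using DERIV_mult[OF fg(2,4), of p p] by simp
  then show ?case using mult.hyps fg(1,3)
    by (intro exI[of _ "\<lambda>p. f' p * g p + g' p * f p"] conjI allI real_polynomial_function.intros(3,4))
qed

lemma real_polynomial_growth:
  fixes P :: "'a::real_normed_vector \<Rightarrow> real"
  assumes "real_polynomial_function P"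
  shows "\<exists>C m. 0 \<le> C \<and> (\<forall>p. \<bar>P p\<bar> \<le> C * (1 + norm p) ^ m)"
  using assms
proof (induction rule: real_polynomial_function.induct)
  case (linear f)
  then obtain K where K: "0 \<le> K" "\<And>x. norm (f x) \<le> norm x * K"
    using bounded_linear.nonneg_bounded by blast
  have "\<bar>f p\<bar> \<le> K * (1 + norm p) ^ 1" for p
    using K(2)[of p] mult_left_mono[OF _ K(1), of "norm p" "1 + norm p"] by (simp add: mult.commute)
  then show ?case using K(1) by blast
next
  case (const c)
  have "\<bar>c\<bar> \<le> \<bar>c\<bar> * (1 + norm p) ^ 0" for p :: 'a by simp
  then show ?case using abs_ge_zero by blast
next
  case (add f g)
  then obtain C m D n where C: "0 \<le> C" "\<And>p. \<bar>f p\<bar> \<le> C * (1 + norm p) ^ m"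
    and D: "0 \<le> D" "\<And>p. \<bar>g p\<bar> \<le> D * (1 + norm p) ^ n" by blast
  have "\<bar>f p + g p\<bar> \<le> (C + D) * (1 + norm p) ^ (m + n)" for p
  proof -
    have "\<bar>f p + g p\<bar> \<le> C * (1 + norm p) ^ m + D * (1 + norm p) ^ n"
      using C(2)[of p] D(2)[of p] by linarith
    also have "\<dots> \<le> C * (1 + norm p) ^ (m + n) + D * (1 + norm p) ^ (m + n)"
      using C(1) D(1) by (intro add_mono mult_left_mono power_increasing) auto
    finally show ?thesis by (simp add: distrib_right)
  qed
  then show ?case using C(1) D(1) by (meson add_nonneg_nonneg)
next
  case (mult f g)
  then obtain C m D n where C: "0 \<le> C" "\<And>p. \<bar>f p\<bar> \<le> C * (1 + norm p) ^ m"
    and D: "0 \<le> D" "\<And>p. \<bar>g p\<bar> \<le> D * (1 + norm p) ^ n" by blast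
  have "\<bar>f p * g p\<bar> \<le> (C * D) * (1 + norm p) ^ (m + n)" for p
    using mult_mono[OF C(2)[of p] D(2)[of p]] C(1) by (simp add: abs_mult power_add mult_ac)
  then show ?case using C(1) D(1) by (meson mult_nonneg_nonneg)
qed

lemma gauss_plane_directional_derivative:
  "((\<lambda>t. gauss_plane (p + t *\<^sub>R v)) has_real_derivative - (p \<bullet> v) * gauss_plane p) (at 0)"
  unfolding gauss_plane_def inner_add_left inner_add_right inner_scaleR_left inner_scaleR_right
  by (auto intro!: derivative_eq_intros simp: inner_commute)

lemma polynomial_gauss_directional_derivative:
  assumes P: "real_polynomial_function P"
  shows "\<exists>Q. real_polynomial_function Q \<and> (\<forall>p. ((\<lambda>t. complex_of_real (P (p
      + t *\<^sub>R v) * gauss_plane (p + t *\<^sub>R v)))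
    has_vector_derivative complex_of_real (Q p * gauss_plane p)) (at 0))"
proof -
  obtain Q where Q: "real_polynomial_function Q" "\<And>p. ((\<lambda>t. P (p + t *\<^sub>R v)) has_real_derivative Q p) (at 0)"
    using real_polynomial_directional_derivative[OF P] by blast
  have "((\<lambda>t. P (p + t *\<^sub>R v) * gauss_plane (p + t *\<^sub>R v)) has_real_derivative (Q p
      - (p \<bullet> v) * P p) * gauss_plane p) (at 0)" for p
    using DERIV_mult[OF Q(2)[of p] gauss_plane_directional_derivative[of p v]] by (simp add: algebra_simps)
  then have "((\<lambda>t. complex_of_real (P (p + t *\<^sub>R v) * gauss_plane (p + t *\<^sub>R v)))
    has_vector_derivative complex_of_real ((Q p - (p \<bullet> v) * P p) * gauss_plane p)) (at 0)" for p
    by (rule has_vector_derivative_of_real[unfolded has_real_derivative_iff_has_vector_derivative[symmetric]])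
  moreover have "real_polynomial_function (\<lambda>p. Q p - (p \<bullet> v) * P p)"
    by (intro real_polynomial_function_diff Q(1) P real_polynomial_function.intros(4)
        real_polynomial_function.intros(1)[OF bounded_linear_inner_left])
  ultimately show ?thesis by (intro exI[of _ "\<lambda>p. Q p - (p \<bullet> v) * P p"]) blast
qed

lemma partial_x_eqI:
  assumes "((\<lambda>t. \<psi> ((x, y) + t *\<^sub>R (1, 0))) has_vector_derivative d) (at 0)"
  shows "partial_x \<psi> (x, y) = d"
proof -
  have "((\<lambda>t. \<psi> ((x, y) + t *\<^sub>R (1, 0))) \<circ> (\<lambda>s. s - x) has_vector_derivative 1 *\<^sub>R d) (at x)"
    using assms by (intro vector_diff_chain_at) (auto intro!: derivative_eq_intros)
  then show ?thesis by (simp add: partial_x_def o_def vector_derivative_at)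
qed

lemma partial_y_eqI:
  assumes "((\<lambda>t. \<psi> ((x, y) + t *\<^sub>R (0, 1))) has_vector_derivative d) (at 0)"
  shows "partial_y \<psi> (x, y) = d"
proof -
  have "((\<lambda>t. \<psi> ((x, y) + t *\<^sub>R (0, 1))) \<circ> (\<lambda>s. s - y) has_vector_derivative 1 *\<^sub>R d) (at y)"
    using assms by (intro vector_diff_chain_at) (auto intro!: derivative_eq_intros)
  then show ?thesis by (simp add: partial_y_def o_def vector_derivative_at)
qed

text \<open>Polynomials times the Gaussian form a class closed under both partial derivatives, so
  induction over \<open>partials\<close> stays inside it.\<close>

lemma partials_gauss:
  assumes "\<psi> \<in> partials (\<lambda>p. complex_of_real (gauss_plane p))"
  shows "\<exists>P. real_polynomial_function P \<and> \<psi> = (\<lambda>p. complex_of_real (P p * gauss_plane p))"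
  using assms
proof (induction rule: partials.induct)
  case 1
  have "real_polynomial_function (\<lambda>_::real \<times> real. 1)" by (rule real_polynomial_function.intros(2))
  then show ?case by fastforce
next
  case (2 \<psi>)
  then obtain P where P: "real_polynomial_function P" "\<psi>
      = (\<lambda>p. complex_of_real (P p * gauss_plane p))" by blast
  from polynomial_gauss_directional_derivative[OF P(1), of "(1, 0)"]
  show ?case unfolding P(2) by (metis (no_types, lifting) ext partial_x_eqI surj_pair)
next
  case (3 \<psi>)
  then obtain P where P: "real_polynomial_function P" "\<psi>
      = (\<lambda>p. complex_of_real (P p * gauss_plane p))" by blast
  from polynomial_gauss_directional_derivative[OF P(1), of "(0, 1)"]
  show ?case unfolding P(2) by (metis (no_types, lifting) ext partial_y_eqI surj_pair)
qed

lemma schwartz_gauss: "schwartz (\<lambda>p. complex_of_real (gauss_plane p))"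
  unfolding schwartz_def C_infinity_def
proof (intro conjI ballI allI)
  fix \<psi> assume "\<psi> \<in> partials (\<lambda>p. complex_of_real (gauss_plane p))"
  then obtain P where P: "real_polynomial_function P" "\<psi> = (\<lambda>p. complex_of_real (P p * gauss_plane p))"
    using partials_gauss by blast
  show "\<psi> differentiable (at p)" for p
  proof -
    have "P differentiable (at p)" by (rule differentiable_at_real_polynomial_function[OF P(1)])
    moreover have "gauss_plane differentiable (at p)"
      unfolding gauss_plane_def differentiable_def by (rule exI) (auto intro!: derivative_eq_intros)
    ultimately have "(\<lambda>p. P p * gauss_plane p) differentiable (at p)" by (rule differentiable_mult)
    then obtain L where "((\<lambda>p. P p * gauss_plane p) has_derivative L) (at p)" unfolding differentiable_def by blast
    then have "(\<psi> has_derivative (\<lambda>x. of_real (L x))) (at p)" unfolding P(2) by (rule has_derivative_of_real)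
    then show ?thesis unfolding differentiable_def by blast
  qed
  fix N
  obtain C m where C: "0 \<le> C" "\<And>p. \<bar>P p\<bar> \<le> C * (1 + norm p) ^ m"
      using real_polynomial_growth[OF P(1)] by blast
  \<comment> \<open>The factorial comes from bounding a power by one term of an exponential series,
    and 3 / 2 is the maximum of 1 + r - r^2 / 2, attained at r = 1.\<close>
  have "norm ((1 + norm p) ^ N *\<^sub>R \<psi> p) \<le> C * fact (N + m) * exp (3 / 2)" for p :: "real \<times> real"
  proof -
    define r where "r = norm p"
    have r: "0 \<le> r" by (simp add: r_def)
    have g: "gauss_plane p = exp (- r\<^sup>2 / 2)" by (simp add: gauss_plane_def r_def power2_norm_eq_inner)
    have "norm ((1 + norm p) ^ N *\<^sub>R \<psi> p) = (1 + r) ^ N * (\<bar>P p\<bar> * exp (- r\<^sup>2 / 2))"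
      using r by (simp add: P(2) norm_mult abs_mult g r_def[symmetric])
    also have "\<dots> \<le> (1 + r) ^ N * (C * (1 + r) ^ m * exp (- r\<^sup>2 / 2))"
      using C(2)[of p] r by (intro mult_left_mono mult_right_mono) (auto simp: r_def)
    also have "\<dots> = C * (1 + r) ^ (N + m) * exp (- r\<^sup>2 / 2)" by (simp add: power_add mult_ac)
    also have "\<dots> \<le> C * (fact (N + m) * exp (1 + r)) * exp (- r\<^sup>2 / 2)"
    proof -
      have e: "(1 + r) ^ (N + m) / fact (N + m) \<le> exp (1 + r)"
      proof -
        have "(\<Sum>n\<in>{N + m}. (1 + r) ^ n /\<^sub>R fact n) \<le> (\<Sum>n. (1 + r) ^ n /\<^sub>R fact n)"
          using r by (intro sum_le_suminf sums_summable[OF exp_converges]) auto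
        then show ?thesis using sums_unique[OF exp_converges[of "1 + r"]]
            by (simp add: divide_inverse mult.commute)
      qed
      then have "(1 + r) ^ (N + m) \<le> fact (N + m) * exp (1 + r)" by (simp add: divide_simps mult.commute)
      then show ?thesis
        using C(1) by (intro mult_left_mono mult_right_mono) auto
    qed
    also have "\<dots> = C * fact (N + m) * exp (1 + r - r\<^sup>2 / 2)" by (simp add: exp_add[symmetric] mult.assoc)
    also have "\<dots> \<le> C * fact (N + m) * exp (3 / 2)"
    proof -
      have "0 \<le> (r - 1)\<^sup>2" by simp
      then have "1 + r - r\<^sup>2 / 2 \<le> 3 / 2" by (simp add: power2_diff)
      then show ?thesis using C(1) by (intro mult_left_mono) auto
    qed
    finally show ?thesis .
  qed
  then show "bounded (range (\<lambda>p. (1 + norm p) ^ N *\<^sub>R \<psi> p))" by (auto simp: bounded_iff)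
qed

section \<open>Fourier transforms of Gaussians\<close>

text \<open>Closed form of the integral of exp (- s u^2 / 2 + \<alpha> u - i u x) over u, without
  the normalisation 1 / (2 pi).\<close>

definition gauss_fourier :: "real \<Rightarrow> complex \<Rightarrow> real \<Rightarrow> complex" where
  "gauss_fourier s \<alpha> x = of_real (sqrt (2 * pi / s)) * exp ((\<alpha> - \<i> * of_real x)\<^sup>2 / of_real (2 * s))"

text \<open>Substituting u = a / s + y / sqrt s completes the square for the real part a of
  \<alpha>. What remains is the characteristic function of the standard normal distribution at (b -
  x) / sqrt s; it replaces a contour shift.\<close>

lemma has_bochner_integral_gauss_fourier:
  fixes \<alpha> :: complex
  assumes s: "0 < s"
  shows "has_bochner_integral lborel
    (\<lambda>u. exp (of_real (- (s * u\<^sup>2 / 2)) + \<alpha> * of_real u) * exp (- \<i> * of_real (u * x))) (gauss_fourier s \<alpha> x)"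
proof -
  define a b where "a = Re \<alpha>" and "b = Im \<alpha>"
  have \<alpha>: "\<alpha> = of_real a + \<i> * of_real b" by (simp add: a_def b_def complex_eq_iff)
  define \<tau> where "\<tau> = (b - x) / sqrt s"
  \<comment> \<open>The part of the integrand that is constant in y after the substitution.\<close>
  define K where "K = exp (of_real (a\<^sup>2 / (2 * s)) + \<i> * of_real ((b - x) * a / s))"
  define c where "c = 1 / sqrt s"
  have c: "c \<noteq> 0" "s * c\<^sup>2 = 1" "c * sqrt s = 1" using s by (auto simp: c_def power_divide)
  let ?f = "\<lambda>u. exp (of_real (- (s * u\<^sup>2 / 2)) + \<alpha> * of_real u) * exp (- \<i> * of_real (u * x))"
  let ?n = "\<lambda>y. std_normal_density y *\<^sub>R exp (\<i> * of_real (\<tau> * y))"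
  have i: "integrable lborel ?n"
  proof (rule Bochner_Integration.integrable_bound)
    show "integrable lborel (std_normal_density :: real \<Rightarrow> real)" by simp
  qed (auto simp: abs_mult)
  have "integral\<^sup>L lborel ?n = char std_normal_distribution \<tau>"
    unfolding char_def
    by (subst integral_density) (auto simp: normal_density_nonneg)
  also have "\<dots> = of_real (exp (- \<tau>\<^sup>2 / 2))" by (simp add: char_std_normal_distribution)
  finally have "has_bochner_integral lborel ?n (of_real (exp (- \<tau>\<^sup>2 / 2)))"
    using i by (simp add: has_bochner_integral_iff)
  from has_bochner_integral_mult_right[OF this, of "K * of_real (sqrt (2 * pi))"]
  have "has_bochner_integral lborel (\<lambda>y. K * of_real (sqrt (2 * pi)) * ?n y)
     (K * of_real (sqrt (2 * pi)) * of_real (exp (- \<tau>\<^sup>2 / 2)))" by simp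
  moreover have "K * of_real (sqrt (2 * pi)) * ?n y = ?f (a / s + c * y)" for y
  proof -
    let ?E = "of_real (a\<^sup>2 / (2 * s)) + \<i> * of_real ((b - x) * a / s) + of_real (- y\<^sup>2 / 2)
        + \<i> * of_real (\<tau> * y)"
    let ?F = "of_real (- (s * (a / s + c * y)\<^sup>2 / 2)) + \<alpha> * of_real (a / s + c * y) +
        - \<i> * of_real ((a / s + c * y) * x)"
    have "K * of_real (sqrt (2 * pi)) * ?n y
        = K * (of_real (exp (- y\<^sup>2 / 2)) * exp (\<i> * of_real (\<tau> * y)))"
      by (simp add: std_normal_density_def scaleR_conv_of_real)
    also have "\<dots> = exp (?E)"
      by (simp only: K_def exp_add exp_of_real[symmetric] mult.assoc)
    also have "?E
        = ?F"
    proof (rule complex_eqI)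
      have "s * (a / s + c * y)\<^sup>2 = a\<^sup>2 / s + 2 * a * c * y + (s * c\<^sup>2) * y\<^sup>2"
        using s by (simp add: power2_eq_square field_simps)
      then have 1: "s * (a / s + c * y)\<^sup>2 = a\<^sup>2 / s + 2 * a * c * y + y\<^sup>2" by (simp only: c mult_1)
      show "Re (?E)
        = Re (?F)"
        unfolding 1 \<alpha> using s by (simp add: power2_eq_square field_simps)
      have \<tau>: "\<tau> = (b - x) * c" by (simp add: \<tau>_def c_def)
      show "Im (?E)
        = Im (?F)"
        unfolding \<alpha> \<tau> using s by (simp add: field_simps)
    qed
    finally show ?thesis by (simp only: exp_add)
  qed
  moreover have "K * of_real (sqrt (2 * pi)) * of_real (exp (- \<tau>\<^sup>2 / 2)) = gauss_fourier s \<alpha> x /\<^sub>R \<bar>c\<bar>"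
  proof -
    have "K * of_real (exp (- \<tau>\<^sup>2 / 2)) = exp (of_real (a\<^sup>2 / (2 * s)) + \<i> * of_real ((b
        - x) * a / s) + of_real (- \<tau>\<^sup>2 / 2))"
      by (simp only: K_def exp_add exp_of_real[symmetric])
    also have "of_real (a\<^sup>2 / (2 * s)) + \<i> * of_real ((b - x) * a / s) + of_real (- \<tau>\<^sup>2 / 2)
        = (\<alpha> - \<i> * of_real x)\<^sup>2 / of_real (2 * s)"
    proof -
      define d where "d = b - x"
      have t2: "- \<tau>\<^sup>2 / 2 = - (d\<^sup>2 / (2 * s))" using s by (simp add: \<tau>_def d_def power_divide)
      have "\<alpha> - \<i> * of_real x = of_real a + \<i> * of_real d" by (simp add: \<alpha> d_def algebra_simps)
      moreover have "(of_real a + \<i> * of_real d)\<^sup>2 = of_real (a\<^sup>2 - d\<^sup>2) + \<i> * of_real (2 * (d * a))"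
        by (simp add: power2_eq_square complex_eq_iff)
      ultimately have sq: "(\<alpha> - \<i> * of_real x)\<^sup>2 = of_real (a\<^sup>2 - d\<^sup>2) + \<i> * of_real (2 * (d * a))" by simp
      show ?thesis unfolding t2 sq d_def[symmetric] using s by (simp add: complex_eq_iff diff_divide_distrib)
    qed
    finally have "K * of_real (exp (- \<tau>\<^sup>2 / 2)) = exp ((\<alpha> - \<i> * of_real x)\<^sup>2 / of_real (2 * s))" .
    moreover have "sqrt (2 * pi / s) = sqrt (2 * pi) * \<bar>c\<bar>" using s by (simp add: c_def real_sqrt_divide)
    ultimately show ?thesis using c by (simp add: gauss_fourier_def scaleR_conv_of_real mult_ac)
  qed
  ultimately have "has_bochner_integral lborel (\<lambda>y. ?f (a / s + c * y)) (gauss_fourier s \<alpha> x /\<^sub>R \<bar>c\<bar>)"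
    by (simp only:)
  then show ?thesis by (rule iffD2[OF lborel_has_bochner_integral_real_affine_iff[OF c(1)]])
qed

text \<open>Up to a factor independent of x, the modulus is a normal density with mean Im \<alpha>
  and variance s; this makes the moments accessible.\<close>

lemma cmod_gauss_fourier:
  assumes "0 < s"
  shows "cmod (gauss_fourier s \<alpha> x) = 2 * pi * exp ((Re \<alpha>)\<^sup>2 / (2 * s)) * normal_density (Im \<alpha>) (sqrt s) x"
proof -
  have "Re ((\<alpha> - \<i> * of_real x)\<^sup>2 / of_real (2 * s)) = (Re \<alpha>)\<^sup>2 / (2 * s) + (- (x - Im \<alpha>)\<^sup>2 / (2 * s))"
    using assms by (simp add: power2_eq_square field_simps)
  then have "cmod (gauss_fourier s \<alpha> x) = sqrt (2 * pi / s) * (exp ((Re \<alpha>)\<^sup>2 / (2 * s)) * exp (- (x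
      - Im \<alpha>)\<^sup>2 / (2 * s)))"
    using assms by (simp only: gauss_fourier_def norm_mult norm_exp_eq_Re norm_of_real exp_add) simp
  moreover have "sqrt (2 * pi / s) = 2 * pi * (1 / sqrt (2 * pi * s))"
  proof -
    have "2 * pi / s = (2 * pi)\<^sup>2 / (2 * pi * s)" using assms by (simp add: power2_eq_square)
    then have "sqrt (2 * pi / s) = sqrt ((2 * pi)\<^sup>2) / sqrt (2 * pi * s)" by (simp only: real_sqrt_divide)
    moreover have "sqrt ((2 * pi)\<^sup>2) = 2 * pi" unfolding real_sqrt_abs by simp
    ultimately show ?thesis by simp
  qed
  ultimately show ?thesis using assms by (simp add: normal_density_def)
qed

lemma gauss_fourier_shift: "gauss_fourier s (\<alpha> + \<i> * of_real c) x = gauss_fourier s \<alpha> (x - c)"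
  by (simp add: gauss_fourier_def algebra_simps)

text \<open>The variance s may approach r = 0, where the densities concentrate at Im \<alpha>. Their
  moments stay bounded, and the prefactor exp ((Re \<alpha>)^2 / (2 s)) does so because Re \<alpha>
  = 0 in that case.\<close>

lemma gauss_fourier_moment_bound:
  assumes "0 \<le> r" "r = 0 \<longrightarrow> Re \<alpha> = 0"
  shows "\<exists>C\<ge>0. \<forall>s. r < s \<and> s \<le> r + 1 \<longrightarrow>
    integrable lborel (\<lambda>x. (1 + \<bar>x\<bar>) ^ N * cmod (gauss_fourier s \<alpha> x)) \<and>
    (LINT x|lborel. (1 + \<bar>x\<bar>) ^ N * cmod (gauss_fourier s \<alpha> x)) \<le> C"
proof -
  define a b where "a = Re \<alpha>" and "b = Im \<alpha>"
  \<comment> \<open>Chosen so that 1 + |b + sqrt s y| \<le> B (1 + |y|) for all s in the given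
    range.\<close>
  define B where "B = 1 + \<bar>b\<bar> + sqrt (r + 1)"
  let ?J = "\<lambda>y. (2 * B) ^ N * (std_normal_density y * \<bar>y\<bar> ^ 0 + std_normal_density y * \<bar>y\<bar> ^ N)"
  have J: "integrable lborel ?J"
    by (intro integrable_mult_right Bochner_Integration.integrable_add integrable_std_normal_moment_abs)
  have B: "1 \<le> B" "0 \<le> B" using assms by (auto simp: B_def)
  \<comment> \<open>For r = 0 the exponent is 0 by the convention for division by zero, which is the
    right bound since then a = 0.\<close>
  define E where "E = 2 * pi * exp (a\<^sup>2 / (2 * r))"
  have E: "0 \<le> E" by (simp add: E_def)
  have "integrable lborel (\<lambda>x. (1 + \<bar>x\<bar>) ^ N * cmod (gauss_fourier s \<alpha> x)) \<and>
    (LINT x|lborel. (1 + \<bar>x\<bar>) ^ N * cmod (gauss_fourier s \<alpha> x)) \<le> E * (LINT y|lborel. ?J y)"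
    if s: "r < s" "s \<le> r + 1" for s
  proof -
    have s0: "0 < s" using s assms by simp
    define F where "F = 2 * pi * exp (a\<^sup>2 / (2 * s))"
    have F: "0 \<le> F" by (simp add: F_def)
    have FE: "F \<le> E"
    proof (cases "r = 0")
      case True
      then show ?thesis using assms by (simp add: F_def E_def a_def)
    next
      case False
      then have "a\<^sup>2 / (2 * s) \<le> a\<^sup>2 / (2 * r)" using assms s by (intro divide_left_mono) auto
      then show ?thesis by (simp add: F_def E_def)
    qed
    let ?g = "\<lambda>x. (1 + \<bar>x\<bar>) ^ N * normal_density b (sqrt s) x"
    have sub: "normal_density b (sqrt s) (b + sqrt s * y) = std_normal_density y / sqrt s" for y
      using s0 by (simp add: normal_density_def power_mult_distrib real_sqrt_mult field_simps)
    have le: "(1 + \<bar>b + sqrt s * y\<bar>) ^ N * std_normal_density y \<le> ?J y" for y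
    proof -
      have "1 + \<bar>b + sqrt s * y\<bar> \<le> 1 + \<bar>b\<bar> + sqrt s * \<bar>y\<bar>"
        using abs_triangle_ineq[of b "sqrt s * y"] s0 by (simp add: abs_mult)
      also have "\<dots> \<le> 1 + \<bar>b\<bar> + sqrt (r + 1) * \<bar>y\<bar>"
        using s by (intro add_left_mono mult_right_mono real_sqrt_le_mono) auto
      also have "\<dots> \<le> B * (1 + \<bar>y\<bar>)" using assms by (simp add: B_def algebra_simps)
      also have "\<dots> \<le> B * (2 * max 1 \<bar>y\<bar>)" using B by (intro mult_left_mono) auto
      finally have "(1 + \<bar>b + sqrt s * y\<bar>) ^ N \<le> (2 * B * max 1 \<bar>y\<bar>) ^ N"
        by (intro power_mono) (auto simp: mult_ac)
      also have "\<dots> \<le> (2 * B) ^ N * (1 + \<bar>y\<bar> ^ N)"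
        unfolding power_mult_distrib[of "2 * B"] using B by (intro mult_left_mono) (auto simp: max_def)
      finally have "(1 + \<bar>b + sqrt s * y\<bar>) ^ N * std_normal_density y
          \<le> (2 * B) ^ N * (1 + \<bar>y\<bar> ^ N) * std_normal_density y"
        by (intro mult_right_mono) auto
      then show ?thesis by (simp add: algebra_simps)
    qed
    have i1: "integrable lborel (\<lambda>y. (1 + \<bar>b + sqrt s * y\<bar>) ^ N * std_normal_density y)"
      using J
    proof (rule Bochner_Integration.integrable_bound)
      show "AE y in lborel. norm ((1 + \<bar>b + sqrt s * y\<bar>) ^ N * std_normal_density y) \<le> norm (?J y)"
        using order_trans[OF le abs_ge_self] by (intro AE_I2) (simp add: abs_mult)
    qed measurable
    have gs: "?g (b + sqrt s * y) = (1 + \<bar>b + sqrt s * y\<bar>) ^ N * std_normal_density y / sqrt s" for y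
      by (simp add: sub)
    have i2: "integrable lborel ?g"
      using i1 s0 lborel_integrable_real_affine_iff[of "sqrt s" ?g b] by (simp only: gs) simp
    have "(LINT x|lborel. ?g x) = sqrt s * (LINT y|lborel. (1 + \<bar>b
        + sqrt s * y\<bar>) ^ N * std_normal_density y / sqrt s)"
      using s0 lborel_integral_real_affine[of "sqrt s" ?g b] by (simp only: gs) simp
    also have "\<dots> = (LINT y|lborel. (1 + \<bar>b + sqrt s * y\<bar>) ^ N * std_normal_density y)"
      using s0 by simp
    also have "\<dots> \<le> (LINT y|lborel. ?J y)" by (rule integral_mono[OF i1 J le])
    finally have gJ: "(LINT x|lborel. ?g x) \<le> (LINT y|lborel. ?J y)" .
    have eq: "(1 + \<bar>x\<bar>) ^ N * cmod (gauss_fourier s \<alpha> x) = F * ?g x" for x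
      unfolding cmod_gauss_fourier[OF s0] by (simp add: F_def a_def b_def)
    have "F * (LINT x|lborel. ?g x) \<le> E * (LINT y|lborel. ?J y)"
      using gJ FE E F by (intro mult_mono integral_nonneg_AE) auto
    then show ?thesis unfolding eq using i2 by simp
  qed
  moreover have "0 \<le> E * (LINT y|lborel. ?J y)"
    using E B by (intro mult_nonneg_nonneg Bochner_Integration.integral_nonneg) auto
  ultimately show ?thesis by blast
qed

section \<open>Gaussians on the plane and functions of polynomial growth\<close>

lemma lborel_product:
  fixes f g :: "real \<Rightarrow> 'b::{real_normed_field, banach, second_countable_topology}"
  assumes f: "integrable lborel f" and g: "integrable lborel g"
  shows "integrable lborel (\<lambda>p. f (fst p) * g (snd p))"
    and "(LINT p|lborel. f (fst p) * g (snd p)) = (LINT x|lborel. f x) * (LINT y|lborel. g y)"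
proof -
  have [measurable]: "f \<in> borel_measurable borel" "g \<in> borel_measurable borel"
    using f g by (auto dest: borel_measurable_integrable)
  have i: "integrable (lborel \<Otimes>\<^sub>M lborel) (\<lambda>p. f (fst p) * g (snd p))"
  proof (rule lborel_pair.Fubini_integrable)
    show "integrable lborel (\<lambda>x. LINT y|lborel. norm (f (fst (x, y)) * g (snd (x, y))))"
      using f by (simp add: norm_mult)
    show "AE x in lborel. integrable lborel (\<lambda>y. f (fst (x, y)) * g (snd (x, y)))"
      using g by simp
  qed measurable
  then show "integrable lborel (\<lambda>p. f (fst p) * g (snd p))" by (simp only: lborel_prod)
  show "(LINT p|lborel. f (fst p) * g (snd p)) = (LINT x|lborel. f x) * (LINT y|lborel. g y)"
    using lborel_pair.integral_fst'[OF i] by (simp add: lborel_prod)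
qed

definition poly_bounded :: "(real \<times> real \<Rightarrow> complex) \<Rightarrow> bool" where
  "poly_bounded \<phi> \<longleftrightarrow> (\<exists>C N. 0 \<le> C \<and> (\<forall>p. norm (\<phi> p) \<le> C * (1 + norm p) ^ N))"

lemma poly_bounded_add:
  assumes "poly_bounded \<phi>" "poly_bounded \<psi>" shows "poly_bounded (\<lambda>p. \<phi> p + \<psi> p)"
proof -
  obtain C m D n where C: "0 \<le> C" "\<And>p. norm (\<phi> p) \<le> C * (1 + norm p) ^ m"
    and D: "0 \<le> D" "\<And>p. norm (\<psi> p) \<le> D * (1 + norm p) ^ n"
    using assms unfolding poly_bounded_def by blast
  have "norm (\<phi> p + \<psi> p) \<le> (C + D) * (1 + norm p) ^ (m + n)" for p
  proof -
    have "norm (\<phi> p + \<psi> p) \<le> C * (1 + norm p) ^ m + D * (1 + norm p) ^ n"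
      using C(2)[of p] D(2)[of p] norm_triangle_ineq[of "\<phi> p" "\<psi> p"] by linarith
    also have "\<dots> \<le> C * (1 + norm p) ^ (m + n) + D * (1 + norm p) ^ (m + n)"
      using C(1) D(1) by (intro add_mono mult_left_mono power_increasing) auto
    finally show ?thesis by (simp add: distrib_right)
  qed
  then show ?thesis unfolding poly_bounded_def using C(1) D(1) by (meson add_nonneg_nonneg)
qed

lemma poly_bounded_scaleR:
  assumes "poly_bounded \<phi>" shows "poly_bounded (\<lambda>p. c *\<^sub>R \<phi> p)"
proof -
  obtain C m where C: "0 \<le> C" "\<And>p. norm (\<phi> p) \<le> C * (1 + norm p) ^ m"
    using assms unfolding poly_bounded_def by blast
  have "norm (c *\<^sub>R \<phi> p) \<le> \<bar>c\<bar> * C * (1 + norm p) ^ m" for p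
    using mult_left_mono[OF C(2)[of p], of "\<bar>c\<bar>"] by (simp add: mult.assoc)
  moreover have "0 \<le> \<bar>c\<bar> * C" using C(1) by simp
  ultimately show ?thesis unfolding poly_bounded_def by blast
qed

lemma shifted_growth:
  fixes p q :: "'b::real_normed_vector"
  shows "(1 + norm (p + q)) ^ N \<le> (1 + norm q) ^ N * (1 + norm p) ^ N"
proof -
  have "1 + norm (p + q) \<le> (1 + norm q) * (1 + norm p)"
    using norm_triangle_ineq[of p q] mult_nonneg_nonneg[OF norm_ge_zero[of q] norm_ge_zero[of p]]
    unfolding distrib_left distrib_right by linarith
  then have "(1 + norm (p + q)) ^ N \<le> ((1 + norm q) * (1 + norm p)) ^ N" by (intro power_mono) auto
  then show ?thesis by (simp add: power_mult_distrib)
qed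

lemma poly_bounded_shift:
  assumes "poly_bounded \<phi>" shows "poly_bounded (\<lambda>p. \<phi> (p + q))"
proof -
  obtain C m where C: "0 \<le> C" "\<And>p. norm (\<phi> p) \<le> C * (1 + norm p) ^ m"
    using assms unfolding poly_bounded_def by blast
  have "norm (\<phi> (p + q)) \<le> C * (1 + norm q) ^ m * (1 + norm p) ^ m" for p
    using order_trans[OF C(2) mult_left_mono[OF shifted_growth C(1)]] by (simp add: mult.assoc)
  moreover have "0 \<le> C * (1 + norm q) ^ m" using C(1) by simp
  ultimately show ?thesis unfolding poly_bounded_def by blast
qed

text \<open>The shape of the Weyl matrix elements between exponential vectors, with a and b the
  squared norms of h_1 and h_2. Either may be 0, and then there is no Gaussian decay in that
  variable.\<close>

definition gauss_form :: "real \<Rightarrow> real \<Rightarrow> complex \<Rightarrow> complex \<Rightarrow> complex \<Rightarrow> real \<times> real \<Rightarrow> complex" where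
  "gauss_form a b \<alpha> \<beta> \<gamma> p = exp (of_real (- (a * (fst p)\<^sup>2 / 2)) + \<alpha> * of_real (fst p)
     + (of_real (- (b * (snd p)\<^sup>2 / 2)) + \<beta> * of_real (snd p)) + \<gamma>)"

text \<open>The cut-off only adds \<open>\<epsilon>\<^sup>2\<close> to both quadratic coefficients,
  which makes them positive in degenerate directions as well when \<epsilon> is nonzero.\<close>

lemma gauss_cutoff:
  "complex_of_real (gauss_plane (\<epsilon> *\<^sub>R p)) * gauss_form a b \<alpha> \<beta> \<gamma> p = gauss_form (a + \<epsilon>\<^sup>2) (b + \<epsilon>\<^sup>2) \<alpha> \<beta> \<gamma> p"
proof -
  have "gauss_plane (\<epsilon> *\<^sub>R p) = exp (- (\<epsilon>\<^sup>2 * (fst p)\<^sup>2 / 2) - \<epsilon>\<^sup>2 * (snd p)\<^sup>2 / 2)"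
    by (cases p) (simp add: gauss_plane_def power2_eq_square field_simps)
  then show ?thesis
    unfolding gauss_form_def by (simp add: exp_of_real[symmetric] exp_add[symmetric] algebra_simps add_divide_distrib)
qed

definition gauss_form_fourier :: "real \<Rightarrow> real \<Rightarrow> complex \<Rightarrow> complex \<Rightarrow> complex \<Rightarrow> real \<times> real \<Rightarrow> complex" where
  "gauss_form_fourier a b \<alpha> \<beta> \<gamma> p = (1 / (2 * pi)) *\<^sub>R (exp \<gamma> * (gauss_fourier a \<alpha> (fst p) * gauss_fourier b \<beta> (snd p)))"

lemma inv_fourier_gauss_form:
  assumes "0 < a" "0 < b"
  shows "inv_fourier (gauss_form a b \<alpha> \<beta> \<gamma>) p = gauss_form_fourier a b \<alpha> \<beta> \<gamma> p"
proof -
  let ?f = "\<lambda>u. exp (of_real (- (a * u\<^sup>2 / 2)) + \<alpha> * of_real u) * exp (- \<i> * of_real (u * fst p))"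
  let ?g = "\<lambda>u. exp (of_real (- (b * u\<^sup>2 / 2)) + \<beta> * of_real u) * exp (- \<i> * of_real (u * snd p))"
  have f: "integrable lborel ?f" "integral\<^sup>L lborel ?f = gauss_fourier a \<alpha> (fst p)"
    using has_bochner_integral_gauss_fourier[OF assms(1)] unfolding has_bochner_integral_iff by blast+
  have g: "integrable lborel ?g" "integral\<^sup>L lborel ?g = gauss_fourier b \<beta> (snd p)"
    using has_bochner_integral_gauss_fourier[OF assms(2)] unfolding has_bochner_integral_iff by blast+
  have "gauss_form a b \<alpha> \<beta> \<gamma> q * exp (- \<i> * of_real (q \<bullet> p)) = exp \<gamma> * (?f (fst q) * ?g (snd q))" for q
  proof -
    have "q \<bullet> p = fst q * fst p + snd q * snd p" by (simp add: inner_prod_def)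
    then show ?thesis
      unfolding gauss_form_def exp_add[symmetric] mult.assoc[symmetric]
      by (simp add: exp_add[symmetric] algebra_simps del: of_real_power)
  qed
  then show ?thesis
    unfolding inv_fourier_def gauss_form_fourier_def using lborel_product(2)[OF f(1) g(1)] f(2) g(2) by simp
qed

text \<open>Imaginary increments of the linear coefficients are frequencies, and a frequency
  translates the transform.\<close>

lemma gauss_form_fourier_shift:
  "gauss_form_fourier a b (\<alpha> + \<i> * of_real c1) (\<beta> + \<i> * of_real c2) \<gamma> p
      = gauss_form_fourier a b \<alpha> \<beta> \<gamma> (p - (c1, c2))"
  by (simp add: gauss_form_fourier_def gauss_fourier_shift)

lemma continuous_gauss_fourier: "continuous_on UNIV (gauss_fourier s \<alpha>)"
  unfolding gauss_fourier_def divide_inverse by (intro continuous_intros)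

lemma continuous_gauss_form_fourier: "continuous_on UNIV (gauss_form_fourier a b \<alpha> \<beta> \<gamma>)"
  unfolding gauss_form_fourier_def
  by (intro continuous_intros continuous_on_compose2[OF continuous_gauss_fourier]) auto

text \<open>A product of two one-dimensional bounds, with \<epsilon> \<le> 1 corresponding to s
  \<le> r + 1. Independence of \<epsilon> lets estimates pass to the limit.\<close>

lemma gauss_form_fourier_moment_bound:
  fixes a b :: real and \<alpha> \<beta> \<gamma> :: complex
  defines "G \<equiv> \<lambda>\<epsilon>. gauss_form_fourier (a + \<epsilon>\<^sup>2) (b + \<epsilon>\<^sup>2) \<alpha> \<beta> \<gamma>"
  assumes "0 \<le> a" "a = 0 \<longrightarrow> Re \<alpha> = 0" "0 \<le> b" "b = 0 \<longrightarrow> Re \<beta> = 0"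
  shows "\<exists>C\<ge>0. \<forall>\<epsilon>. 0 < \<epsilon> \<and> \<epsilon> \<le> 1 \<longrightarrow>
    integrable lborel (\<lambda>p. (1 + norm p) ^ N * cmod (G \<epsilon> p)) \<and>
    (LINT p|lborel. (1 + norm p) ^ N * cmod (G \<epsilon> p)) \<le> C"
proof -
  let ?f = "\<lambda>s x. (1 + \<bar>x\<bar>) ^ N * cmod (gauss_fourier s \<alpha> x)"
  let ?g = "\<lambda>s x. (1 + \<bar>x\<bar>) ^ N * cmod (gauss_fourier s \<beta> x)"
  obtain C where C: "0 \<le> C" "\<And>s. a < s \<Longrightarrow> s \<le> a + 1 \<Longrightarrow> integrable lborel (?f s) \<and> (LINT x|lborel. ?f s x) \<le> C"
    using gauss_fourier_moment_bound[OF assms(2,3), of N] by blast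
  obtain D where D: "0 \<le> D" "\<And>s. b < s \<Longrightarrow> s \<le> b + 1 \<Longrightarrow> integrable lborel (?g s) \<and> (LINT x|lborel. ?g s x) \<le> D"
    using gauss_fourier_moment_bound[OF assms(4,5), of N] by blast
  define K where "K = cmod (exp \<gamma>) / (2 * pi)"
  have K: "0 \<le> K" by (simp add: K_def)
  have "integrable lborel (\<lambda>p. (1 + norm p) ^ N * cmod (G \<epsilon> p)) \<and>
    (LINT p|lborel. (1 + norm p) ^ N * cmod (G \<epsilon> p)) \<le> K * (C * D)"
    if \<epsilon>: "0 < \<epsilon>" "\<epsilon> \<le> 1" for \<epsilon>
  proof -
    let ?M = "\<lambda>p. (1 + norm p) ^ N * cmod (G \<epsilon> p)"
    let ?H = "\<lambda>p. K * (?f (a + \<epsilon>\<^sup>2) (fst p) * ?g (b + \<epsilon>\<^sup>2) (snd p))"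
    have e: "a < a + \<epsilon>\<^sup>2" "a + \<epsilon>\<^sup>2 \<le> a + 1" "b < b + \<epsilon>\<^sup>2" "b + \<epsilon>\<^sup>2 \<le> b + 1" using \<epsilon>
        by (auto simp: power_le_one)
    note f = C(2)[OF e(1,2)] and g = D(2)[OF e(3,4)]
    note P = lborel_product[OF f[THEN conjunct1] g[THEN conjunct1]]
    have H: "integrable lborel ?H" using P(1) by (rule integrable_mult_right)
    have le: "?M p \<le> ?H p" for p
    proof -
      have "1 + norm p \<le> (1 + \<bar>fst p\<bar>) * (1 + \<bar>snd p\<bar>)"
        using norm_pair_le[of p] mult_nonneg_nonneg[OF abs_ge_zero[of "fst p"] abs_ge_zero[of "snd p"]]
        unfolding distrib_left distrib_right by linarith
      then have "(1 + norm p) ^ N \<le> (1 + \<bar>fst p\<bar>) ^ N * (1 + \<bar>snd p\<bar>) ^ N"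
        unfolding power_mult_distrib[symmetric] by (intro power_mono) auto
      then have "?M p \<le> (1 + \<bar>fst p\<bar>) ^ N * (1 + \<bar>snd p\<bar>) ^ N * cmod (G \<epsilon> p)"
        by (intro mult_right_mono) auto
      then show ?thesis by (simp add: G_def gauss_form_fourier_def norm_mult K_def mult_ac)
    qed
    have "integrable lborel ?M"
      using H
    proof (rule Bochner_Integration.integrable_bound)
      have [measurable]: "G \<epsilon> \<in> borel_measurable borel"
        unfolding G_def by (rule borel_measurable_continuous_onI[OF continuous_gauss_form_fourier])
      show "?M \<in> borel_measurable lborel" by measurable
      show "AE p in lborel. norm (?M p) \<le> norm (?H p)"
        using order_trans[OF le abs_ge_self] by (intro AE_I2) (simp add: abs_mult)
    qed
    moreover have "(LINT p|lborel. ?M p) \<le> (LINT p|lborel. ?H p)"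
      by (rule integral_mono[OF calculation H le])
    moreover have "(LINT p|lborel. ?H p) = K * ((LINT x|lborel. ?f (a
        + \<epsilon>\<^sup>2) x) * (LINT x|lborel. ?g (b + \<epsilon>\<^sup>2) x))"
      using P(2) by simp
    moreover have "\<dots> \<le> K * (C * D)"
      using f g K C(1) by (intro mult_left_mono mult_mono Bochner_Integration.integral_nonneg) auto
    ultimately show ?thesis by linarith
  qed
  moreover have "0 \<le> K * (C * D)" using K C(1) D(1) by simp
  ultimately show ?thesis by blast
qed

section \<open>Derivatives of the cut-off integrals along translations of the symbol\<close>

lemma has_vector_derivative_at_0_if_quadratic:
  fixes f :: "real \<Rightarrow> 'b::real_normed_vector"
  assumes "\<And>h. \<bar>h\<bar> \<le> 1 \<Longrightarrow> norm (f h - f 0 - h *\<^sub>R d) \<le> B * h\<^sup>2"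
  shows "(f has_vector_derivative d) (at 0)"
proof -
  have "((\<lambda>h. norm (f (0 + h) - f 0 - h *\<^sub>R d) / norm h) \<longlongrightarrow> 0) (at 0)"
  proof (rule Lim_null_comparison)
    have "\<forall>\<^sub>F h::real in at 0. \<bar>h\<bar> \<le> 1"
      by (auto simp: eventually_at intro!: exI[of _ 1])
    then show "\<forall>\<^sub>F h in at 0. norm (norm (f (0 + h) - f 0 - h *\<^sub>R d) / norm h) \<le> B * \<bar>h\<bar>"
    proof eventually_elim
      case (elim h)
      have "norm (f h - f 0 - h *\<^sub>R d) / \<bar>h\<bar> \<le> B * h\<^sup>2 / \<bar>h\<bar>" using assms[OF elim]
          by (intro divide_right_mono) auto
      also have "\<dots> = B * \<bar>h\<bar>" by (cases "h = 0") (auto simp: power2_eq_square abs_if)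
      finally show ?case by simp
    qed
    have "((\<lambda>h. B * \<bar>h\<bar>) \<longlongrightarrow> B * \<bar>0\<bar>) (at (0::real))" by (intro tendsto_intros)
    then show "((\<lambda>h. B * \<bar>h\<bar>) \<longlongrightarrow> 0) (at (0::real))" by simp
  qed
  then show ?thesis
    unfolding has_vector_derivative_def has_derivative_at by (auto intro: bounded_linear_scaleR_left)
qed

text \<open>The multiplier \<open>exp (\<i> t (c \<bullet> p))\<close> translates the symbol by \<open>t c\<close>.  Since the moments of the
  cut-off Gaussians are bounded uniformly in the cut-off parameter, the second-order Taylor estimate
  for the symbol survives the limit.\<close>

lemma inv_fourier_integral_derivative:
  assumes smooth: "C_infinity \<phi>" and temp: "\<And>\<psi>. \<psi> \<in> partials \<phi> \<Longrightarrow> tempered \<psi>"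
    and ab: "0 \<le> a" "a = 0 \<longrightarrow> Re \<alpha> = 0" "0 \<le> b" "b = 0 \<longrightarrow> Re \<beta> = 0"
    and f: "\<And>t. has_inv_fourier_integral \<phi>
      (gauss_form a b (\<alpha> + \<i> * of_real (t * c1)) (\<beta> + \<i> * of_real (t * c2)) \<gamma>) (f t)"
    and fx: "has_inv_fourier_integral (partial_x \<phi>) (gauss_form a b \<alpha> \<beta> \<gamma>) fx"
    and fy: "has_inv_fourier_integral (partial_y \<phi>) (gauss_form a b \<alpha> \<beta> \<gamma>) fy"
  shows "(f has_vector_derivative c1 *\<^sub>R fx + c2 *\<^sub>R fy) (at 0)"
proof -
  define c where "c = (c1, c2)"
  define G where "G t = gauss_form a b (\<alpha> + \<i> * of_real (t * c1)) (\<beta> + \<i> * of_real (t * c2)) \<gamma>" for t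
  define g where "g \<epsilon> t p = complex_of_real (gauss_plane (\<epsilon> *\<^sub>R p)) * G t p" for \<epsilon> t p
  define K where "K \<epsilon> = gauss_form_fourier (a + \<epsilon>\<^sup>2) (b + \<epsilon>\<^sup>2) \<alpha> \<beta> \<gamma>" for \<epsilon>
  define D where "D \<psi> p = c1 *\<^sub>R partial_x \<psi> p + c2 *\<^sub>R partial_y \<psi> p" for \<psi> p
  have diff: "\<psi> differentiable (at p)" if "\<psi> \<in> partials \<phi>" for \<psi> p
    using smooth that unfolding C_infinity_def by blast
  have cont: "continuous_on UNIV \<psi>" if "\<psi> \<in> partials \<phi>" for \<psi>
    by (rule continuous_at_imp_continuous_on) (use diff[OF that] differentiable_imp_continuous_within in blast)
  have pb: "poly_bounded \<psi>" if "\<psi> \<in> partials \<phi>" for \<psi>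
    unfolding poly_bounded_def by (rule tempered_partials_poly_bounded[OF smooth temp that])
  note x = partials.intros(2) and y = partials.intros(3)
  have \<phi>: "\<phi> \<in> partials \<phi>" by (rule partials.intros(1))
  have cK: "continuous_on UNIV (K \<epsilon>)" for \<epsilon> unfolding K_def by (rule continuous_gauss_form_fourier)
  have int: "integrable lborel (\<lambda>p. \<psi> p * K \<epsilon> p)"
    if \<psi>: "poly_bounded \<psi>" "continuous_on UNIV \<psi>" and \<epsilon>: "0 < \<epsilon>" "\<epsilon> \<le> 1" for \<psi> \<epsilon>
  proof -
    obtain C m where C: "0 \<le> C" "\<And>p. norm (\<psi> p) \<le> C * (1 + norm p) ^ m"
      using \<psi>(1) unfolding poly_bounded_def by blast
    have "integrable lborel (\<lambda>p. (1 + norm p) ^ m * cmod (K \<epsilon> p))"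
      using gauss_form_fourier_moment_bound[OF ab, of m \<gamma>] \<epsilon> unfolding K_def by blast
    then have "integrable lborel (\<lambda>p. C * ((1 + norm p) ^ m * cmod (K \<epsilon> p)))" by (rule integrable_mult_right)
    then show ?thesis
    proof (rule Bochner_Integration.integrable_bound)
      show "(\<lambda>p. \<psi> p * K \<epsilon> p) \<in> borel_measurable lborel"
        unfolding measurable_lborel2
        by (intro borel_measurable_times borel_measurable_continuous_onI cK \<psi>(2))
      show "AE p in lborel. norm (\<psi> p * K \<epsilon> p) \<le> norm (C * ((1 + norm p) ^ m * cmod (K \<epsilon> p)))"
        using mult_right_mono[OF C(2), of "cmod (K \<epsilon> _)"] C(1)
        by (intro AE_I2) (simp add: norm_mult abs_mult mult.assoc)
    qed
  qed
  \<comment> \<open>The multiplier translates the transformed Gaussian by t c; invariance of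
    Lebesgue measure moves the translation to the symbol.\<close>
  have pair: "inv_fourier_dist \<psi> (g \<epsilon> t)
      = (LINT p|lborel. \<psi> (p + t *\<^sub>R c) * K \<epsilon> p)"
    if "continuous_on UNIV \<psi>" "0 < \<epsilon>" for \<psi> \<epsilon> t
  proof -
    have e: "0 < a + \<epsilon>\<^sup>2" "0 < b + \<epsilon>\<^sup>2" using ab that(2) by (auto simp: add_nonneg_pos)
    have "inv_fourier (g \<epsilon> t) p = K \<epsilon> (p - t *\<^sub>R c)" for p
      unfolding g_def[abs_def] G_def gauss_cutoff inv_fourier_gauss_form[OF e] gauss_form_fourier_shift K_def c_def by simp
    then have "inv_fourier_dist \<psi> (g \<epsilon> t)
        = (LINT p|distr lborel borel ((+) (t *\<^sub>R c)). \<psi> p * K \<epsilon> (p - t *\<^sub>R c))"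
      by (simp add: inv_fourier_dist_def lborel_distr_plus)
    also have "\<dots> = (LINT p|lborel. \<psi> (t *\<^sub>R c + p) * K \<epsilon> (t *\<^sub>R c + p - t *\<^sub>R c))"
    proof (rule integral_distr)
      show "(\<lambda>p. \<psi> p * K \<epsilon> (p - t *\<^sub>R c)) \<in> borel_measurable borel"
        by (intro borel_measurable_continuous_onI continuous_intros that(1) continuous_on_compose2[OF cK]) auto
    qed simp
    finally show ?thesis by (simp add: add.commute)
  qed
  have lim: "((\<lambda>\<epsilon>. LINT p|lborel. \<psi> (p + t *\<^sub>R c) * K \<epsilon> p) \<longlongrightarrow> l) (at_right 0)"
    if "has_inv_fourier_integral \<psi> (G t) l" "continuous_on UNIV \<psi>" for \<psi> t l
  proof -
    have "complex_of_real (gauss_plane 0) = 1" by (simp add: gauss_plane_def)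
    then have "((\<lambda>\<epsilon>. inv_fourier_dist \<psi> (g \<epsilon> t)) \<longlongrightarrow> l) (at_right 0)"
      using that(1) schwartz_gauss unfolding g_def[abs_def] has_inv_fourier_integral_def by blast
    moreover have "\<forall>\<^sub>F \<epsilon> in at_right 0. inv_fourier_dist \<psi> (g \<epsilon> t)
        = (LINT p|lborel. \<psi> (p + t *\<^sub>R c) * K \<epsilon> p)"
      using pair[OF that(2)] by (auto simp: eventually_at_right_field intro!: exI[of _ 1])
    ultimately show ?thesis by (simp cong: tendsto_cong)
  qed
  have "poly_bounded (\<lambda>p. c1 *\<^sub>R D (partial_x \<phi>) p + c2 *\<^sub>R D (partial_y \<phi>) p)"
    unfolding D_def by (intro poly_bounded_add poly_bounded_scaleR pb x y \<phi>)
  then obtain C N where C: "0 \<le> C"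
    "\<And>p. norm (c1 *\<^sub>R D (partial_x \<phi>) p + c2 *\<^sub>R D (partial_y \<phi>) p) \<le> C * (1 + norm p) ^ N"
    unfolding poly_bounded_def by blast
  \<comment> \<open>For |t| \<le> 1 the added factor absorbs the displacement by t c in the growth
    bound of the second derivative.\<close>
  define C' where "C' = C * (1 + norm c) ^ N"
  have C': "0 \<le> C'" using C(1) by (simp add: C'_def)
  have taylor: "norm (\<phi> (p + h *\<^sub>R c) - \<phi> p - h *\<^sub>R D \<phi> p) \<le> C' * h\<^sup>2 * (1 + norm p) ^ N" if h: "\<bar>h\<bar>
      \<le> 1" for p h
  proof -
    have "norm (\<phi> (p + h *\<^sub>R c) - \<phi> (p + 0 *\<^sub>R c) - h *\<^sub>R D \<phi> (p + 0 *\<^sub>R c)) \<le> (C' * (1 + norm p) ^ N) * h\<^sup>2"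
    proof (rule taylor_bound_2[OF _ _ _ h])
      fix t
      show "((\<lambda>t. \<phi> (p + t *\<^sub>R c)) has_vector_derivative D \<phi> (p + t *\<^sub>R c)) (at t)"
        unfolding c_def D_def by (rule differentiable_line[OF diff[OF \<phi>]])
      show "((\<lambda>t. D \<phi> (p + t *\<^sub>R c)) has_vector_derivative
          c1 *\<^sub>R D (partial_x \<phi>) (p + t *\<^sub>R c) + c2 *\<^sub>R D (partial_y \<phi>) (p + t *\<^sub>R c)) (at t)"
        unfolding c_def D_def
        by (intro has_vector_derivative_add bounded_linear.has_vector_derivative[OF bounded_linear_scaleR_right]
            differentiable_line diff x y \<phi>)
      assume t: "\<bar>t\<bar> \<le> 1"
      have "norm (t *\<^sub>R c) \<le> norm c" using mult_right_mono[OF t, of "norm c"] by simp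
      then have "(1 + norm (t *\<^sub>R c)) ^ N \<le> (1 + norm c) ^ N" by (intro power_mono) auto
      then have "(1 + norm (t *\<^sub>R c)) ^ N * (1 + norm p) ^ N \<le> (1 + norm c) ^ N * (1 + norm p) ^ N"
        by (rule mult_right_mono) simp
      then have "(1 + norm (p + t *\<^sub>R c)) ^ N \<le> (1 + norm c) ^ N * (1 + norm p) ^ N"
        using shifted_growth[of p "t *\<^sub>R c" N] by (rule order_trans[rotated])
      then show "norm (c1 *\<^sub>R D (partial_x \<phi>) (p + t *\<^sub>R c) + c2 *\<^sub>R D (partial_y \<phi>) (p + t *\<^sub>R c))
          \<le> C' * (1 + norm p) ^ N"
        using order_trans[OF C(2) mult_left_mono[OF _ C(1)]] by (simp only: C'_def mult.assoc)
    qed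
    then show ?thesis by (simp add: mult_ac)
  qed
  obtain M where M: "0 \<le> M" "\<And>\<epsilon>. 0 < \<epsilon> \<Longrightarrow> \<epsilon> \<le> 1 \<Longrightarrow> integrable lborel (\<lambda>p. (1 + norm p) ^ N * cmod (K \<epsilon> p)) \<and>
      (LINT p|lborel. (1 + norm p) ^ N * cmod (K \<epsilon> p)) \<le> M"
    using gauss_form_fourier_moment_bound[OF ab, of N \<gamma>] unfolding K_def by blast
  let ?I = "\<lambda>\<psi> t \<epsilon>. LINT p|lborel. \<psi> (p + t *\<^sub>R c) * K \<epsilon> p"
  let ?R = "\<lambda>h \<epsilon>. ?I \<phi> h \<epsilon> - ?I \<phi> 0 \<epsilon> - h *\<^sub>R (c1 *\<^sub>R ?I (partial_x \<phi>) 0 \<epsilon> + c2 *\<^sub>R ?I (partial_y \<phi>) 0 \<epsilon>)"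
  have bound: "norm (?R h \<epsilon>) \<le> C' * h\<^sup>2 * M"
    if h: "\<bar>h\<bar> \<le> 1" and \<epsilon>: "0 < \<epsilon>" "\<epsilon> \<le> 1" for h \<epsilon>
  proof -
    have i1: "integrable lborel (\<lambda>p. \<phi> (p + h *\<^sub>R c) * K \<epsilon> p)"
      by (intro int poly_bounded_shift pb \<phi> \<epsilon> continuous_on_compose2[OF cont[OF \<phi>]] continuous_intros) auto
    have i2: "integrable lborel (\<lambda>p. \<psi> p * K \<epsilon> p)" if "\<psi> \<in> partials \<phi>" for \<psi>
      by (intro int pb cont \<epsilon> that)
    note i3 = i2[OF \<phi>] i2[OF x[OF \<phi>]] i2[OF y[OF \<phi>]]
    let ?S = "\<lambda>p. \<phi> (p + h *\<^sub>R c) * K \<epsilon> p - \<phi> p * K \<epsilon> p - h *\<^sub>R (c1 *\<^sub>R (partial_x \<phi> p * K \<epsilon> p)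
        + c2 *\<^sub>R (partial_y \<phi> p * K \<epsilon> p))"
    have "?R h \<epsilon>
        = integral\<^sup>L lborel ?S"
      using i1 i3 by simp
    also have "\<dots> = (LINT p|lborel. (\<phi> (p + h *\<^sub>R c) - \<phi> p - h *\<^sub>R D \<phi> p) * K \<epsilon> p)"
      by (simp add: D_def algebra_simps)
    also have "norm \<dots> \<le> (LINT p|lborel. C' * h\<^sup>2 * ((1 + norm p) ^ N * cmod (K \<epsilon> p)))"
    proof (rule order_trans[OF integral_norm_bound integral_mono[OF integrable_norm]])
      have "integrable lborel ?S"
        using i1 i3 by simp
      then show "integrable lborel (\<lambda>p. (\<phi> (p + h *\<^sub>R c) - \<phi> p - h *\<^sub>R D \<phi> p) * K \<epsilon> p)"
        by (simp add: D_def algebra_simps)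
      show "integrable lborel (\<lambda>p. C' * h\<^sup>2 * ((1 + norm p) ^ N * cmod (K \<epsilon> p)))"
        using M(2)[OF \<epsilon>] by (intro integrable_mult_right) blast
      show "norm ((\<phi> (p + h *\<^sub>R c) - \<phi> p - h *\<^sub>R D \<phi> p) * K \<epsilon> p)
          \<le> C' * h\<^sup>2 * ((1 + norm p) ^ N * cmod (K \<epsilon> p))" for p
        using mult_right_mono[OF taylor[OF h, of p], of "cmod (K \<epsilon> p)"] by (simp add: norm_mult mult.assoc)
    qed
    also have "\<dots> \<le> C' * h\<^sup>2 * M" using M(2)[OF \<epsilon>] C' by (simp add: mult_left_mono)
    finally show ?thesis .
  qed
  show ?thesis
  proof (rule has_vector_derivative_at_0_if_quadratic)
    fix h :: real assume h: "\<bar>h\<bar> \<le> 1"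
    have G0: "gauss_form a b \<alpha> \<beta> \<gamma> = G 0" by (simp add: G_def)
    have "((\<lambda>\<epsilon>. norm (?R h \<epsilon>))
        \<longlongrightarrow> norm (f h - f 0 - h *\<^sub>R (c1 *\<^sub>R fx + c2 *\<^sub>R fy))) (at_right 0)"
      by (intro tendsto_norm tendsto_diff tendsto_add tendsto_scaleR tendsto_const lim cont x y \<phi>
          f[folded G_def] fx[unfolded G0] fy[unfolded G0])
    then show "norm (f h - f 0 - h *\<^sub>R (c1 *\<^sub>R fx + c2 *\<^sub>R fy)) \<le> (C' * M) * h\<^sup>2"
    proof (rule tendsto_upperbound)
      show "\<forall>\<^sub>F \<epsilon> in at_right 0. norm (?R h \<epsilon>) \<le> (C' * M) * h\<^sup>2"
        unfolding eventually_at_right_field using bound[OF h] by (intro exI[of _ 1]) (simp add: mult_ac)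
    qed simp
  qed
qed

section \<open>Conjugation by Weyl operators\<close>

lemma expvec_dense: "closure (cspan (range (expvec :: 'a::{real_inner, polish_space} complexification \<Rightarrow> 'a fock))) = UNIV"
proof (rule cspan_dense_if_total)
  fix y :: "'a fock" assume "\<And>x. x \<in> range expvec \<Longrightarrow> cinner x y = 0"
  then show "y = 0" by (intro expvec_total) auto
qed

text \<open>The defining condition quantifies over cut-offs; the Gaussian shows that it is not
  vacuous and determines the limit.\<close>

lemma has_inv_fourier_integral_unique:
  assumes "has_inv_fourier_integral \<phi> G c" "has_inv_fourier_integral \<phi> G d"
  shows "c = d"
proof -
  have k: "complex_of_real (gauss_plane 0) = 1" by (simp add: gauss_plane_def)
  show ?thesis
    using assms schwartz_gauss k unfolding has_inv_fourier_integral_def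
    by (intro tendsto_unique[OF trivial_limit_at_right_real]) blast+
qed

lemma has_inv_fourier_integral_cmult:
  assumes "has_inv_fourier_integral \<phi> G c"
  shows "has_inv_fourier_integral \<phi> (\<lambda>p. d * G p) (d * c)"
proof -
  have "inv_fourier (\<lambda>p. \<kappa> (\<epsilon> *\<^sub>R p) * (d * G p)) q = d * inv_fourier (\<lambda>p. \<kappa> (\<epsilon> *\<^sub>R p) * G p) q" for \<kappa> \<epsilon> q
    unfolding inv_fourier_def by (simp add: mult.left_commute[of _ d] mult.assoc)
  then have "inv_fourier_dist \<phi> (\<lambda>p. \<kappa> (\<epsilon> *\<^sub>R p) * (d * G p))
      = d * inv_fourier_dist \<phi> (\<lambda>p. \<kappa> (\<epsilon> *\<^sub>R p) * G p)" for \<kappa> \<epsilon>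
    unfolding inv_fourier_dist_def by (simp add: mult.left_commute[of _ d])
  then show ?thesis
    using assms unfolding has_inv_fourier_integral_def by (auto intro!: tendsto_mult tendsto_const)
qed

text \<open>Matrix elements between exponential vectors determine a bounded operator, because these
  vectors are total and span a dense subspace. This gives meaning to the definite description in
  \<open>O_op\<close>.\<close>

lemma is_O_unique:
  fixes h :: "'a::{real_inner, polish_space} \<times> 'a"
  assumes "is_O h \<phi> M" "is_O h \<phi> M'" shows "M = M'"
proof (rule bounded_linear_eq_on_dense[OF _ _ expvec_dense])
  show "bounded_clinear M" "bounded_clinear M'" using assms by (auto simp: is_O_def)
  fix x :: "'a fock" assume "x \<in> range expvec"
  then obtain k where x: "x = expvec k" by blast
  have "cinner (expvec l) (M (expvec k) - M' (expvec k)) = 0" for l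
  proof -
    obtain c where c: "cinner (expvec l) (M (expvec k)) = (1 / (2 * pi)) *\<^sub>R c"
      "has_inv_fourier_integral \<phi> (\<lambda>(u, v). cinner (expvec l)
         (weyl (of_h (u *\<^sub>R fst h)) (of_h (v *\<^sub>R snd h)) (expvec k))) c"
      using assms(1) unfolding is_O_def by blast
    obtain d where d: "cinner (expvec l) (M' (expvec k)) = (1 / (2 * pi)) *\<^sub>R d"
      "has_inv_fourier_integral \<phi> (\<lambda>(u, v). cinner (expvec l)
         (weyl (of_h (u *\<^sub>R fst h)) (of_h (v *\<^sub>R snd h)) (expvec k))) d"
      using assms(2) unfolding is_O_def by blast
    show ?thesis using has_inv_fourier_integral_unique[OF c(2) d(2)] c(1) d(1)
        by (simp add: cinner.diff_right)
  qed
  then show "M x = M' x" unfolding x using expvec_total[of "M (expvec k) - M' (expvec k)"] by simp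
qed

section \<open>Operators of smooth symbols\<close>

lemma is_O_O_op:
  assumes "\<phi> \<in> Dom_O h" shows "is_O h \<phi> (O_op h \<phi>)"
proof -
  obtain M where "is_O h \<phi> M" using assms by (auto simp: Dom_O_def)
  then show ?thesis unfolding O_op_def using is_O_unique by (intro theI[of "is_O h \<phi>"]) blast+
qed

lemma smooth_symbols_Dom: "\<phi> \<in> smooth_symbols h \<Longrightarrow> \<phi> \<in> Dom_O h"
  unfolding smooth_symbols_def using partials.intros(1) by blast

lemma smooth_symbols_partials:
  assumes "\<phi> \<in> smooth_symbols h" "\<psi> \<in> partials \<phi>" shows "\<psi> \<in> smooth_symbols h"
  using assms partials_trans[OF _ assms(2)] unfolding smooth_symbols_def C_infinity_def by blast

lemma smooth_symbols_x: "\<phi> \<in> smooth_symbols h \<Longrightarrow> partial_x \<phi> \<in> smooth_symbols h"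
  by (rule smooth_symbols_partials) (auto intro: partials.intros)

lemma smooth_symbols_y: "\<phi> \<in> smooth_symbols h \<Longrightarrow> partial_y \<phi> \<in> smooth_symbols h"
  by (rule smooth_symbols_partials) (auto intro: partials.intros)

text \<open>Temperedness is part of \<open>has_inv_fourier_integral\<close>, so membership of all
  partial derivatives in \<open>Dom_O\<close> supplies it.\<close>

lemma smooth_symbols_tempered:
  assumes "\<phi> \<in> smooth_symbols h" "\<psi> \<in> partials \<phi>" shows "tempered \<psi>"
proof -
  have "is_O h \<psi> (O_op h \<psi>)"
    by (rule is_O_O_op[OF smooth_symbols_Dom[OF smooth_symbols_partials[OF assms]]])
  then show ?thesis unfolding is_O_def has_inv_fourier_integral_def by blast
qed

lemma bounded_clinear_O_op: "\<phi> \<in> smooth_symbols h \<Longrightarrow> bounded_clinear (O_op h \<phi>)"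
  using is_O_O_op[OF smooth_symbols_Dom] unfolding is_O_def by blast

text \<open>\<open>weyl_alpha\<close> and \<open>weyl_beta\<close> are the coefficients of u and v
  in the exponent of the matrix element of U(u h_1, v h_2) between \<open>expvec k\<close> and
  \<open>expvec l\<close>.\<close>

definition weyl_alpha :: "'a::real_inner \<times> 'a \<Rightarrow> 'a complexification \<Rightarrow> 'a complexification \<Rightarrow> complex" where
  "weyl_alpha h k l = hinner k (of_h (fst h)) - hinner (of_h (fst h)) l"

definition weyl_beta :: "'a::real_inner \<times> 'a \<Rightarrow> 'a complexification \<Rightarrow> 'a complexification \<Rightarrow> complex" where
  "weyl_beta h k l = \<i> * (hinner k (of_h (snd h)) + hinner (of_h (snd h)) l)"

text \<open>The parameters s and t are the frequencies of the character of (u, v) contributed by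
  conjugation with a Weyl operator.\<close>

definition weyl_symbol :: "'a::real_inner \<times> 'a \<Rightarrow> 'a complexification \<Rightarrow> 'a complexification \<Rightarrow>
    real \<Rightarrow> real \<Rightarrow> real \<times> real \<Rightarrow> complex" where
  "weyl_symbol h k l s t = gauss_form ((norm (fst h))\<^sup>2) ((norm (snd h))\<^sup>2)
    (weyl_alpha h k l + \<i> * of_real s) (weyl_beta h k l + \<i> * of_real t) (hinner k l)"

lemma weyl_matrix_element:
  "(\<lambda>(u, v). cinner (expvec k) (weyl (of_h (u *\<^sub>R fst h)) (of_h (v *\<^sub>R snd h)) (expvec l)))
    = weyl_symbol h k l 0 0"
proof (rule ext, clarify)
  fix u v :: real
  define z where "z = Cpx (u *\<^sub>R fst h) (v *\<^sub>R snd h)"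
  have zz: "hinner z z = of_real ((norm (fst h))\<^sup>2 * u\<^sup>2 + (norm (snd h))\<^sup>2 * v\<^sup>2)"
    unfolding hinner_self z_def by (simp add: power_mult_distrib)
  have zl: "hinner z l = of_real u * hinner (of_h (fst h)) l - \<i> * of_real v * hinner (of_h (snd h)) l"
    by (simp add: z_def hinner_def of_h_def complex_eq_iff)
  have kz: "hinner k z = of_real u * hinner k (of_h (fst h)) + \<i> * of_real v * hinner k (of_h (snd h))"
    by (simp add: z_def hinner_def of_h_def complex_eq_iff)
  have "cinner (expvec k) (weyl (of_h (u *\<^sub>R fst h)) (of_h (v *\<^sub>R snd h)) (expvec l))
      = exp (- (hinner z z / 2) - hinner z l) * exp (hinner k l + hinner k z)"
    by (simp add: weyl_expvec z_def[symmetric] weyl_vec_def weyl_factor_def cinner_scaleC_right cinner_expvec hinner_shift_right)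
  also have "\<dots> = weyl_symbol h k l 0 0 (u, v)"
    unfolding weyl_symbol_def gauss_form_def weyl_alpha_def weyl_beta_def exp_add[symmetric] zz zl kz
    by (simp add: algebra_simps add_divide_distrib)
  finally show "cinner (expvec k) (weyl (of_h (u *\<^sub>R fst h)) (of_h (v *\<^sub>R snd h)) (expvec l))
      = weyl_symbol h k l 0 0 (u, v)" .
qed

text \<open>\<open>symplectic_x\<close> and \<open>symplectic_y\<close> are 2 Im <z, h_1> and 2 Im
  <z, i h_2>, the phases in the Weyl commutation relation.\<close>

definition symplectic_x :: "'a::real_inner complexification \<Rightarrow> 'a \<times> 'a \<Rightarrow> real" where
  "symplectic_x z h = - 2 * inner (hIm z) (fst h)"

definition symplectic_y :: "'a::real_inner complexification \<Rightarrow> 'a \<times> 'a \<Rightarrow> real" where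
  "symplectic_y z h = 2 * inner (hRe z) (snd h)"

text \<open>Conjugating by the Weyl operator with argument \<open>t z\<close> multiplies the Weyl operator with
  argument \<open>(u h\<^sub>1, v h\<^sub>2)\<close> by a character of \<open>(u, v)\<close>.\<close>

lemma is_O_weyl_vec:
  assumes "is_O h \<phi> M"
  shows "has_inv_fourier_integral \<phi> (weyl_symbol h k l (t * symplectic_x z h) (t * symplectic_y z h))
    (of_real (2 * pi) * cinner (weyl_vec z t k) (M (weyl_vec z t l)))"
proof -
  let ?k = "shift_h z t k" and ?l = "shift_h z t l"
  define d where "d = cnj (weyl_factor z k (of_real t)) * weyl_factor z l (of_real t)"
  have M: "bounded_clinear M" using assms by (simp add: is_O_def)
  obtain c where c: "cinner (expvec ?k) (M (expvec ?l)) = (1 / (2 * pi)) *\<^sub>R c"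
    "has_inv_fourier_integral \<phi> (weyl_symbol h ?k ?l 0 0) c"
    using assms unfolding is_O_def weyl_matrix_element by blast
  have d: "d = exp (- ((of_real t)\<^sup>2 * hinner z z) - of_real t * hinner k z - of_real t * hinner z l)"
    unfolding d_def weyl_factor_def exp_cnj exp_add[symmetric] by (simp add: hinner_cnj algebra_simps)
  have g: "hinner ?k ?l = hinner k l + of_real t * hinner z l + of_real t * hinner k z
      + (of_real t)\<^sup>2 * hinner z z"
    unfolding hinner_shift_left hinner_shift_right by (simp add: algebra_simps power2_eq_square)
  \<comment> \<open>Shifting k and l by the same vector changes the linear coefficient by a purely
    imaginary amount, which is why a character arises.\<close>
  have al: "weyl_alpha h ?k ?l = weyl_alpha h k l + \<i> * of_real (t * symplectic_x z h)"
    unfolding weyl_alpha_def hinner_shift_left hinner_shift_right symplectic_x_def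
    by (simp add: hinner_def of_h_def complex_eq_iff algebra_simps inner_commute)
  have be: "weyl_beta h ?k ?l = weyl_beta h k l + \<i> * of_real (t * symplectic_y z h)"
    unfolding weyl_beta_def hinner_shift_left hinner_shift_right symplectic_y_def
    by (simp add: hinner_def of_h_def complex_eq_iff algebra_simps inner_commute)
  have "d * weyl_symbol h ?k ?l 0 0 p = weyl_symbol h k l (t * symplectic_x z h) (t * symplectic_y z h) p" for p
    unfolding weyl_symbol_def al be gauss_form_def d g exp_add[symmetric] by (simp add: algebra_simps)
  then have "has_inv_fourier_integral \<phi> (weyl_symbol h k l (t * symplectic_x z h) (t * symplectic_y z h)) (d * c)"
    using has_inv_fourier_integral_cmult[OF c(2), of d] by simp
  also have "d * c = of_real (2 * pi) * cinner (weyl_vec z t k) (M (weyl_vec z t l))"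
    unfolding weyl_vec_def bounded_clinearD(4)[OF M] cinner_scaleC_left cinner_scaleC_right c(1) d_def
    by (simp add: scaleR_conv_of_real)
  finally show ?thesis .
qed

text \<open>The closed formula on exponential vectors is extended isometrically to the whole space,
  which avoids convergence questions for the operator series on other vectors.\<close>

definition weyl_unitary :: "'a::{real_inner, polish_space} complexification \<Rightarrow> real \<Rightarrow> 'a fock \<Rightarrow> 'a fock" where
  "weyl_unitary z t = (SOME W. bounded_clinear W \<and> (\<forall>x y. cinner (W x) (W y) = cinner x y) \<and>
     (\<forall>k. W (expvec k) = weyl_vec z t k))"

lemma weyl_unitary:
  "bounded_clinear (weyl_unitary z t)" "cinner (weyl_unitary z t x) (weyl_unitary z t y) = cinner x y"
  "weyl_unitary z t (expvec k) = weyl_vec z t k"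
proof -
  have "cinner (weyl_vec z t k) (weyl_vec z t l) = cinner (expvec k) (expvec l)" for k l
    by (simp add: cinner_weyl_vec cinner_expvec)
  from isometric_extension[OF this expvec_dense]
  obtain W where "bounded_clinear W" "\<And>x y. cinner (W x) (W y) = cinner x y" "\<And>k. W (expvec k)
      = weyl_vec z t k"
    by blast
  then have "\<exists>W. bounded_clinear W \<and> (\<forall>x y. cinner (W x) (W y) = cinner x y)
      \<and> (\<forall>k. W (expvec k) = weyl_vec z t k)"
    by blast
  from someI_ex[OF this] show "bounded_clinear (weyl_unitary z t)"
    "cinner (weyl_unitary z t x) (weyl_unitary z t y) = cinner x y" "weyl_unitary z t (expvec k)
        = weyl_vec z t k"
    unfolding weyl_unitary_def by blast+
qed

lemma norm_weyl_unitary: "norm (weyl_unitary z t x) = norm x"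
  using weyl_unitary(2)[of z t x x] unfolding cinner_self of_real_eq_iff by simp

lemma weyl_unitary_inverse:
  fixes z :: "'a::{real_inner, polish_space} complexification"
  shows "weyl_unitary z (- t) (weyl_unitary z t x) = x"
proof -
  have "(\<lambda>x. weyl_unitary z (- t) (weyl_unitary z t x)) = (\<lambda>x. x)"
  proof (rule bounded_linear_eq_on_dense[OF _ _ expvec_dense])
    show "bounded_clinear (\<lambda>x. weyl_unitary z (- t) (weyl_unitary z t x))"
      by (rule bounded_clinear_compose) (rule weyl_unitary(1))+
    show "bounded_clinear (\<lambda>x :: 'a fock. x)" by (simp add: bounded_clinear_def bounded_linear_ident)
    fix x :: "'a fock" assume "x \<in> range expvec"
    then obtain k where x: "x = expvec k" by blast
    have "weyl_unitary z (- t) (weyl_vec z t k) = weyl_factor z k (of_real t) *\<^sub>C weyl_vec z (- t) (shift_h z t k)"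
      unfolding weyl_vec_def[of z t k] bounded_clinearD(4)[OF weyl_unitary(1)] weyl_unitary(3) ..
    then show "weyl_unitary z (- t) (weyl_unitary z t x) = x"
        by (simp add: x weyl_unitary(3) weyl_vec_inverse)
  qed
  then show ?thesis by (rule fun_cong)
qed

lemma weyl_unitary_adjoint: "cinner x (weyl_unitary z (- t) y) = cinner (weyl_unitary z t x) y"
  using weyl_unitary(2)[of z t x "weyl_unitary z (- t) y"] weyl_unitary_inverse[of z "- t" y] by simp

lemma weyl_unitary_0:
  fixes z :: "'a::{real_inner, polish_space} complexification"
  shows "weyl_unitary z 0 = (\<lambda>x. x)"
proof (rule bounded_linear_eq_on_dense[OF _ _ expvec_dense])
  show "bounded_clinear (weyl_unitary z 0)" by (rule weyl_unitary(1))
  show "bounded_clinear (\<lambda>x :: 'a fock. x)" by (simp add: bounded_clinear_def bounded_linear_ident)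
  fix x :: "'a fock" assume "x \<in> range expvec"
  then show "weyl_unitary z 0 x = x"
    by (auto simp: weyl_unitary(3) weyl_vec_def weyl_factor_def shift_h_def)
qed

definition weyl_derivation :: "'a::{real_inner, polish_space} complexification \<Rightarrow> ('a fock \<Rightarrow> 'a fock) \<Rightarrow>
    ('a fock \<Rightarrow> 'a fock) \<Rightarrow> bool" where
  "weyl_derivation z A B \<longleftrightarrow> bounded_clinear A \<and> bounded_clinear B \<and> (\<exists>C\<ge>0. \<forall>t \<psi>. \<bar>t\<bar> \<le> 1 \<longrightarrow>
     norm (weyl_unitary z (- t) (A (weyl_unitary z t \<psi>)) - A \<psi> - t *\<^sub>R B \<psi>) \<le> C * t\<^sup>2 * norm \<psi>)"

text \<open>The operator belonging to the derivative of the symbol in the direction in which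
  conjugation translates it.\<close>

definition O_deriv :: "'a::{real_inner, polish_space} complexification \<Rightarrow> 'a \<times> 'a \<Rightarrow> (real \<times> real \<Rightarrow>
    complex) \<Rightarrow> 'a fock \<Rightarrow> 'a fock" where
  "O_deriv z h \<phi> \<psi> = symplectic_x z h *\<^sub>R O_op h (partial_x \<phi>) \<psi>
      + symplectic_y z h *\<^sub>R O_op h (partial_y \<phi>) \<psi>"

section \<open>Infinitesimal conjugation of the generators\<close>

lemma bounded_clinear_scaleR: "bounded_clinear f \<Longrightarrow> bounded_clinear (\<lambda>x. r *\<^sub>R f x)"
  unfolding scaleR_scaleC by (rule bounded_clinear_compose[OF bounded_clinear_scaleC])

lemma bounded_clinear_O_deriv: "\<phi> \<in> smooth_symbols h \<Longrightarrow> bounded_clinear (O_deriv z h \<phi>)"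
  unfolding O_deriv_def[abs_def]
  by (intro bounded_clinear_add bounded_clinear_scaleR bounded_clinear_O_op smooth_symbols_x smooth_symbols_y)

lemma O_op_matrix_derivative:
  assumes \<phi>: "\<phi> \<in> smooth_symbols h"
  shows "((\<lambda>t. cinner (weyl_vec z t k) (O_op h \<phi> (weyl_vec z t l))) has_vector_derivative
    cinner (weyl_vec z t k) (O_deriv z h \<phi> (weyl_vec z t l))) (at t)"
proof -
  note O = is_O_O_op[OF smooth_symbols_Dom]
  let ?c = "of_real (2 * pi) :: complex"
  let ?m = "\<lambda>\<phi> t. cinner (weyl_vec z t k) (O_op h \<phi> (weyl_vec z t l))"
  \<comment> \<open>Putting the frequencies accumulated up to time t into the linear coefficients
    reduces differentiation at t to differentiation at 0.\<close>
  let ?al = "weyl_alpha h k l + \<i> * of_real (t * symplectic_x z h)"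
  let ?be = "weyl_beta h k l + \<i> * of_real (t * symplectic_y z h)"
  have "((\<lambda>s. ?c * ?m \<phi> (t + s)) has_vector_derivative
      symplectic_x z h *\<^sub>R (?c * ?m (partial_x \<phi>) t) + symplectic_y z h *\<^sub>R (?c * ?m (partial_y \<phi>) t)) (at 0)"
  proof (rule inv_fourier_integral_derivative)
    show "C_infinity \<phi>" using \<phi> by (simp add: smooth_symbols_def)
    show "tempered \<psi>" if "\<psi> \<in> partials \<phi>" for \<psi> by (rule smooth_symbols_tempered[OF \<phi> that])
    \<comment> \<open>In a degenerate direction the linear coefficient has no real part, which keeps
      the moments bounded as the cut-off is removed; the same holds for the second component
      below.\<close>
    show "(norm (fst h))\<^sup>2 = 0 \<longrightarrow> Re ?al = 0"
      by (simp add: weyl_alpha_def hinner_def of_h_def)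
    show "(norm (snd h))\<^sup>2 = 0 \<longrightarrow> Re ?be = 0"
      by (simp add: weyl_beta_def hinner_def of_h_def)
    show "has_inv_fourier_integral \<phi> (gauss_form ((norm (fst h))\<^sup>2) ((norm (snd h))\<^sup>2)
       (?al + \<i> * of_real (s * symplectic_x z h)) (?be + \<i> * of_real (s * symplectic_y z h)) (hinner k l)) (?c * ?m \<phi> (t + s))" for s
      using is_O_weyl_vec[OF O[OF \<phi>], of k l "t + s" z] by (simp add: weyl_symbol_def algebra_simps)
    show "has_inv_fourier_integral (partial_x \<phi>) (gauss_form ((norm (fst h))\<^sup>2) ((norm (snd h))\<^sup>2) ?al ?be (hinner k l)) (?c * ?m (partial_x \<phi>) t)"
      using is_O_weyl_vec[OF O[OF smooth_symbols_x[OF \<phi>]]] by (simp only: weyl_symbol_def)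
    show "has_inv_fourier_integral (partial_y \<phi>) (gauss_form ((norm (fst h))\<^sup>2) ((norm (snd h))\<^sup>2) ?al ?be (hinner k l)) (?c * ?m (partial_y \<phi>) t)"
      using is_O_weyl_vec[OF O[OF smooth_symbols_y[OF \<phi>]]] by (simp only: weyl_symbol_def)
  qed auto
  then have "((\<lambda>s. ?c * ?m \<phi> (t + s)) has_vector_derivative ?c * cinner (weyl_vec z t k) (O_deriv z h \<phi> (weyl_vec z t l))) (at 0)"
    by (simp add: O_deriv_def cinner.add_right cinner.scaleR_right distrib_left)
  then have "((\<lambda>s. inverse ?c * (?c * ?m \<phi> (t + s))) has_vector_derivative
      inverse ?c * (?c * cinner (weyl_vec z t k) (O_deriv z h \<phi> (weyl_vec z t l)))) (at 0)"
    by (rule has_vector_derivative_mult_right)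
  moreover have "inverse ?c * (?c * x) = x" for x by simp
  ultimately have "((\<lambda>s. ?m \<phi> (t + s)) has_vector_derivative cinner (weyl_vec z t k) (O_deriv z h \<phi> (weyl_vec z t l))) (at 0)"
    by (simp only:)
  then have "(((\<lambda>s. ?m \<phi> (t + s)) \<circ> (\<lambda>s. s - t)) has_vector_derivative
      1 *\<^sub>R cinner (weyl_vec z t k) (O_deriv z h \<phi> (weyl_vec z t l))) (at t)"
    by (intro vector_diff_chain_at) (auto intro!: derivative_eq_intros)
  then show ?thesis by (simp add: o_def)
qed

lemma O_op_form_derivative:
  assumes \<phi>: "\<phi> \<in> smooth_symbols h"
    and x: "x \<in> cspan (range expvec)" and y: "y \<in> cspan (range expvec)"
  shows "((\<lambda>t. cinner (weyl_unitary z t x) (O_op h \<phi> (weyl_unitary z t y))) has_vector_derivative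
    cinner (weyl_unitary z t x) (O_deriv z h \<phi> (weyl_unitary z t y))) (at t)"
  using x
proof (induction rule: cspan_induct)
  case zero
  show ?case by (simp add: bounded_clinearD(3)[OF weyl_unitary(1)] cinner.zero_left)
next
  case (add c u x)
  then obtain k where u: "u = expvec k" by blast
  have "((\<lambda>t. cinner (weyl_unitary z t u) (O_op h \<phi> (weyl_unitary z t y))) has_vector_derivative
    cinner (weyl_unitary z t u) (O_deriv z h \<phi> (weyl_unitary z t y))) (at t)"
    using y
  proof (induction rule: cspan_induct)
    case zero
    show ?case
      by (simp add: bounded_clinearD(3)[OF weyl_unitary(1)] bounded_clinearD(3)[OF bounded_clinear_O_op[OF \<phi>]]
          bounded_clinearD(3)[OF bounded_clinear_O_deriv[OF \<phi>]] cinner.zero_right)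
  next
    case (add d v y)
    then obtain l where v: "v = expvec l" by blast
    note lin = bounded_clinearD[OF weyl_unitary(1)] bounded_clinearD[OF bounded_clinear_O_op[OF \<phi>]]
      bounded_clinearD[OF bounded_clinear_O_deriv[OF \<phi>]]
    show ?case
      unfolding lin cinner.add_right cinner_scaleC_right
      by (intro has_vector_derivative_add has_vector_derivative_mult_right add.IH)
        (simp only: u v weyl_unitary(3) O_op_matrix_derivative[OF \<phi>])
  qed
  then show ?case
    unfolding bounded_clinearD[OF weyl_unitary(1)] cinner.add_left cinner_scaleC_left
    by (intro has_vector_derivative_add has_vector_derivative_mult_right add.IH)
qed

text \<open>Approximating T y itself by test vectors x gives |T y|^2 \<le> K |T y| |y|.\<close>

lemma norm_le_if_form_le_on_dense:
  fixes T :: "'a::complex_inner \<Rightarrow> 'a"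
  assumes T: "bounded_clinear T" and V: "closure V = UNIV" and K: "0 \<le> K"
    and le: "\<And>x y. x \<in> V \<Longrightarrow> y \<in> V \<Longrightarrow> cmod (cinner x (T y)) \<le> K * norm x * norm y"
  shows "norm (T y) \<le> K * norm y"
proof -
  obtain X where X: "\<And>n. X n \<in> V" "X \<longlonglongrightarrow> T y" using V closure_sequential[of "T y" V] by auto
  obtain Y where Y: "\<And>n. Y n \<in> V" "Y \<longlonglongrightarrow> y" using V closure_sequential[of y V] by auto
  have TY: "(\<lambda>n. T (Y n)) \<longlonglongrightarrow> T y"
    using T Y(2) unfolding bounded_clinear_def by (blast intro: bounded_linear.tendsto)
  have "cmod (cinner (T y) (T y)) \<le> K * norm (T y) * norm y"
  proof (rule LIMSEQ_le)
    show "(\<lambda>n. cmod (cinner (X n) (T (Y n)))) \<longlonglongrightarrow> cmod (cinner (T y) (T y))"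
      by (intro tendsto_norm cinner.tendsto X(2) TY)
    show "(\<lambda>n. K * norm (X n) * norm (Y n)) \<longlonglongrightarrow> K * norm (T y) * norm y"
      by (intro tendsto_intros X(2) Y(2))
    show "\<exists>N. \<forall>n\<ge>N. cmod (cinner (X n) (T (Y n))) \<le> K * norm (X n) * norm (Y n)"
      using le[OF X(1) Y(1)] by blast
  qed
  then have "norm (T y) * norm (T y) \<le> norm (T y) * (K * norm y)"
    by (simp add: cinner_self norm_power power2_eq_square mult_ac norm_mult)
  then show ?thesis using K by (cases "T y = 0") (auto simp: mult_le_cancel_left_pos)
qed

text \<open>On the span of exponential vectors the form of the conjugated operator is twice
  differentiable, and its second derivative is the form of one bounded operator evaluated at vectors
  of unchanged norm. Taylor's estimate holds for the forms, and density lifts it to the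
  norm.\<close>

lemma weyl_derivation_O_op:
  assumes \<phi>: "\<phi> \<in> smooth_symbols h"
  shows "weyl_derivation z (O_op h \<phi>) (O_deriv z h \<phi>)"
  unfolding weyl_derivation_def
proof (intro conjI)
  let ?A = "O_op h \<phi>" and ?A' = "O_deriv z h \<phi>" and ?W = "weyl_unitary z"
  \<comment> \<open>Built from second-order partial derivatives of the symbol; these give bounded
    operators because \<open>smooth_symbols\<close> is closed under partial derivatives.\<close>
  let ?A'' = "\<lambda>\<psi>. symplectic_x z h *\<^sub>R O_deriv z h (partial_x \<phi>) \<psi>
      + symplectic_y z h *\<^sub>R O_deriv z h (partial_y \<phi>) \<psi>"
  show A: "bounded_clinear ?A" by (rule bounded_clinear_O_op[OF \<phi>])
  show A': "bounded_clinear ?A'" by (rule bounded_clinear_O_deriv[OF \<phi>])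
  have "bounded_clinear ?A''"
    by (intro bounded_clinear_add bounded_clinear_scaleR bounded_clinear_O_deriv smooth_symbols_x smooth_symbols_y \<phi>)
  then obtain K where K: "0 \<le> K" "\<And>\<psi>. norm (?A'' \<psi>) \<le> K * norm \<psi>"
    using bounded_clinear_bound by blast
  have form: "cmod (cinner x (?W (- t) (?A (?W t y)) - ?A y - t *\<^sub>R ?A' y)) \<le> (K * t\<^sup>2) * norm x * norm y"
    if x: "x \<in> cspan (range expvec)" and y: "y \<in> cspan (range expvec)" and t: "\<bar>t\<bar> \<le> 1" for x y t
  proof -
    let ?f = "\<lambda>B t. cinner (?W t x) (B (?W t y))"
    have "norm (?f ?A t - ?f ?A 0 - t *\<^sub>R ?f ?A' 0) \<le> (K * norm x * norm y) * t\<^sup>2"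
    proof (rule taylor_bound_2[OF _ _ _ t])
      fix s
      show "(?f ?A has_vector_derivative ?f ?A' s) (at s)" by (rule O_op_form_derivative[OF \<phi> x y])
      show "(?f ?A' has_vector_derivative ?f ?A'' s) (at s)"
        unfolding O_deriv_def[of z h \<phi>] cinner.add_right cinner.scaleR_right
        by (intro has_vector_derivative_add bounded_linear.has_vector_derivative[OF bounded_linear_scaleR_right]
            O_op_form_derivative smooth_symbols_x smooth_symbols_y \<phi> x y)
      have "cmod (?f ?A'' s) \<le> norm (?W s x) * norm (?A'' (?W s y))" by (rule norm_cinner_le)
      also have "\<dots> \<le> norm x * (K * norm y)"
        using K(2)[of "?W s y"] unfolding norm_weyl_unitary by (rule mult_left_mono) simp
      finally show "cmod (?f ?A'' s) \<le> K * norm x * norm y" by (simp only: mult_ac)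
    qed
    then show ?thesis
      by (simp add: weyl_unitary_0 cinner.diff_right cinner.scaleR_right weyl_unitary_adjoint mult_ac)
  qed
  have "norm (?W (- t) (?A (?W t y)) - ?A y - t *\<^sub>R ?A' y) \<le> (K * t\<^sup>2) * norm y" if t: "\<bar>t\<bar> \<le> 1" for t y
  proof (rule norm_le_if_form_le_on_dense[OF _ expvec_dense])
    have "bounded_clinear (\<lambda>y. ?W (- t) (?A (?W t y)) + (- 1) *\<^sub>R ?A y + (- t) *\<^sub>R ?A' y)"
      by (intro bounded_clinear_add bounded_clinear_scaleR A A' bounded_clinear_compose[OF weyl_unitary(1)]
          bounded_clinear_compose[OF A] weyl_unitary(1))
    then show "bounded_clinear (\<lambda>y. ?W (- t) (?A (?W t y)) - ?A y - t *\<^sub>R ?A' y)" by simp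
  qed (use K(1) form[OF _ _ t] in auto)
  then show "\<exists>C\<ge>0. \<forall>t \<psi>. \<bar>t\<bar> \<le> 1 \<longrightarrow> norm (?W (- t) (?A (?W t \<psi>)) - ?A \<psi> - t *\<^sub>R ?A' \<psi>) \<le> C * t\<^sup>2 * norm \<psi>"
    using K(1) by blast
qed

section \<open>Sums, multiples and products\<close>

lemma weyl_derivation_add:
  assumes "weyl_derivation z A A'" "weyl_derivation z B B'"
  shows "weyl_derivation z (\<lambda>\<psi>. A \<psi> + B \<psi>) (\<lambda>\<psi>. A' \<psi> + B' \<psi>)"
proof -
  let ?W = "weyl_unitary z"
  obtain C D where C: "0 \<le> C" "\<And>t \<psi>. \<bar>t\<bar> \<le> 1 \<Longrightarrow> norm (?W (- t) (A (?W t \<psi>)) - A \<psi> - t *\<^sub>R A' \<psi>)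
      \<le> C * t\<^sup>2 * norm \<psi>"
    and D: "0 \<le> D" "\<And>t \<psi>. \<bar>t\<bar> \<le> 1 \<Longrightarrow> norm (?W (- t) (B (?W t \<psi>)) - B \<psi> - t *\<^sub>R B' \<psi>) \<le> D * t\<^sup>2 * norm \<psi>"
    using assms unfolding weyl_derivation_def by blast
  have "norm (?W (- t) (A (?W t \<psi>) + B (?W t \<psi>)) - (A \<psi> + B \<psi>) - t *\<^sub>R (A' \<psi> + B' \<psi>))
      \<le> (C + D) * t\<^sup>2 * norm \<psi>"
    if t: "\<bar>t\<bar> \<le> 1" for t \<psi>
  proof -
    have "?W (- t) (A (?W t \<psi>) + B (?W t \<psi>)) - (A \<psi> + B \<psi>) - t *\<^sub>R (A' \<psi> + B' \<psi>)
        = (?W (- t) (A (?W t \<psi>)) - A \<psi> - t *\<^sub>R A' \<psi>) + (?W (- t) (B (?W t \<psi>)) - B \<psi> - t *\<^sub>R B' \<psi>)"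
      by (simp add: bounded_clinearD(1)[OF weyl_unitary(1)] algebra_simps)
    also have "norm \<dots> \<le> C * t\<^sup>2 * norm \<psi> + D * t\<^sup>2 * norm \<psi>"
      by (rule norm_triangle_mono[OF C(2)[OF t] D(2)[OF t]])
    finally show ?thesis by (simp add: distrib_right)
  qed
  moreover have "0 \<le> C + D" using C(1) D(1) by simp
  ultimately show ?thesis
    using assms unfolding weyl_derivation_def by (blast intro: bounded_clinear_add)
qed

lemma weyl_derivation_scaleC:
  assumes "weyl_derivation z A A'"
  shows "weyl_derivation z (\<lambda>\<psi>. c *\<^sub>C A \<psi>) (\<lambda>\<psi>. c *\<^sub>C A' \<psi>)"
proof -
  let ?W = "weyl_unitary z"
  obtain C where C: "0 \<le> C" "\<And>t \<psi>. \<bar>t\<bar> \<le> 1 \<Longrightarrow> norm (?W (- t) (A (?W t \<psi>)) - A \<psi> - t *\<^sub>R A' \<psi>)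
      \<le> C * t\<^sup>2 * norm \<psi>"
    using assms unfolding weyl_derivation_def by blast
  have "norm (?W (- t) (c *\<^sub>C A (?W t \<psi>)) - c *\<^sub>C A \<psi> - t *\<^sub>R (c *\<^sub>C A' \<psi>)) \<le> (cmod c * C) * t\<^sup>2 * norm \<psi>"
    if t: "\<bar>t\<bar> \<le> 1" for t \<psi>
  proof -
    have "?W (- t) (c *\<^sub>C A (?W t \<psi>)) - c *\<^sub>C A \<psi> - t *\<^sub>R (c *\<^sub>C A' \<psi>)
        = c *\<^sub>C (?W (- t) (A (?W t \<psi>)) - A \<psi> - t *\<^sub>R A' \<psi>)"
      unfolding bounded_clinearD(4)[OF weyl_unitary(1)] scaleC_diff_right scaleR_scaleC
      by (simp only: scaleC_commute[of c])
    then show ?thesis using mult_left_mono[OF C(2)[OF t], of "cmod c"] by (simp add: norm_scaleC mult.assoc)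
  qed
  moreover have "0 \<le> cmod c * C" using C(1) by simp
  ultimately show ?thesis
    using assms unfolding weyl_derivation_def
    by (blast intro: bounded_clinear_compose[OF bounded_clinear_scaleC])
qed

text \<open>Conjugation is multiplicative: W_{-t} A B W_t is the product of W_{-t} A W_t and W_{-t}
  B W_t. Expanding both factors to first order leaves terms of order t^2.\<close>

lemma weyl_derivation_compose:
  assumes AA: "weyl_derivation z A A'" and BB: "weyl_derivation z B B'"
  shows "weyl_derivation z (\<lambda>\<psi>. A (B \<psi>)) (\<lambda>\<psi>. A' (B \<psi>) + A (B' \<psi>))"
proof -
  let ?W = "weyl_unitary z"
  have lin: "bounded_clinear A" "bounded_clinear A'" "bounded_clinear B" "bounded_clinear B'"
    using assms by (auto simp: weyl_derivation_def)
  obtain C D where C: "0 \<le> C" "\<And>t \<psi>. \<bar>t\<bar> \<le> 1 \<Longrightarrow> norm (?W (- t) (A (?W t \<psi>)) - A \<psi> - t *\<^sub>R A' \<psi>)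
      \<le> C * t\<^sup>2 * norm \<psi>"
    and D: "0 \<le> D" "\<And>t \<psi>. \<bar>t\<bar> \<le> 1 \<Longrightarrow> norm (?W (- t) (B (?W t \<psi>)) - B \<psi> - t *\<^sub>R B' \<psi>) \<le> D * t\<^sup>2 * norm \<psi>"
    using assms unfolding weyl_derivation_def by blast
  obtain a where a: "0 \<le> a" "\<And>\<psi>. norm (A \<psi>) \<le> a * norm \<psi>" using bounded_clinear_bound[OF lin(1)] by blast
  obtain a' where a': "0 \<le> a'" "\<And>\<psi>. norm (A' \<psi>) \<le> a' * norm \<psi>" using bounded_clinear_bound[OF lin(2)] by blast
  obtain b where b: "0 \<le> b" "\<And>\<psi>. norm (B \<psi>) \<le> b * norm \<psi>" using bounded_clinear_bound[OF lin(3)] by blast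
  obtain b' where b': "0 \<le> b'" "\<And>\<psi>. norm (B' \<psi>) \<le> b' * norm \<psi>" using bounded_clinear_bound[OF lin(4)] by blast
  have "norm (?W (- t) (A (B (?W t \<psi>))) - A (B \<psi>) - t *\<^sub>R (A' (B \<psi>) + A (B' \<psi>)))
      \<le> (C * b + a * D + a' * (D + b')) * t\<^sup>2 * norm \<psi>"
    if t: "\<bar>t\<bar> \<le> 1" for t \<psi>
  proof -
    define Bt where "Bt = ?W (- t) (B (?W t \<psi>))"
    have WB: "?W t Bt = B (?W t \<psi>)" unfolding Bt_def using weyl_unitary_inverse[of z "- t"] by simp
    have t2: "t\<^sup>2 \<le> \<bar>t\<bar>" using mult_right_mono[OF t abs_ge_zero[of t]] by (simp add: power2_eq_square)
    have nBt: "norm Bt \<le> b * norm \<psi>"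
      using b(2)[of "?W t \<psi>"] by (simp add: Bt_def norm_weyl_unitary)
    \<comment> \<open>X and Y are the remainders of the two factors. Z is the cross term, of second
      order because \<open>Bt - B \<psi>\<close> is of first order.\<close>
    let ?X = "?W (- t) (A (?W t Bt)) - A Bt - t *\<^sub>R A' Bt"
    let ?Y = "Bt - B \<psi> - t *\<^sub>R B' \<psi>"
    let ?Z = "t *\<^sub>R A' (Bt - B \<psi>)"
    have "?W (- t) (A (B (?W t \<psi>))) - A (B \<psi>) - t *\<^sub>R (A' (B \<psi>) + A (B' \<psi>)) = ?X + A ?Y + ?Z"
      unfolding WB bounded_clinearD[OF lin(1)] bounded_clinearD[OF lin(2)] by (simp add: algebra_simps)
    also have "norm \<dots> \<le> C * t\<^sup>2 * (b * norm \<psi>) + a * (D * t\<^sup>2 * norm \<psi>) + a' * ((D + b') * t\<^sup>2 * norm \<psi>)"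
    proof (intro norm_triangle_mono)
      show "norm ?X \<le> C * t\<^sup>2 * (b * norm \<psi>)"
        using order_trans[OF C(2)[OF t, of Bt] mult_left_mono[OF nBt, of "C * t\<^sup>2"]] C(1) by simp
      have Y: "norm ?Y \<le> D * t\<^sup>2 * norm \<psi>" unfolding Bt_def by (rule D(2)[OF t])
      then show "norm (A ?Y) \<le> a * (D * t\<^sup>2 * norm \<psi>)"
        using order_trans[OF a(2)[of ?Y] mult_left_mono[OF Y a(1)]] by simp
      have "Bt - B \<psi> = ?Y + t *\<^sub>R B' \<psi>" by simp
      then have "norm (Bt - B \<psi>) \<le> norm ?Y + norm (t *\<^sub>R B' \<psi>)" by (metis norm_triangle_ineq)
      also have "\<dots> \<le> D * t\<^sup>2 * norm \<psi> + \<bar>t\<bar> * (b' * norm \<psi>)"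
        using Y b'(2)[of \<psi>] by (intro add_mono) (auto intro: mult_left_mono)
      also have "\<dots> \<le> D * \<bar>t\<bar> * norm \<psi> + \<bar>t\<bar> * (b' * norm \<psi>)"
        using t2 D(1) by (intro add_right_mono mult_right_mono mult_left_mono) auto
      finally have "norm (Bt - B \<psi>) \<le> (D + b') * \<bar>t\<bar> * norm \<psi>" by (simp add: algebra_simps)
      then have "norm (A' (Bt - B \<psi>)) \<le> a' * ((D + b') * \<bar>t\<bar> * norm \<psi>)"
        using order_trans[OF a'(2) mult_left_mono[OF _ a'(1)]] by blast
      then have "\<bar>t\<bar> * norm (A' (Bt - B \<psi>)) \<le> \<bar>t\<bar> * (a' * ((D + b') * \<bar>t\<bar> * norm \<psi>))"
          by (rule mult_left_mono) simp
      also have "\<dots> = a' * ((D + b') * (\<bar>t\<bar> * \<bar>t\<bar>) * norm \<psi>)" by (simp only: mult_ac)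
      also have "\<bar>t\<bar> * \<bar>t\<bar> = t\<^sup>2" by (simp add: power2_eq_square)
      finally show "norm ?Z \<le> a' * ((D + b') * t\<^sup>2 * norm \<psi>)" by simp
    qed
    also have "\<dots> = (C * b + a * D + a' * (D + b')) * t\<^sup>2 * norm \<psi>" by (simp add: algebra_simps)
    finally show ?thesis .
  qed
  moreover have "0 \<le> C * b + a * D + a' * (D + b')" using C(1) D(1) a(1) b(1) a'(1) b'(1) by simp
  moreover have "bounded_clinear (\<lambda>\<psi>. A (B \<psi>))" "bounded_clinear (\<lambda>\<psi>. A' (B \<psi>) + A (B' \<psi>))"
    by (intro bounded_clinear_add bounded_clinear_compose[OF lin(1)] bounded_clinear_compose[OF lin(2)] lin)+
  ultimately show ?thesis unfolding weyl_derivation_def by blast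
qed

section \<open>Uniqueness of the derivative and its commutator form\<close>

lemma weyl_derivation_form_derivative:
  assumes "weyl_derivation z A B"
  shows "((\<lambda>t. cinner (weyl_unitary z t x) (A (weyl_unitary z t y)))
      has_vector_derivative cinner x (B y)) (at 0)"
proof -
  let ?W = "weyl_unitary z"
  obtain C where C: "0 \<le> C" "\<And>t \<psi>. \<bar>t\<bar> \<le> 1 \<Longrightarrow> norm (?W (- t) (A (?W t \<psi>)) - A \<psi> - t *\<^sub>R B \<psi>)
      \<le> C * t\<^sup>2 * norm \<psi>"
    using assms unfolding weyl_derivation_def by blast
  show ?thesis
  proof (rule has_vector_derivative_at_0_if_quadratic)
    fix t :: real assume t: "\<bar>t\<bar> \<le> 1"
    have "cinner (?W t x) (A (?W t y)) - cinner (?W 0 x) (A (?W 0 y)) - t *\<^sub>R cinner x (B y)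
        = cinner x (?W (- t) (A (?W t y)) - A y - t *\<^sub>R B y)"
      by (simp add: weyl_unitary_0 cinner.diff_right cinner.scaleR_right weyl_unitary_adjoint)
    also have "cmod \<dots> \<le> norm x * norm (?W (- t) (A (?W t y)) - A y - t *\<^sub>R B y)" by (rule norm_cinner_le)
    also have "\<dots> \<le> norm x * (C * t\<^sup>2 * norm y)" by (rule mult_left_mono[OF C(2)[OF t]]) simp
    finally show "norm (cinner (?W t x) (A (?W t y)) - cinner (?W 0 x) (A (?W 0 y)) - t *\<^sub>R cinner x (B y))
        \<le> (norm x * C * norm y) * t\<^sup>2" by (simp only: mult_ac)
  qed
qed

text \<open>The matrix elements of B are derivatives at 0 of functions that depend on A
  alone.\<close>

lemma weyl_derivation_unique:
  assumes "weyl_derivation z A B" "weyl_derivation z A B'"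
  shows "B y = B' y"
  by (rule cinner_eqI, rule vector_derivative_unique_at[OF weyl_derivation_form_derivative[OF assms(1)]
        weyl_derivation_form_derivative[OF assms(2)]])

text \<open>The derivation is the commutator with the field operator generating the Weyl group, whose
  action on exponential vectors is \<open>weyl_taylor z k 1\<close>.\<close>

lemma weyl_derivation_commutator:
  assumes AB: "weyl_derivation z A B"
  shows "cinner (expvec k) (B (expvec l)) = cinner (weyl_taylor z k 1) (A (expvec l))
      + cinner (expvec k) (A (weyl_taylor z l 1))"
proof -
  have A: "bounded_linear A" using AB by (simp add: weyl_derivation_def bounded_clinear_def)
  have wd: "((\<lambda>t. weyl_vec z t k) has_vector_derivative weyl_taylor z k 1) (at 0)" for k
  proof -
    obtain C where C: "\<And>t N. \<bar>t\<bar> \<le> 1 \<Longrightarrow> norm (weyl_vec z t k - (\<Sum>n<N. t ^ n *\<^sub>R weyl_taylor z k n))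
        \<le> C * (\<bar>t\<bar> / 2) ^ N"
      using weyl_taylor_remainder[of z k] by blast
    have "weyl_vec z 0 k = weyl_taylor z k 0"
      using weyl_unitary(3)[of z 0 k] by (simp add: weyl_unitary_0 weyl_taylor_0)
    \<comment> \<open>The remainder after two Taylor terms; the factor 1 / 4 comes from (t /
      2)^2.\<close>
    then have "norm (weyl_vec z t k - weyl_vec z 0 k - t *\<^sub>R weyl_taylor z k 1) \<le> (C / 4) * t\<^sup>2"
        if "\<bar>t\<bar> \<le> 1" for t
      using C[OF that, of 2] by (simp add: numeral_2_eq_2 diff_diff_eq power_divide)
    then show ?thesis by (rule has_vector_derivative_at_0_if_quadratic)
  qed
  have "((\<lambda>t. cinner (weyl_vec z t k) (A (weyl_vec z t l))) has_vector_derivative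
      cinner (weyl_vec z 0 k) (A (weyl_taylor z l 1)) + cinner (weyl_taylor z k 1) (A (weyl_vec z 0 l))) (at 0)"
    by (rule cinner.has_vector_derivative[OF wd bounded_linear.has_vector_derivative[OF A wd]])
  moreover have "((\<lambda>t. cinner (weyl_vec z t k) (A (weyl_vec z t l)))
      has_vector_derivative cinner (expvec k) (B (expvec l))) (at 0)"
    using weyl_derivation_form_derivative[OF AB, of "expvec k" "expvec l"] by (simp only: weyl_unitary(3))
  moreover have "weyl_vec z 0 k = expvec k" for k using weyl_unitary(3)[of z 0 k]
      by (simp add: weyl_unitary_0)
  ultimately show ?thesis using vector_derivative_unique_at by (metis add.commute)
qed

section \<open>The derivation operator\<close>

lemma fst_scaleC [simp]: "fst (c *\<^sub>C p) = c *\<^sub>C fst p"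
  and snd_scaleC [simp]: "snd (c *\<^sub>C p) = c *\<^sub>C snd p"
  by (simp_all add: scaleC_prod_def)

text \<open>The arguments make the pair (\<open>symplectic_x\<close>, \<open>symplectic_y\<close>)
  select one coordinate: it is (<x, h_1>, 0) for z = - (i / 2) x and (0, <x, h_2>) for z = x / 2.
  These are the factors of the x-components of the two tensors in the derivative of a generator; the
  Leibniz rules carry the identification to the whole algebra.\<close>

lemma deriv_graph_components:
  fixes x :: "'a::{real_inner, polish_space}"
  assumes "deriv_graph A A'" and x: "x \<in> hbasis"
  shows "weyl_derivation (Cpx 0 (- (1/2) *\<^sub>R x)) A (\<lambda>\<psi>. Rep_fock_h (fst (A' \<psi>)) x) \<and>
    weyl_derivation (Cpx ((1/2) *\<^sub>R x) 0) A (\<lambda>\<psi>. Rep_fock_h (snd (A' \<psi>)) x)"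
  using assms(1)
proof (induction rule: deriv_graph.induct)
  case (gen \<phi> h)
  have h: "hinner (of_h x) (of_h y) = of_real (inner x y)" for y
    by (simp add: hinner_def of_h_def complex_eq_iff)
  have "(\<lambda>\<psi>. Rep_fock_h (fst (O_op h (partial_x \<phi>) \<psi> \<otimes>\<^sub>h of_h (fst h), O_op h (partial_y \<phi>) \<psi> \<otimes>\<^sub>h of_h (snd h))) x)
      = O_deriv (Cpx 0 (- (1/2) *\<^sub>R x)) h \<phi>"
    "(\<lambda>\<psi>. Rep_fock_h (snd (O_op h (partial_x \<phi>) \<psi> \<otimes>\<^sub>h of_h (fst h), O_op h (partial_y \<phi>) \<psi> \<otimes>\<^sub>h of_h (snd h))) x)
      = O_deriv (Cpx ((1/2) *\<^sub>R x) 0) h \<phi>"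
    using x by (simp_all add: fun_eq_iff tensor_h.rep_eq O_deriv_def symplectic_x_def symplectic_y_def h scaleR_scaleC[symmetric])
  then show ?case by (simp only: weyl_derivation_O_op[OF gen])
next
  case (add A A' B B')
  then show ?case
    using weyl_derivation_add[of _ A _ B] by (auto simp: plus_fock_h.rep_eq)
next
  case (scale A A' c)
  then show ?case using weyl_derivation_scaleC[of _ A] by (auto simp: scaleC_fock_h.rep_eq)
next
  case (mult A A' B B')
  then have "bounded_clinear A" by (simp add: weyl_derivation_def)
  with mult show ?case
    using weyl_derivation_compose[of _ A _ B] by (auto simp: plus_fock_h.rep_eq ampliation.rep_eq o_def)
qed

lemma fock_h_eqI: "(\<And>x. x \<in> hbasis \<Longrightarrow> Rep_fock_h F x = Rep_fock_h G x) \<Longrightarrow> F = G"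
  using Rep_fock_h[of F] Rep_fock_h[of G]
  by (force simp: Rep_fock_h_inject[symmetric] fun_eq_iff fock_h_coeffs_def)

text \<open>An operator may be built from generators in many ways, but each basis component of its
  derivative is determined by \<open>weyl_derivation_unique\<close>.\<close>

lemma deriv_graph_unique:
  assumes "deriv_graph A A'" "deriv_graph A A''" shows "A' = A''"
proof
  fix \<psi>
  show "A' \<psi> = A'' \<psi>"
    using weyl_derivation_unique[OF deriv_graph_components[OF assms(1), THEN conjunct1] deriv_graph_components[OF assms(2), THEN conjunct1], of _ \<psi>]
      weyl_derivation_unique[OF deriv_graph_components[OF assms(1), THEN conjunct2] deriv_graph_components[OF assms(2), THEN conjunct2], of _ \<psi>]
    by (intro prod_eqI fock_h_eqI)
qed

lemma deriv_graph_exists: "A \<in> smooth_ops \<Longrightarrow> \<exists>A'. deriv_graph A A'"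
  by (induction rule: smooth_ops.induct) (blast intro: deriv_graph.intros)+

lemma deriv_graph_deriv_op:
  assumes "A \<in> smooth_ops" shows "deriv_graph A (deriv_op A)"
proof -
  obtain A' where A': "deriv_graph A A'" using deriv_graph_exists[OF assms] by blast
  show ?thesis unfolding deriv_op_def
    by (rule theI[of "deriv_graph A", OF A']) (rule deriv_graph_unique[OF _ A'])
qed

text \<open>For x in \<open>hbasis\<close> this is the elementary tensor of \<psi> and x, a test
  vector that picks out the component along x.\<close>

definition fock_h_single :: "'a::{real_inner, polish_space} \<Rightarrow> 'a fock \<Rightarrow> 'a fock_h" where
  "fock_h_single x \<psi> = Abs_fock_h (\<lambda>y. if y = x then \<psi> else 0)"

lemma cinner_fock_h_single:
  assumes x: "x \<in> hbasis" shows "cinner (fock_h_single x \<psi>) F = cinner \<psi> (Rep_fock_h F x)"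
proof -
  have "square_summable (\<lambda>y. if y = x then \<psi> else 0)"
    unfolding square_summable_def
  proof (rule has_sum_imp_summable)
    show "((\<lambda>y. (norm (if y = x then \<psi> else 0))\<^sup>2) has_sum (norm \<psi>)\<^sup>2) UNIV"
      by (rule has_sum_finite_neutralI[of "{x}"]) auto
  qed
  then have "(\<lambda>y. if y = x then \<psi> else 0) \<in> fock_h_coeffs" using x by (auto simp: fock_h_coeffs_def)
  then have R: "Rep_fock_h (fock_h_single x \<psi>) = (\<lambda>y. if y = x then \<psi> else 0)"
    by (simp add: fock_h_single_def Abs_fock_h_inverse)
  show ?thesis unfolding cinner_fock_h.rep_eq R
    by (rule infsumI, rule has_sum_finite_neutralI[of "{x}"]) (auto simp: cinner.zero_left)
qed

text \<open>The commutator formula moves the derivation onto \<open>weyl_taylor z k 1\<close> and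
  \<open>weyl_taylor z l 1\<close>. These vectors do not depend on n, so weak convergence of the
  operators makes the matrix elements tend to 0.\<close>

lemma weak_limit_component_eq_0:
  fixes T :: "nat \<Rightarrow> 'a::{real_inner, polish_space} fock \<Rightarrow> 'a fock"
  assumes A0: "weak_op_tendsto A (\<lambda>_. 0)" and T: "\<And>n. weyl_derivation z (A n) (T n)"
    and lim: "\<And>k. (\<lambda>n. cinner (expvec k) (T n (expvec l))) \<longlonglongrightarrow> cinner (expvec k) y"
  shows "y = 0"
proof (rule expvec_total)
  fix k
  have "(\<lambda>n. cinner (weyl_taylor z k 1) (A n (expvec l)) + cinner (expvec k) (A n (weyl_taylor z l 1)))
      \<longlonglongrightarrow> cinner (weyl_taylor z k 1) 0 + cinner (expvec k) 0"
    using A0 unfolding weak_op_tendsto_def by (intro tendsto_add) blast+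
  then have "(\<lambda>n. cinner (expvec k) (T n (expvec l))) \<longlonglongrightarrow> 0"
    by (simp add: weyl_derivation_commutator[OF T] cinner.zero_right)
  then show "cinner (expvec k) y = 0" using lim LIMSEQ_unique by blast
qed

text \<open>The first conjunct justifies the definite description in \<open>deriv_op\<close>. For
  the second, density of the exponential vectors and the test vectors \<open>fock_h_single\<close>
  reduce the vanishing of the weak limit to its basis components on a single exponential
  vector.\<close>

theorem corollary6p5p11:
  shows "(\<forall>A\<in>(smooth_ops :: ('a::{real_inner, polish_space} fock \<Rightarrow> 'a fock) set).
            \<exists>!A'. deriv_graph A A') \<and>
         weakly_closable (smooth_ops :: ('a fock \<Rightarrow> 'a fock) set) deriv_op"
proof (intro conjI ballI)
  fix A :: "'a fock \<Rightarrow> 'a fock" assume "A \<in> smooth_ops"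
  then show "\<exists>!A'. deriv_graph A A'" using deriv_graph_exists deriv_graph_unique by blast
next
  show "weakly_closable (smooth_ops :: ('a fock \<Rightarrow> 'a fock) set) deriv_op"
    unfolding weakly_closable_def
  proof (intro allI impI)
    fix A :: "nat \<Rightarrow> 'a fock \<Rightarrow> 'a fock" and \<alpha> :: "'a fock \<Rightarrow> 'a fock_h \<times> 'a fock_h"
    assume A: "\<forall>n. A n \<in> smooth_ops" and \<alpha>: "bounded_clinear \<alpha>"
      and A0: "weak_op_tendsto A (\<lambda>_. 0)" and D: "weak_op_tendsto (\<lambda>n. deriv_op (A n)) \<alpha>"
    have G: "deriv_graph (A n) (deriv_op (A n))" for n using A by (simp add: deriv_graph_deriv_op)
    have lim: "(\<lambda>n. cinner p (deriv_op (A n) \<psi>)) \<longlonglongrightarrow> cinner p (\<alpha> \<psi>)" for p \<psi>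
      using D unfolding weak_op_tendsto_def by blast
    have "\<alpha> (expvec l) = 0" for l
    proof (rule prod_eqI; rule fock_h_eqI)
      fix x :: 'a assume x: "x \<in> hbasis"
      have "Rep_fock_h (fst (\<alpha> (expvec l))) x = 0"
        by (rule weak_limit_component_eq_0[OF A0 deriv_graph_components[OF G x, THEN conjunct1]])
          (use lim[of "(fock_h_single x (expvec _), 0)" "expvec l"] in
            \<open>simp add: cinner_prod_def cinner.zero_left cinner_fock_h_single[OF x]\<close>)
      then show "Rep_fock_h (fst (\<alpha> (expvec l))) x = Rep_fock_h (fst 0) x" by (simp add: zero_fock_h.rep_eq)
      have "Rep_fock_h (snd (\<alpha> (expvec l))) x = 0"
        by (rule weak_limit_component_eq_0[OF A0 deriv_graph_components[OF G x, THEN conjunct2]])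
          (use lim[of "(0, fock_h_single x (expvec _))" "expvec l"] in
            \<open>simp add: cinner_prod_def cinner.zero_left cinner_fock_h_single[OF x]\<close>)
      then show "Rep_fock_h (snd (\<alpha> (expvec l))) x = Rep_fock_h (snd 0) x" by (simp add: zero_fock_h.rep_eq)
    qed
    moreover have "bounded_clinear (\<lambda>_::'a fock. 0 :: 'a fock_h \<times> 'a fock_h)"
      unfolding bounded_clinear_def by (simp add: bounded_linear_zero)
    ultimately show "\<alpha> = (\<lambda>_. 0)"
      using \<alpha> by (intro bounded_linear_eq_on_dense[OF _ _ expvec_dense]) auto
  qed
qed

end
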